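(* The following two assertions are equivalent: (1) (the Jacobian Conjecture $JC(n)$ holds for all $n$) for every integer $n\ge 1$, every polynomial morphism $F:\mathbb{C}^n\to\mathbb{C}^n$ such that $F'(x)\neq 0$ for all $x\in\mathbb{C}^n$ is an isomorphism, i.e. possesses an inverse mapping which is also given by polynomials; (2) ($JN(n)$ holds for all $n$) for every integer $n\ge 1$, every nilpotent morphism $N:\mathbb{C}^n\to\mathbb{C}^n$ possesses at most one fixed point.
   Context: A morphism $F:\mathbb{C}^n\to\mathbb{C}^n$ is a mapping given by $n$ polynomials $F_1,\dots,F_n\in\mathbb{C}[X_1,\dots,X_n]$. Its Jacobi matrix is $JF=\left(\frac{\partial F_i}{\partial X_j}\right)_{1\le i,j\le n}$, and $F'(X)=\det JF(X)$. A morphism $N=(N_1,\dots,N_n):\mathbb{C}^n\to\mathbb{C}^n$ is called nilpotent if $JN(X)$ is a nilpotent matrix, i.e. $(JN(X))^n\equiv 0$ in the ring of $n\times n$ matrices over $\mathbb{C}[X_1,\dots,X_n]$. A fixed point of $N$ is a point $x\in\mathbb{C}^n$ with $N(x)=x$. *)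

theory Defs
  imports "HOL-Library.Poly_Mapping" "HOL.Complex" "Jordan_Normal_Form.Determinant"
begin

text \<open>
  Polynomials in the variables \<open>X\<^sub>0, X\<^sub>1, \<dots>\<close> are finitely supported maps from monomials to
  coefficients, and monomials are finitely supported maps from variable indices to exponents. The
  ring operations are those of \<^theory>\<open>HOL-Library.Poly_Mapping\<close>. The number \<open>n\<close> of variables is
  a term, not a type, and the ring in \<open>n\<close> variables is the carrier set \<open>polys n\<close>.
\<close>

type_synonym cpoly = "(nat \<Rightarrow>\<^sub>0 nat) \<Rightarrow>\<^sub>0 complex"

definition polys :: "nat \<Rightarrow> cpoly set" where
  "polys n = {p. \<forall>m \<in> Poly_Mapping.keys p. Poly_Mapping.keys m \<subseteq> {..<n}}"

definition eval_poly :: "complex vec \<Rightarrow> cpoly \<Rightarrow> complex" where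
  "eval_poly x p = (\<Sum>m \<in> Poly_Mapping.keys p.
     Poly_Mapping.lookup p m * (\<Prod>i \<in> Poly_Mapping.keys m. (x $ i) ^ Poly_Mapping.lookup m i))"

text \<open>
  Subtraction of monomials is truncated, but where it truncates the coefficient is \<open>0\<close>.
\<close>

definition partial_deriv :: "nat \<Rightarrow> cpoly \<Rightarrow> cpoly" where
  "partial_deriv j p = (\<Sum>m \<in> Poly_Mapping.keys p.
     Poly_Mapping.single (m - Poly_Mapping.single j 1)
       (of_nat (Poly_Mapping.lookup m j) * Poly_Mapping.lookup p m))"

text \<open>
  A morphism is kept as its tuple of polynomials; \<open>eval_morphism\<close> is the map it induces on points.
  Since \<open>\<complex>\<close> is infinite, the induced map determines the tuple.
\<close>

definition morphism :: "nat \<Rightarrow> cpoly vec \<Rightarrow> bool" where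
  "morphism n F \<longleftrightarrow> F \<in> carrier_vec n \<and> (\<forall>i<n. F $ i \<in> polys n)"

definition eval_morphism :: "cpoly vec \<Rightarrow> complex vec \<Rightarrow> complex vec" where
  "eval_morphism F x = map_vec (eval_poly x) F"

definition jacobi_mat :: "cpoly vec \<Rightarrow> cpoly mat" where
  "jacobi_mat F = mat (dim_vec F) (dim_vec F) (\<lambda>(i, j). partial_deriv j (F $ i))"

definition jacobian :: "cpoly vec \<Rightarrow> cpoly" where
  "jacobian F = det (jacobi_mat F)"

definition isomorphism :: "nat \<Rightarrow> cpoly vec \<Rightarrow> bool" where
  "isomorphism n F \<longleftrightarrow> morphism n F \<and>
     (\<exists>G. morphism n G \<and>
       (\<forall>x \<in> carrier_vec n. eval_morphism G (eval_morphism F x) = x \<and>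
                            eval_morphism F (eval_morphism G x) = x))"

definition nilpotent_morphism :: "nat \<Rightarrow> cpoly vec \<Rightarrow> bool" where
  "nilpotent_morphism n N \<longleftrightarrow> morphism n N \<and> jacobi_mat N ^\<^sub>m n = 0\<^sub>m n n"

definition fixed_point :: "nat \<Rightarrow> cpoly vec \<Rightarrow> complex vec \<Rightarrow> bool" where
  "fixed_point n N x \<longleftrightarrow> x \<in> carrier_vec n \<and> eval_morphism N x = x"

definition JC :: "nat \<Rightarrow> bool" where
  "JC n \<longleftrightarrow> (\<forall>F. morphism n F \<and> (\<forall>x \<in> carrier_vec n. eval_poly x (jacobian F) \<noteq> 0)
                \<longrightarrow> isomorphism n F)"

definition JN :: "nat \<Rightarrow> bool" where
  "JN n \<longleftrightarrow> (\<forall>N. nilpotent_morphism n N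
                \<longrightarrow> (\<forall>x y. fixed_point n N x \<and> fixed_point n N y \<longrightarrow> x = y))"

end

theory Submission
  imports "Jordan_Normal_Form.Schur_Decomposition" "HOL-Computational_Algebra.Field_as_Ring"
    "HOL-Analysis.Continuum_Not_Denumerable"
    "HOL-Library.Function_Algebras" Defs
begin

text \<open>
  If \<open>N\<close> is nilpotent, then \<open>X - N\<close> has Jacobian \<open>1\<close>, so (1) makes it injective, and the fixed points of \<open>N\<close>
  are its zeros.

  For the converse let \<open>F\<close> have a nonvanishing Jacobian, normalised so that \<open>F = X + H\<^sub>2 + \<dots> + H\<^sub>d\<close> with
  \<open>H\<^sub>k\<close> homogeneous of degree \<open>k\<close>. In the variables \<open>(x, y\<^sub>1, \<dots>)\<close> the map \<open>(H\<^sub>2 - y\<^sub>1, H\<^sub>3 - y\<^sub>2, \<dots>, H\<^sub>d)\<close> is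
  nilpotent, and the points of a fibre of \<open>F\<close> are the fixed points of a translate of its negative. So (2) makes
  \<open>F\<close> injective.

  It remains to see that an injective \<open>F\<close> with nonvanishing Jacobian has a polynomial inverse. Write
  \<open>F(x) - F(z) = A(x,z)(x - z)\<close>. The polynomials \<open>F\<^sub>j(x) - F\<^sub>j(z)\<close> and \<open>det A\<close> have no common zero, so by the
  Nullstellensatz and Cramer's rule the \<open>x\<^sub>i - z\<^sub>i\<close> lie in the ideal of the \<open>F\<^sub>j(x) - F\<^sub>j(z)\<close>. Applying to the
  \<open>z\<close>-part a functional that is linear over the polynomials in \<open>F\<close> shows that \<open>x\<^sub>i\<close> is a rational function of
  \<open>F\<close>. A reduced denominator vanishes nowhere on the image of \<open>F\<close>, where the quotient is polynomial in \<open>x\<close>; so its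
  composite with \<open>F\<close> is a polynomial without zeros, hence constant.
\<close>

section \<open>Polynomial functions\<close>

text \<open>Polynomials are taken as functions of points indexed by all natural numbers, so that
  composition, restriction to lines and a change of the number of variables cost nothing. The
  obstacle is that reduced fractions and Gauss's lemma ask for divisibility in many variables. It is
  met on lines: one direction \<open>v\<close> is singled out, polynomials are expanded along
  \<open>v\<close> with coefficients constant along \<open>v\<close>, and divisibility between such
  coefficients is checked on every line through one point, where Gauss's lemma over one variable
  applies. Accordingly no fraction is reduced outright: a denominator of least degree along
  \<open>v\<close> turns out constant along \<open>v\<close>, and together with one that is monic
  along \<open>v\<close> it forces the fraction to be a polynomial. Density of the image and
  avoidance of zeros come from Taylor coefficients: the inverse Jacobian matrix is polynomial, so
  each constant derivation of the target lifts to the source. In the nilpotent map the variables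
  \<open>y\<close> stagger the homogeneous parts, so that an eigenvalue enters each block with one
  more power; these powers amount to rescaling the point at which the Jacobian matrix is
  taken.\<close>

type_synonym point = "nat \<Rightarrow> complex"

text \<open>Functions instead of formal polynomials lose nothing, as the field is infinite; the
  bridge to the formal ring is built near the end. Coordinates from \<open>n\<close> on exist but
  are ignored, so \<open>n\<close> stays a term and may grow.\<close>

inductive polyfun :: "nat \<Rightarrow> (point \<Rightarrow> complex) \<Rightarrow> bool" for n where
  const [intro!, simp]: "polyfun n (\<lambda>_. c)"
| var [intro]: "i < n \<Longrightarrow> polyfun n (\<lambda>x. x i)"
| add [intro]: "polyfun n f \<Longrightarrow> polyfun n g \<Longrightarrow> polyfun n (\<lambda>x. f x + g x)"
| mult [intro]: "polyfun n f \<Longrightarrow> polyfun n g \<Longrightarrow> polyfun n (\<lambda>x. f x * g x)"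

lemma polyfun_uminus [intro]: "polyfun n f \<Longrightarrow> polyfun n (\<lambda>x. - f x)"
  using polyfun.mult [OF polyfun.const [of n "-1"], of f] by simp

lemma polyfun_diff [intro]: "polyfun n f \<Longrightarrow> polyfun n g \<Longrightarrow> polyfun n (\<lambda>x. f x - g x)"
  using polyfun.add [OF _ polyfun_uminus, of n f g] by simp

lemma polyfun_sum [intro]: "(\<And>a. a \<in> A \<Longrightarrow> polyfun n (f a)) \<Longrightarrow> polyfun n (\<lambda>x. \<Sum>a\<in>A. f a x)"
  by (induction A rule: infinite_finite_induct) auto

lemma polyfun_prod [intro]: "(\<And>a. a \<in> A \<Longrightarrow> polyfun n (f a)) \<Longrightarrow> polyfun n (\<lambda>x. \<Prod>a\<in>A. f a x)"
  by (induction A rule: infinite_finite_induct) auto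

lemma polyfun_power [intro]: "polyfun n f \<Longrightarrow> polyfun n (\<lambda>x. f x ^ k)"
  by (induction k) auto

lemma polyfun_compose:
  assumes "polyfun n g" "\<And>i. i < n \<Longrightarrow> polyfun m (\<lambda>x. f x i)"
  shows "polyfun m (\<lambda>x. g (f x))"
  using assms by (induction rule: polyfun.induct) auto

lemma polyfun_cong: "polyfun n f \<Longrightarrow> (\<And>i. i < n \<Longrightarrow> x i = y i) \<Longrightarrow> f x = f y"
  by (induction rule: polyfun.induct) auto

lemma polyfun_mono: "polyfun n f \<Longrightarrow> n \<le> m \<Longrightarrow> polyfun m f"
  by (induction rule: polyfun.induct) auto

lemma polyfun_det:
  assumes "\<And>i j. i < m \<Longrightarrow> j < m \<Longrightarrow> polyfun n (\<lambda>x. A x i j)"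
  shows "polyfun n (\<lambda>x. det (mat m m (\<lambda>(i, j). A x i j)))"
proof -
  have "polyfun n (\<lambda>x. \<Sum>p\<in>{p. p permutes {0..<m}}. signof p * (\<Prod>i = 0..<m. A x i (p i)))"
    by (intro polyfun_sum polyfun.mult polyfun_prod assms) (auto simp: permutes_def)
  moreover have "(\<lambda>x. det (mat m m (\<lambda>(i, j). A x i j))) =
      (\<lambda>x. \<Sum>p\<in>{p. p permutes {0..<m}}. signof p * (\<Prod>i = 0..<m. A x i (p i)))"
  proof
    fix x
    show "det (mat m m (\<lambda>(i, j). A x i j)) =
      (\<Sum>p\<in>{p. p permutes {0..<m}}. signof p * (\<Prod>i = 0..<m. A x i (p i)))"
      by (subst det_def'[of _ m])
         (auto intro!: sum.cong prod.cong dest: permutes_in_image[of _ "{0..<m}"])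
  qed
  ultimately show ?thesis by simp
qed

section \<open>Restriction of polynomial functions to lines\<close>

definition shift :: "point \<Rightarrow> complex \<Rightarrow> point \<Rightarrow> point" where
  "shift y s v = (\<lambda>i. y i + s * v i)"

lemma shift_0 [simp]: "shift y 0 v = y"
  by (simp add: shift_def)

lemma shift_apply: "shift y s v i = y i + s * v i"
  by (simp add: shift_def)

lemma polyfun_shift [intro]: "polyfun n f \<Longrightarrow> polyfun n (\<lambda>x. f (shift x s v))"
  by (rule polyfun_compose) (auto simp: shift_def)

lemma polyfun_line: "polyfun n f \<Longrightarrow> \<exists>P. \<forall>s. f (shift y s v) = poly P s"
proof (induction rule: polyfun.induct)
  case (const c)
  show ?case by (rule exI[of _ "[:c:]"]) simp
next
  case (var i)
  show ?case by (rule exI[of _ "[:y i, v i:]"]) (simp add: shift_def)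
next
  case (add f g)
  then show ?case by (metis poly_add)
next
  case (mult f g)
  then show ?case by (metis poly_mult)
qed

text \<open>The line from \<open>x\<close> to \<open>z\<close> reduces this to the absence of zero
  divisors in one variable: the restriction of \<open>f\<close> is nonzero at parameter
  \<open>0\<close>, so that of \<open>g\<close> vanishes identically, also at parameter
  \<open>1\<close>.\<close>

lemma polyfun_mult_eq_0:
  assumes f: "polyfun n f" and g: "polyfun n g" and fg: "\<And>x. f x * g x = 0" and "f x \<noteq> 0"
  shows "g z = 0"
proof -
  define v where "v = (\<lambda>i. z i - x i)"
  obtain P Q where P: "\<And>s. f (shift x s v) = poly P s" and Q: "\<And>s. g (shift x s v) = poly Q s"
    using polyfun_line[OF f] polyfun_line[OF g] by metis
  have "poly (P * Q) s = 0" for s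
    using fg[of "shift x s v"] P[of s] Q[of s] by simp
  then have "P * Q = 0"
    by (metis poly_all_0_iff_0)
  moreover have "poly P 0 \<noteq> 0"
    using P[of 0] \<open>f x \<noteq> 0\<close> by simp
  ultimately have "Q = 0" by auto
  moreover have "shift x 1 v = z" by (simp add: shift_def v_def)
  ultimately show ?thesis using Q[of 1] by simp
qed

lemma polyfun_cancel:
  assumes "polyfun n b" "polyfun n f" "polyfun n g" "b y \<noteq> 0" "\<And>x. b x * f x = b x * g x"
  shows "f z = g z"
  using polyfun_mult_eq_0[of n b "\<lambda>x. f x - g x" y z] assms by (auto simp: algebra_simps)

text \<open>On the line joining \<open>x\<close> and \<open>z\<close> a nonconstant restriction
  would have a root.\<close>

lemma polyfun_nonvanishing_const:
  assumes f: "polyfun n f" and nz: "\<And>x. f x \<noteq> 0"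
  shows "f x = f z"
proof -
  define v where "v = (\<lambda>i. z i - x i)"
  obtain P where P: "\<And>s. f (shift x s v) = poly P s"
    using polyfun_line[OF f] by metis
  have "\<not> (\<exists>s. poly P s = 0)"
    using P nz by metis
  then have "constant (poly P)"
    using fundamental_theorem_of_algebra by blast
  then have "poly P 0 = poly P 1"
    by (simp add: constant_def)
  moreover have "shift x 1 v = z" by (simp add: shift_def v_def)
  ultimately show ?thesis using P[of 0] P[of 1] by simp
qed

section \<open>Derivatives\<close>

text \<open>Stated along arbitrary differentiable curves, this form survives the induction over
  \<open>polyfun\<close> and later serves both for lines and for composition with a polynomial
  map.\<close>

definition chain_rule :: "nat \<Rightarrow> (point \<Rightarrow> complex) \<Rightarrow> (nat \<Rightarrow> point \<Rightarrow> complex) \<Rightarrow> bool" where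
  "chain_rule n f f' \<longleftrightarrow> (\<forall>\<gamma> \<gamma>' s. (\<forall>i<n. ((\<lambda>s. \<gamma> s i) has_field_derivative \<gamma>' i) (at s)) \<longrightarrow>
      ((\<lambda>s. f (\<gamma> s)) has_field_derivative (\<Sum>j<n. \<gamma>' j * f' j (\<gamma> s))) (at s))"

lemma chain_ruleD:
  "chain_rule n f f' \<Longrightarrow> (\<And>i. i < n \<Longrightarrow> ((\<lambda>s. \<gamma> s i) has_field_derivative \<gamma>' i) (at s)) \<Longrightarrow>
    ((\<lambda>s. f (\<gamma> s)) has_field_derivative (\<Sum>j<n. \<gamma>' j * f' j (\<gamma> s))) (at s)"
  unfolding chain_rule_def by blast

lemma chain_rule_ex:
  "polyfun n f \<Longrightarrow> \<exists>f'. (\<forall>j. polyfun n (f' j)) \<and> chain_rule n f f'"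
proof (induction rule: polyfun.induct)
  case (const c)
  show ?case by (rule exI[of _ "\<lambda>_ _. 0"]) (simp add: chain_rule_def)
next
  case (var i)
  have "(\<Sum>j<n. g j * (if i = j then 1 else 0)) = g i" for g :: "nat \<Rightarrow> complex"
    using var by (simp add: if_distrib cong: if_cong)
  with var show ?case
    by (intro exI[of _ "\<lambda>j _. if i = j then 1 else 0"]) (simp add: chain_rule_def)
next
  case (add f g)
  then obtain f' g' where p: "\<forall>j. polyfun n (f' j)" "\<forall>j. polyfun n (g' j)"
    and d: "chain_rule n f f'" "chain_rule n g g'"
    by blast
  have "chain_rule n (\<lambda>x. f x + g x) (\<lambda>j x. f' j x + g' j x)"
    unfolding chain_rule_def
  proof (intro allI impI)
    fix \<gamma> :: "complex \<Rightarrow> point" and \<gamma>' s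
    assume a: "\<forall>i<n. ((\<lambda>s. \<gamma> s i) has_field_derivative \<gamma>' i) (at s)"
    show "((\<lambda>s. f (\<gamma> s) + g (\<gamma> s)) has_field_derivative
        (\<Sum>j<n. \<gamma>' j * (f' j (\<gamma> s) + g' j (\<gamma> s)))) (at s)"
      using DERIV_add[OF chain_ruleD[OF d(1)] chain_ruleD[OF d(2)], of \<gamma> \<gamma>' s \<gamma> \<gamma>'] a
      by (simp add: distrib_left sum.distrib)
  qed
  moreover have "\<forall>j. polyfun n (\<lambda>x. f' j x + g' j x)"
    using p polyfun.add by blast
  ultimately show ?case by (intro exI[of _ "\<lambda>j x. f' j x + g' j x"]) simp
next
  case (mult f g)
  then obtain f' g' where p: "\<forall>j. polyfun n (f' j)" "\<forall>j. polyfun n (g' j)"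
    and d: "chain_rule n f f'" "chain_rule n g g'"
    by blast
  have "chain_rule n (\<lambda>x. f x * g x) (\<lambda>j x. f' j x * g x + g' j x * f x)"
    unfolding chain_rule_def
  proof (intro allI impI)
    fix \<gamma> :: "complex \<Rightarrow> point" and \<gamma>' s
    assume a: "\<forall>i<n. ((\<lambda>s. \<gamma> s i) has_field_derivative \<gamma>' i) (at s)"
    have "(\<Sum>j<n. \<gamma>' j * (f' j (\<gamma> s) * g (\<gamma> s) + g' j (\<gamma> s) * f (\<gamma> s))) =
        (\<Sum>j<n. \<gamma>' j * f' j (\<gamma> s)) * g (\<gamma> s) + (\<Sum>j<n. \<gamma>' j * g' j (\<gamma> s)) * f (\<gamma> s)"
      unfolding sum_distrib_right sum.distrib[symmetric]
      by (rule sum.cong) (auto simp: algebra_simps)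
    then show "((\<lambda>s. f (\<gamma> s) * g (\<gamma> s)) has_field_derivative
        (\<Sum>j<n. \<gamma>' j * (f' j (\<gamma> s) * g (\<gamma> s) + g' j (\<gamma> s) * f (\<gamma> s)))) (at s)"
      using DERIV_mult[OF chain_ruleD[OF d(1)] chain_ruleD[OF d(2)], of \<gamma> \<gamma>' s \<gamma> \<gamma>'] a
      by simp
  qed
  moreover have "\<forall>j. polyfun n (\<lambda>x. f' j x * g x + g' j x * f x)"
    using p mult.hyps polyfun.add polyfun.mult by blast
  ultimately show ?case by (intro exI[of _ "\<lambda>j x. f' j x * g x + g' j x * f x"]) simp
qed

definition pd :: "nat \<Rightarrow> (point \<Rightarrow> complex) \<Rightarrow> point \<Rightarrow> complex" where
  "pd j f x = (THE D. ((\<lambda>s. f (x(j := s))) has_field_derivative D) (at (x j)))"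

lemma
  assumes f: "polyfun n f"
  shows polyfun_pd [intro]: "j < n \<Longrightarrow> polyfun n (pd j f)"
    and polyfun_chain: "(\<And>i. i < n \<Longrightarrow> ((\<lambda>s. \<gamma> s i) has_field_derivative \<gamma>' i) (at s0)) \<Longrightarrow>
      ((\<lambda>s. f (\<gamma> s)) has_field_derivative (\<Sum>j<n. \<gamma>' j * pd j f (\<gamma> s0))) (at s0)"
proof -
  obtain f' where f': "\<forall>j. polyfun n (f' j)" and d: "chain_rule n f f'"
    using chain_rule_ex[OF f] by blast
  have eq: "pd j f x = f' j x" if "j < n" for j x
  proof -
    have "((\<lambda>s. (x(j := s)) i) has_field_derivative (if i = j then 1 else 0)) (at (x j))" for i
      by auto
    then have "((\<lambda>s. f (x(j := s))) has_field_derivative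
        (\<Sum>i<n. (if i = j then 1 else 0) * f' i (x(j := x j)))) (at (x j))"
      by (rule chain_ruleD[OF d])
    also have "(\<Sum>i<n. (if i = j then 1 else 0) * f' i (x(j := x j))) = f' j x"
      using that by (simp add: if_distrib if_distribR cong: if_cong)
    finally have D: "((\<lambda>s. f (x(j := s))) has_field_derivative f' j x) (at (x j))" .
    show ?thesis
      unfolding pd_def using D DERIV_unique by blast
  qed
  then show "polyfun n (pd j f)" if "j < n"
    using f' that by (metis ext)
  show "((\<lambda>s. f (\<gamma> s)) has_field_derivative (\<Sum>j<n. \<gamma>' j * pd j f (\<gamma> s0))) (at s0)"
    if "\<And>i. i < n \<Longrightarrow> ((\<lambda>s. \<gamma> s i) has_field_derivative \<gamma>' i) (at s0)"
    using chain_ruleD[OF d, of \<gamma> \<gamma>' s0] that eq by simp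
qed

section \<open>Directional derivatives and Taylor coefficients on lines\<close>

definition dird :: "nat \<Rightarrow> point \<Rightarrow> (point \<Rightarrow> complex) \<Rightarrow> point \<Rightarrow> complex" where
  "dird n v f x = (\<Sum>j<n. v j * pd j f x)"

lemma polyfun_dird [intro]: "polyfun n f \<Longrightarrow> polyfun n (dird n v f)"
  unfolding dird_def[abs_def] by (intro polyfun_sum polyfun.mult polyfun.const polyfun_pd) auto

lemma DERIV_shift:
  assumes "polyfun n f"
  shows "((\<lambda>s. f (shift x s v)) has_field_derivative dird n v f (shift x s v)) (at s)"
  unfolding dird_def
  by (rule polyfun_chain[OF assms]) (auto simp: shift_def intro!: derivative_eq_intros)

text \<open>The sum, product and coordinate rules come from exhibiting some derivative along the
  line and appealing to uniqueness.\<close>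

lemma dird_unique:
  assumes "polyfun n f" "((\<lambda>s. f (shift x s v)) has_field_derivative D) (at 0)"
  shows "dird n v f x = D"
  using DERIV_unique[OF DERIV_shift[OF assms(1), of x v 0] assms(2)] by simp

lemma DERIV_shift_0:
  "polyfun n f \<Longrightarrow> ((\<lambda>s. f (shift x s v)) has_field_derivative dird n v f x) (at 0)"
  using DERIV_shift[of n f x v 0] by simp

lemma dird_add:
  assumes "polyfun n f" "polyfun n g"
  shows "dird n v (\<lambda>x. f x + g x) x = dird n v f x + dird n v g x"
  by (rule dird_unique[OF polyfun.add[OF assms] DERIV_add[OF DERIV_shift_0[OF assms(1)] DERIV_shift_0[OF assms(2)]]])

lemma dird_mult:
  assumes "polyfun n f" "polyfun n g"
  shows "dird n v (\<lambda>x. f x * g x) x = dird n v f x * g x + f x * dird n v g x"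
  using dird_unique[OF polyfun.mult[OF assms] DERIV_mult[OF DERIV_shift_0[OF assms(1)] DERIV_shift_0[OF assms(2)]]]
  by (simp add: mult_ac)

lemma dird_const [simp]: "dird n v (\<lambda>_. c) x = 0"
  by (rule dird_unique) auto

lemma dird_var: "i < n \<Longrightarrow> dird n v (\<lambda>x. x i) x = v i"
  by (rule dird_unique) (auto simp: shift_def intro!: derivative_eq_intros)

lemma dird_cmult: "polyfun n f \<Longrightarrow> dird n v (\<lambda>x. c * f x) x = c * dird n v f x"
  by (simp add: dird_mult)

lemma dird_sum: "(\<And>a. a \<in> A \<Longrightarrow> polyfun n (f a)) \<Longrightarrow>
    dird n v (\<lambda>x. \<Sum>a\<in>A. f a x) x = (\<Sum>a\<in>A. dird n v (f a) x)"
  by (induction A rule: infinite_finite_induct) (auto simp: dird_add polyfun_sum)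

lemma dird_cong: "(\<And>i. i < n \<Longrightarrow> v i = w i) \<Longrightarrow> dird n v f x = dird n w f x"
  by (simp add: dird_def)

lemma dird_pow_line:
  assumes "polyfun n f" "\<And>s. f (shift y s v) = poly P s"
  shows "polyfun n ((dird n v ^^ a) f) \<and> (\<forall>s. (dird n v ^^ a) f (shift y s v) = poly ((pderiv ^^ a) P) s)"
proof (induction a)
  case 0
  then show ?case using assms by simp
next
  case (Suc a)
  let ?g = "(dird n v ^^ a) f"
  have "dird n v ?g (shift y s v) = poly (pderiv ((pderiv ^^ a) P)) s" for s
  proof -
    have "((\<lambda>s. ?g (shift y s v)) has_field_derivative dird n v ?g (shift y s v)) (at s)"
      using Suc DERIV_shift by blast
    moreover have "((\<lambda>s. ?g (shift y s v)) has_field_derivative poly (pderiv ((pderiv ^^ a) P)) s) (at s)"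
      using Suc poly_DERIV[of "(pderiv ^^ a) P" s] by simp
    ultimately show ?thesis by (rule DERIV_unique)
  qed
  with Suc show ?case by (auto simp: polyfun_dird)
qed

text \<open>Up to factorials, the iterated derivatives at \<open>y\<close> are the coefficients of
  the restriction of \<open>f\<close> to the line; if all vanished, so would the
  restriction.\<close>

lemma dird_pow_nonzero:
  assumes f: "polyfun n f" and "f (shift y s v) \<noteq> 0"
  shows "\<exists>a. (dird n v ^^ a) f y \<noteq> 0"
proof (rule ccontr)
  assume none: "\<not> ?thesis"
  obtain P where P: "\<And>s. f (shift y s v) = poly P s"
    using polyfun_line[OF f] by metis
  have "coeff P a = 0" for a
  proof -
    have "(dird n v ^^ a) f (shift y 0 v) = poly ((pderiv ^^ a) P) 0"
      using dird_pow_line[OF f P] by blast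
    then have "coeff ((pderiv ^^ a) P) 0 = 0"
      using none by (simp add: poly_0_coeff_0)
    moreover have "coeff ((pderiv ^^ a) P) 0 = fact a * coeff P a"
      unfolding coeff_higher_pderiv pochhammer_fact by simp
    ultimately show ?thesis by simp
  qed
  then have "P = 0" by (simp add: poly_eq_iff)
  then show False using P[of s] assms(2) by simp
qed

section \<open>Homogeneous components\<close>

text \<open>The zero function is a form of every degree. The rule \<open>var\<close> adds one
  coordinate at a time, so induction follows the monomials.\<close>

inductive form :: "nat \<Rightarrow> nat \<Rightarrow> (point \<Rightarrow> complex) \<Rightarrow> bool" for n where
  zero [intro!]: "form n m (\<lambda>_. 0)"
| const [intro!]: "form n 0 (\<lambda>_. c)"
| var: "form n m f \<Longrightarrow> i < n \<Longrightarrow> form n (Suc m) (\<lambda>x. x i * f x)"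
| add [intro]: "form n m f \<Longrightarrow> form n m g \<Longrightarrow> form n m (\<lambda>x. f x + g x)"

lemma form_polyfun: "form n m f \<Longrightarrow> polyfun n f"
  by (induction rule: form.induct) auto

lemma form_cmult: "form n m f \<Longrightarrow> form n m (\<lambda>x. c * f x)"
proof (induction rule: form.induct)
  case (var m f i)
  from form.var[OF var.IH var.hyps(2)] show ?case by (simp add: mult_ac)
qed (auto simp: distrib_left)

lemma form_mult: "form n m f \<Longrightarrow> form n k g \<Longrightarrow> form n (m + k) (\<lambda>x. f x * g x)"
proof (induction rule: form.induct)
  case (var m f i)
  from form.var[OF var.IH[OF var.prems] var.hyps(2)] show ?case by (simp add: mult_ac)
qed (auto simp: distrib_right form_cmult)

lemma form_sum: "(\<And>a. a \<in> A \<Longrightarrow> form n m (f a)) \<Longrightarrow> form n m (\<lambda>x. \<Sum>a\<in>A. f a x)"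
  by (induction A rule: infinite_finite_induct) auto

lemma form_scale: "form n m f \<Longrightarrow> f (\<lambda>i. t * x i) = t ^ m * f x"
  by (induction rule: form.induct) (auto simp: algebra_simps)

text \<open>The components are indexed by all degrees and vanish beyond \<open>d\<close>, so the
  bound can be raised and products can be written as Cauchy sums.\<close>

definition graded :: "nat \<Rightarrow> nat \<Rightarrow> (nat \<Rightarrow> point \<Rightarrow> complex) \<Rightarrow> (point \<Rightarrow> complex) \<Rightarrow> bool" where
  "graded n d h f \<longleftrightarrow> (\<forall>m. form n m (h m)) \<and> (\<forall>m x. d < m \<longrightarrow> h m x = 0) \<and> (\<forall>x. f x = (\<Sum>m\<le>d. h m x))"

lemma gradedD:
  assumes "graded n d h f"
  shows "form n m (h m)" "d < m \<Longrightarrow> h m x = 0" "f x = (\<Sum>m\<le>d. h m x)"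
  using assms unfolding graded_def by auto

lemma graded_mono:
  assumes "graded n d h f" "d \<le> e"
  shows "graded n e h f"
proof -
  have "(\<Sum>m\<le>d. h m x) = (\<Sum>m\<le>e. h m x)" for x
    using assms by (intro sum.mono_neutral_left) (auto simp: graded_def)
  with assms show ?thesis by (auto simp: graded_def)
qed

lemma polyfun_graded: "polyfun n f \<Longrightarrow> \<exists>d h. graded n d h f"
proof (induction rule: polyfun.induct)
  case (const c)
  have "graded n 0 (\<lambda>m _. if m = 0 then c else 0) (\<lambda>_. c)"
    unfolding graded_def by auto
  then show ?case by blast
next
  case (var i)
  have "form n 1 (\<lambda>x. x i * 1)"
    using form.var[OF form.const[of n 1] var] by simp
  then have "form n m (\<lambda>x. if m = 1 then x i else 0)" for m
    by (cases "m = 1") auto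
  then have "graded n 1 (\<lambda>m x. if m = 1 then x i else 0) (\<lambda>x. x i)"
    unfolding graded_def by simp
  then show ?case by blast
next
  case (add f g)
  then obtain d h e k where "graded n d h f" "graded n e k g" by blast
  then have "graded n (max d e) h f" "graded n (max d e) k g"
    by (auto intro: graded_mono)
  then have "graded n (max d e) (\<lambda>m x. h m x + k m x) (\<lambda>x. f x + g x)"
    unfolding graded_def by (auto simp: sum.distrib)
  then show ?case by blast
next
  case (mult f g)
  then obtain d h e k where g: "graded n d h f" "graded n e k g" by blast
  have "graded n (d + e) (\<lambda>m x. \<Sum>l\<le>m. h l x * k (m - l) x) (\<lambda>x. f x * g x)"
    unfolding graded_def
  proof (intro conjI allI impI)
    fix m
    show "form n m (\<lambda>x. \<Sum>l\<le>m. h l x * k (m - l) x)"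
      using form_mult[OF gradedD(1)[OF g(1)] gradedD(1)[OF g(2)]]
      by (intro form_sum) (metis atMost_iff le_add_diff_inverse)
  next
    fix m x assume "d + e < m"
    then have "h l x = 0 \<or> k (m - l) x = 0" if "l \<le> m" for l
      using gradedD(2)[OF g(1), of l x] gradedD(2)[OF g(2), of "m - l" x] that by linarith
    then show "(\<Sum>l\<le>m. h l x * k (m - l) x) = 0"
      by (intro sum.neutral) auto
  next
    fix x
    show "f x * g x = (\<Sum>m\<le>d + e. \<Sum>l\<le>m. h l x * k (m - l) x)"
      using polynomial_product[of d "\<lambda>m. h m x" e "\<lambda>m. k m x" 1] g
      by (simp add: graded_def)
  qed
  then show ?case by blast
qed

lemma graded_scale:
  assumes "graded n d h f"
  shows "f (\<lambda>i. t * x i) = (\<Sum>m\<le>d. h m x * t ^ m)"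
  by (simp add: gradedD(3)[OF assms] form_scale[OF gradedD(1)[OF assms]] mult_ac)

section \<open>Divisibility tested on lines\<close>

text \<open>Coefficients of the power series quotient of \<open>a\<close> by \<open>b\<close>,
  solved recursively from the Cauchy product; \<open>b 0\<close> will be a nonzero constant, which
  keeps them polynomial in the point.\<close>

fun quot_coeff :: "(nat \<Rightarrow> point \<Rightarrow> complex) \<Rightarrow> (nat \<Rightarrow> point \<Rightarrow> complex) \<Rightarrow> nat \<Rightarrow> point \<Rightarrow> complex" where
  "quot_coeff a b j = (\<lambda>x. (a j x - (\<Sum>l<j. quot_coeff a b l x * b (j - l) x)) / b 0 x)"

declare quot_coeff.simps [simp del]

lemma polyfun_quot_coeff:
  assumes "\<And>j. polyfun n (a j)" "\<And>j. polyfun n (b j)" "\<And>x. b 0 x = c"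
  shows "polyfun n (quot_coeff a b j)"
proof (induction j rule: less_induct)
  case (less j)
  have "polyfun n (\<lambda>x. (a j x - (\<Sum>l<j. quot_coeff a b l x * b (j - l) x)) * inverse c)"
    by (intro polyfun.mult polyfun_diff polyfun_sum assms less polyfun.const) auto
  then show ?case
    by (subst quot_coeff.simps) (simp add: assms(3) divide_inverse)
qed

text \<open>On each line through the origin the coefficients of the quotient obey the power series
  recursion, hence depend polynomially on the direction, and there are at most \<open>d + 1\<close>
  of them. Their sum, the value at parameter \<open>1\<close>, is a global quotient.\<close>

lemma line_divides_0:
  assumes a: "polyfun n a" and b: "polyfun n b" and nz: "b (\<lambda>_. 0) \<noteq> 0"
    and ex: "\<And>u. \<exists>g. \<forall>t. a (\<lambda>i. t * u i) = b (\<lambda>i. t * u i) * poly g t"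
  shows "\<exists>g. polyfun n g \<and> (\<forall>x. a x = b x * g x)"
proof -
  obtain d A where A: "graded n d A a" using polyfun_graded[OF a] by blast
  obtain e B where B: "graded n e B b" using polyfun_graded[OF b] by blast
  have B0: "B 0 x = b (\<lambda>_. 0)" for x
    using graded_scale[OF B, of 0 x] by (simp add: sum.atMost_shift)
  define G where "G = quot_coeff A B"
  have G: "polyfun n (G j)" for j
    unfolding G_def using B0 gradedD(1)[OF A] gradedD(1)[OF B]
    by (intro polyfun_quot_coeff) (auto intro: form_polyfun)
  have "a u = b u * (\<Sum>j\<le>d. G j u)" for u
  proof -
    obtain g where g: "\<And>t. a (\<lambda>i. t * u i) = b (\<lambda>i. t * u i) * poly g t"
      using ex[of u] by auto
    define P where "P = (\<Sum>m\<le>d. monom (A m u) m)"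
    define Q where "Q = (\<Sum>m\<le>e. monom (B m u) m)"
    have "poly P t = poly (Q * g) t" for t
      using g[of t] by (simp add: P_def Q_def poly_sum poly_monom graded_scale[OF A] graded_scale[OF B])
    then have PQ: "P = Q * g" by (intro poly_ext)
    have cP: "coeff P j = A j u" for j
      using gradedD(2)[OF A, of j u] by (auto simp: P_def coeff_sum)
    have cQ: "coeff Q j = B j u" for j
      using gradedD(2)[OF B, of j u] by (auto simp: Q_def coeff_sum)
    have cg: "coeff g j = G j u" for j
    proof (induction j rule: less_induct)
      case (less j)
      have "A j u = (\<Sum>l\<le>j. coeff g l * B (j - l) u)"
        unfolding cP[symmetric] PQ mult.commute[of Q] coeff_mult cQ ..
      also have "\<dots> = (\<Sum>l<j. G l u * B (j - l) u) + coeff g j * B 0 u"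
        using less by (simp add: lessThan_Suc_atMost[symmetric])
      finally show ?case
        using nz B0 unfolding G_def by (subst quot_coeff.simps) (simp add: field_simps)
    qed
    have "degree P \<le> d"
      by (rule degree_le) (use cP gradedD(2)[OF A] in auto)
    moreover have "Q \<noteq> 0" using cQ[of 0] nz B0 by auto
    ultimately have dg: "degree g \<le> d"
      using PQ degree_mult_eq[of Q g] by (cases "g = 0") auto
    have "poly g 1 = (\<Sum>j\<le>d. coeff g j)"
    proof -
      have "poly g 1 = (\<Sum>j\<le>degree g. coeff g j)"
        by (simp add: poly_altdef)
      also have "\<dots> = (\<Sum>j\<le>d. coeff g j)"
        using dg by (intro sum.mono_neutral_left) (auto simp: coeff_eq_0)
      finally show ?thesis .
    qed
    with g[of 1] cg show ?thesis by simp
  qed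
  moreover have "polyfun n (\<lambda>x. \<Sum>j\<le>d. G j x)"
    using G by (intro polyfun_sum)
  ultimately show ?thesis by blast
qed

lemma line_divides:
  assumes a: "polyfun n a" and b: "polyfun n b" and nz: "b y \<noteq> 0"
    and ex: "\<And>u. \<exists>g. \<forall>t. a (shift y t u) = b (shift y t u) * poly g t"
  shows "\<exists>g. polyfun n g \<and> (\<forall>x. a x = b x * g x)"
proof -
  have *: "polyfun n (\<lambda>x. f (\<lambda>i. x i + y i))" "polyfun n (\<lambda>x. f (\<lambda>i. x i - y i))" if "polyfun n f" for f
    by (rule polyfun_compose[OF that], auto)+
  have "\<exists>g. polyfun n g \<and> (\<forall>x. a (\<lambda>i. x i + y i) = b (\<lambda>i. x i + y i) * g x)"
    by (rule line_divides_0) (use *(1)[OF a] *(1)[OF b] nz ex in \<open>auto simp: shift_def add_ac\<close>)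
  then obtain g where g: "polyfun n g" "\<And>x. a (\<lambda>i. x i + y i) = b (\<lambda>i. x i + y i) * g x" by blast
  have "a x = b x * g (\<lambda>i. x i - y i)" for x
    using g(2)[of "\<lambda>i. x i - y i"] by simp
  with *(2)[OF g(1)] show ?thesis by blast
qed

section \<open>Expansion along a direction\<close>

text \<open>Takes the place of the polynomials in the remaining coordinates once \<open>v\<close> is
  regarded as a coordinate direction.\<close>

definition invariant :: "point \<Rightarrow> (point \<Rightarrow> complex) \<Rightarrow> bool" where
  "invariant v f \<longleftrightarrow> (\<forall>y s. f (shift y s v) = f y)"

text \<open>
  Choosing a direction \<open>v\<close> with \<open>v k = 1\<close> replaces a linear change of coordinates: polynomials are
  written in powers of the \<open>k\<close>-th coordinate, with coefficients that do not change along \<open>v\<close>.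
\<close>

definition expansion :: "nat \<Rightarrow> nat \<Rightarrow> point \<Rightarrow> nat \<Rightarrow> (nat \<Rightarrow> point \<Rightarrow> complex) \<Rightarrow> (point \<Rightarrow> complex) \<Rightarrow> bool" where
  "expansion n k v d c f \<longleftrightarrow> (\<forall>j. polyfun n (c j) \<and> invariant v (c j)) \<and> (\<forall>y. f y = (\<Sum>j<d. c j y * y k ^ j))"

lemma invariant_intros [intro]:
  "invariant v (\<lambda>_. a)"
  "invariant v f \<Longrightarrow> invariant v g \<Longrightarrow> invariant v (\<lambda>x. f x + g x)"
  "invariant v f \<Longrightarrow> invariant v g \<Longrightarrow> invariant v (\<lambda>x. f x - g x)"
  "invariant v f \<Longrightarrow> invariant v g \<Longrightarrow> invariant v (\<lambda>x. f x * g x)"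
  "invariant v f \<Longrightarrow> invariant v (\<lambda>x. f x ^ m)"
  by (auto simp: invariant_def)

lemma expansion_mono:
  assumes "expansion n k v d c f" "d \<le> e"
  shows "expansion n k v e (\<lambda>j x. if j < d then c j x else 0) f"
proof -
  have "(\<Sum>j<d. c j y * y k ^ j) = (\<Sum>j<e. (if j < d then c j y else 0) * y k ^ j)" for y :: point
    using assms by (intro sum.mono_neutral_cong_left) auto
  moreover have "polyfun n (\<lambda>x. if j < d then c j x else 0) \<and> invariant v (\<lambda>x. if j < d then c j x else 0)" for j
    using assms by (cases "j < d") (auto simp: expansion_def)
  ultimately show ?thesis using assms by (simp add: expansion_def)
qed

lemma expansion_add:
  assumes "expansion n k v d c f" "expansion n k v d c' g"
  shows "expansion n k v d (\<lambda>j x. c j x + c' j x) (\<lambda>x. f x + g x)"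
  using assms unfolding expansion_def
  by (auto simp: distrib_right sum.distrib)

lemma expansion_diff:
  assumes "expansion n k v d c f" "expansion n k v d c' g"
  shows "expansion n k v d (\<lambda>j x. c j x - c' j x) (\<lambda>x. f x - g x)"
  using assms unfolding expansion_def
  by (auto simp: left_diff_distrib sum_subtractf)

lemma expansion_cmult:
  assumes "expansion n k v d c f" "polyfun n r" "invariant v r"
  shows "expansion n k v d (\<lambda>j x. r x * c j x) (\<lambda>x. r x * f x)"
  using assms unfolding expansion_def
  by (auto simp: sum_distrib_left mult_ac)

lemma expansion_shift:
  assumes "expansion n k v d c f"
  shows "expansion n k v (d + m) (\<lambda>j x. if j < m then 0 else c (j - m) x) (\<lambda>x. x k ^ m * f x)"
proof -
  have "y k ^ m * (\<Sum>j<d. c j y * y k ^ j) = (\<Sum>j<d + m. (if j < m then 0 else c (j - m) y) * y k ^ j)" for y :: point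
  proof -
    have "y k ^ m * (\<Sum>j<d. c j y * y k ^ j) = (\<Sum>j\<in>{0..<d}. c j y * y k ^ (j + m))"
      by (simp add: sum_distrib_left power_add mult_ac lessThan_atLeast0)
    also have "\<dots> = (\<Sum>j\<in>{0 + m..<d + m}. c (j - m) y * y k ^ j)"
      by (subst sum.shift_bounds_nat_ivl) simp
    also have "\<dots> = (\<Sum>j<d + m. (if j < m then 0 else c (j - m) y) * y k ^ j)"
      by (rule sum.mono_neutral_cong_left) auto
    finally show ?thesis .
  qed
  moreover have "polyfun n (\<lambda>x. if j < m then 0 else c (j - m) x) \<and> invariant v (\<lambda>x. if j < m then 0 else c (j - m) x)" for j
    using assms by (cases "j < m") (auto simp: expansion_def)
  ultimately show ?thesis using assms by (simp add: expansion_def)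
qed

lemma expansion_polyfun: "expansion n k v d c f \<Longrightarrow> k < n \<Longrightarrow> polyfun n f"
  unfolding expansion_def
  by (subst ext[of f "\<lambda>y. \<Sum>j<d. c j y * y k ^ j"])
     (auto intro!: polyfun_sum polyfun.mult polyfun_power polyfun.var)

text \<open>Far out along \<open>v\<close>, a form of degree \<open>m\<close> grows like
  \<open>f v\<close> times the \<open>m\<close>-th power of the parameter, so \<open>f v\<close> is
  its top coefficient. The length of an expansion is exclusive: length \<open>m\<close> means degree
  below \<open>m\<close>.\<close>

lemma form_expansion:
  assumes k: "k < n" "v k = 1"
  shows "form n m f \<Longrightarrow> \<exists>c. expansion n k v m c (\<lambda>y. f y - f v * y k ^ m)"
proof (induction rule: form.induct)
  case (zero m)
  have "expansion n k v m (\<lambda>_ _. 0) (\<lambda>y. 0 - 0 * y k ^ m)"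
    by (auto simp: expansion_def)
  then show ?case by blast
next
  case (const c)
  have "expansion n k v 0 (\<lambda>_ _. 0) (\<lambda>y. c - c * y k ^ 0)"
    by (auto simp: expansion_def)
  then show ?case by blast
next
  case (var m f i)
  then obtain c where c: "expansion n k v m c (\<lambda>y. f y - f v * y k ^ m)" by blast
  \<comment> \<open>Subtracting \<open>v i\<close> times the \<open>k\<close>-th coordinate makes
    the \<open>i\<close>-th one constant along \<open>v\<close>; this uses
    \<open>v k = 1\<close>.\<close>
  define r where "r = (\<lambda>y :: point. y i - v i * y k)"
  have r: "polyfun n r" "invariant v r"
    unfolding r_def
    by (intro polyfun_diff polyfun.mult polyfun.const polyfun.var var k)
       (simp add: invariant_def shift_def k algebra_simps)
  have 1: "expansion n k v (Suc m) (\<lambda>j x. r x * (if j < m then c j x else if j = m then f v else 0)) (\<lambda>x. r x * f x)"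
  proof (rule expansion_cmult[OF _ r])
    show "expansion n k v (Suc m) (\<lambda>j x. if j < m then c j x else if j = m then f v else 0) f"
      unfolding expansion_def
    proof (intro conjI allI)
      fix j
      have cj: "polyfun n (c j)" "invariant v (c j)"
        using c unfolding expansion_def by blast+
      show "polyfun n (\<lambda>x. if j < m then c j x else if j = m then f v else 0)"
        "invariant v (\<lambda>x. if j < m then c j x else if j = m then f v else 0)"
        using cj by (cases "j < m"; cases "j = m"; auto)+
    next
      fix y
      have "f y - f v * y k ^ m = (\<Sum>j<m. c j y * y k ^ j)"
        using c unfolding expansion_def by blast
      then have "f y = (\<Sum>j<m. c j y * y k ^ j) + f v * y k ^ m"
        by (simp add: diff_eq_eq)
      then show "f y = (\<Sum>j<Suc m. (if j < m then c j y else if j = m then f v else 0) * y k ^ j)"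
        by simp
    qed
  qed
  have "expansion n k v (m + 1) (\<lambda>j x. if j < 1 then 0 else c (j - 1) x) (\<lambda>y. y k ^ 1 * (f y - f v * y k ^ m))"
    by (rule expansion_shift[OF c])
  then have 2: "expansion n k v (Suc m) (\<lambda>j x. v i * (if j < 1 then 0 else c (j - 1) x))
      (\<lambda>y. v i * (y k ^ 1 * (f y - f v * y k ^ m)))"
    using expansion_cmult[of n k v "m + 1" _ _ "\<lambda>_. v i"] by (simp add: invariant_def)
  have eq: "(\<lambda>y. y i * f y - v i * f v * y k ^ Suc m) = (\<lambda>y. r y * f y + v i * (y k ^ 1 * (f y - f v * y k ^ m)))"
    unfolding r_def by (rule ext) (simp add: algebra_simps)
  show ?case
    by (subst eq) (rule exI, rule expansion_add[OF 1 2])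
next
  case (add m f g)
  then obtain c c' where "expansion n k v m c (\<lambda>y. f y - f v * y k ^ m)"
    "expansion n k v m c' (\<lambda>y. g y - g v * y k ^ m)" by blast
  from expansion_add[OF this]
  have "expansion n k v m (\<lambda>j x. c j x + c' j x) (\<lambda>y. f y + g y - (f v + g v) * y k ^ m)"
    by (simp add: algebra_simps)
  then show ?case by blast
qed

lemma form_expansion':
  assumes k: "k < n" "v k = 1" and f: "form n m f"
  shows "\<exists>c. expansion n k v (Suc m) c f"
proof -
  obtain c where c: "expansion n k v m c (\<lambda>y. f y - f v * y k ^ m)"
    using form_expansion[of k n v, OF k f] by blast
  have "expansion n k v 1 (\<lambda>_ _. f v) (\<lambda>_. f v)"
    by (simp add: expansion_def invariant_def)
  from expansion_shift[OF this, of m]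
  have "expansion n k v (Suc m) (\<lambda>j x. if j < m then 0 else f v) (\<lambda>y. y k ^ m * f v)"
    by simp
  from expansion_add[OF expansion_mono[OF c, of "Suc m"] this]
  have "\<exists>c. expansion n k v (Suc m) c (\<lambda>y. f y - f v * y k ^ m + y k ^ m * f v)"
    by (intro exI) simp
  then show ?thesis by simp
qed

lemma graded_expansion:
  assumes k: "k < n" "v k = 1" and h: "\<And>m. form n m (h m)"
  shows "\<exists>c. expansion n k v d c (\<lambda>x. \<Sum>m<d. h m x)"
proof (induction d)
  case 0
  have "expansion n k v 0 (\<lambda>_ _. 0) (\<lambda>_. 0)" by (auto simp: expansion_def)
  then show ?case by auto
next
  case (Suc d)
  then obtain c where c: "expansion n k v d c (\<lambda>x. \<Sum>m<d. h m x)" by blast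
  obtain c' where c': "expansion n k v (Suc d) c' (h d)" using form_expansion'[of k n v, OF k h[of d]] by blast
  have "\<exists>c. expansion n k v (Suc d) c (\<lambda>x. (\<Sum>m<d. h m x) + h d x)"
    by (rule exI, rule expansion_add[OF expansion_mono[OF c] c']) simp
  then show ?case by simp
qed

lemma polyfun_expansion:
  assumes "k < n" "v k = 1" "polyfun n f"
  shows "\<exists>d c. expansion n k v d c f"
proof -
  obtain d h where h: "graded n d h f" using polyfun_graded[OF assms(3)] by blast
  have "f = (\<lambda>x. \<Sum>m<Suc d. h m x)"
    using gradedD(3)[OF h] by (auto simp: lessThan_Suc_atMost)
  then show ?thesis
    using graded_expansion[of k n v h "Suc d", OF assms(1,2) gradedD(1)[OF h]] by metis
qed

text \<open>As in Noether normalisation: in a direction where the component of top degree does not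
  vanish, the leading coefficient is constant, namely the value of that component at
  \<open>v\<close>. Rescaling the direction makes one of its coordinates \<open>1\<close>.\<close>

lemma polyfun_monic_direction:
  assumes f: "polyfun n f" and "f x \<noteq> 0" and n: "n \<ge> 1"
  shows "\<exists>k<n. \<exists>v m \<gamma> c. v k = 1 \<and> \<gamma> \<noteq> 0 \<and> expansion n k v m c (\<lambda>y. f y - \<gamma> * y k ^ m)"
proof -
  obtain d h where h: "graded n d h f" using polyfun_graded[OF f] by blast
  have ex: "\<exists>m\<le>d. \<exists>u. h m u \<noteq> 0"
    using gradedD(3)[OF h, of x] \<open>f x \<noteq> 0\<close> by (metis atMost_iff sum.neutral)
  define m where "m = (GREATEST m. m \<le> d \<and> (\<exists>u. h m u \<noteq> 0))"
  have m: "m \<le> d" "\<exists>u. h m u \<noteq> 0"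
    unfolding m_def using GreatestI_ex_nat[of "\<lambda>m. m \<le> d \<and> (\<exists>u. h m u \<noteq> 0)" d] ex by auto
  have top: "h l u = 0" if "m < l" for l u
    using that gradedD(2)[OF h, of l u] Greatest_le_nat[of "\<lambda>m. m \<le> d \<and> (\<exists>u. h m u \<noteq> 0)" l d]
    unfolding m_def by force
  have f_eq: "f y = (\<Sum>l<m. h l y) + h m y" for y
  proof -
    have "f y = (\<Sum>l\<le>d. h l y)" by (rule gradedD(3)[OF h])
    also have "\<dots> = (\<Sum>l\<le>m. h l y)"
      using m top by (intro sum.mono_neutral_right) auto
    finally show ?thesis by (simp add: lessThan_Suc_atMost[symmetric])
  qed
  obtain u where u: "h m u \<noteq> 0" using m by blast
  have "\<exists>k<n. \<exists>v. v k = 1 \<and> h m v \<noteq> 0"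
  proof (cases "\<exists>k<n. u k \<noteq> 0")
    case True
    then obtain k where k: "k < n" "u k \<noteq> 0" by blast
    have "h m (\<lambda>i. inverse (u k) * u i) \<noteq> 0"
      using form_scale[OF gradedD(1)[OF h], of m "inverse (u k)" u] u k by simp
    with k show ?thesis by (intro exI[of _ k] conjI exI[of _ "\<lambda>i. inverse (u k) * u i"]) auto
  next
    case False
    \<comment> \<open>A form that is nonzero at a point whose coordinates all vanish has degree
      \<open>0\<close>, so any direction will do; \<open>n \<ge> 1\<close> supplies the
      coordinate.\<close>
    then have "h m u = h m (\<lambda>i. 0 * u i)"
      by (intro polyfun_cong[OF form_polyfun[OF gradedD(1)[OF h]]]) auto
    with u form_scale[OF gradedD(1)[OF h], of m 0 u] have "m = 0" by (cases m) auto
    then have "h m (\<lambda>_. 1) = h m u"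
      using form_scale[OF gradedD(1)[OF h], of m 0 u] form_scale[OF gradedD(1)[OF h], of m 0 "\<lambda>_. 1"] by simp
    with n u show ?thesis by (intro exI[of _ 0] conjI exI[of _ "\<lambda>_. 1"]) auto
  qed
  then obtain k v where kv: "k < n" "v k = 1" "h m v \<noteq> 0" by blast
  obtain c where c: "expansion n k v m c (\<lambda>x. \<Sum>l<m. h l x)"
    using graded_expansion[of k n v h, OF kv(1,2) gradedD(1)[OF h]] by blast
  obtain c' where c': "expansion n k v m c' (\<lambda>y. h m y - h m v * y k ^ m)"
    using form_expansion[of k n v, OF kv(1,2) gradedD(1)[OF h, of m]] by blast
  have "(\<lambda>y. f y - h m v * y k ^ m) = (\<lambda>y. (\<Sum>l<m. h l y) + (h m y - h m v * y k ^ m))"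
    using f_eq by (simp add: fun_eq_iff)
  with expansion_add[OF c c'] have "expansion n k v m (\<lambda>j x. c j x + c' j x) (\<lambda>y. f y - h m v * y k ^ m)"
    by simp
  with kv show ?thesis by blast
qed

section \<open>The weak Nullstellensatz\<close>

interpretation funspace: vector_space "\<lambda>(a::complex) (f::point \<Rightarrow> complex) x. a * f x"
  by unfold_locales (auto simp: fun_eq_iff algebra_simps)

fun monomials :: "nat \<Rightarrow> nat \<Rightarrow> (point \<Rightarrow> complex) set" where
  "monomials n 0 = {\<lambda>_. 1}"
| "monomials n (Suc m) = (\<Union>i<n. (\<lambda>f x. x i * f x) ` monomials n m)"

lemma finite_monomials: "finite (monomials n m)"
  by (induction m) auto

lemma form_in_span: "form n m f \<Longrightarrow> f \<in> funspace.span (monomials n m)"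
proof (induction rule: form.induct)
  case (zero m)
  show ?case using funspace.span_zero by (simp add: zero_fun_def)
next
  case (const c)
  show ?case
    using funspace.span_scale[OF funspace.span_base[of "\<lambda>_. 1" "{\<lambda>_. 1}"], of c] by simp
next
  case (var m f i)
  have "(\<lambda>x. x i * g x) \<in> funspace.span (monomials n (Suc m))"
    if "g \<in> funspace.span (monomials n m)" for g
    using that
  proof (induction rule: funspace.span_induct_alt)
    case base
    show ?case using funspace.span_zero by (simp add: zero_fun_def)
  next
    case (step c b y)
    have "(\<lambda>x. x i * b x) \<in> monomials n (Suc m)"
      using step(1) var(2) by auto
    then have "(\<lambda>x. c * (x i * b x)) \<in> funspace.span (monomials n (Suc m))"
      by (intro funspace.span_scale funspace.span_base)
    from funspace.span_add[OF this step(2)] show ?case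
      by (simp add: plus_fun_def algebra_simps)
  qed
  with var.IH show ?case by blast
next
  case (add m f g)
  from funspace.span_add[OF add.IH] show ?case by (simp add: plus_fun_def)
qed

lemma graded_in_span:
  assumes "graded n d h f"
  shows "f \<in> funspace.span (\<Union>m\<le>d. monomials n m)"
proof -
  have "h m \<in> funspace.span (\<Union>m\<le>d. monomials n m)" if "m \<le> d" for m
    using form_in_span[OF gradedD(1)[OF assms], of m] that funspace.span_mono[of "monomials n m" "\<Union>m\<le>d. monomials n m"]
    by auto
  then have "(\<Sum>m\<le>d. h m) \<in> funspace.span (\<Union>m\<le>d. monomials n m)"
    by (intro funspace.span_sum) auto
  moreover have "f = (\<Sum>m\<le>d. h m)"
  proof
    fix x
    have "(\<Sum>m\<in>A. h m) x = (\<Sum>m\<in>A. h m x)" for A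
      by (induction A rule: infinite_finite_induct) auto
    then show "f x = (\<Sum>m\<le>d. h m) x" using gradedD(3)[OF assms] by simp
  qed
  ultimately show ?thesis by simp
qed

text \<open>Countably many degree bounds against uncountably many members: infinitely many share one
  bound and so lie in the span of finitely many monomials. Injectivity keeps them distinct as
  vectors.\<close>

lemma uncountable_family_dependent:
  assumes U: "\<And>l. polyfun n (U l)" and inj: "inj (U :: complex \<Rightarrow> point \<Rightarrow> complex)"
  shows "\<exists>T c l0. finite T \<and> l0 \<in> T \<and> c l0 \<noteq> 0 \<and> (\<forall>x. (\<Sum>l\<in>T. c l * U l x) = 0)"
proof -
  have "\<forall>l. \<exists>d. \<exists>h. graded n d h (U l)" using polyfun_graded[OF U] by blast
  then obtain D where D: "\<And>l. \<exists>h. graded n (D l) h (U l)" by metis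
  have "\<exists>d. infinite {l. D l = d}"
  proof (rule ccontr)
    assume "\<not> ?thesis"
    then have "countable (\<Union>d. {l. D l = d})"
      by (intro countable_UN) (auto intro: countable_finite)
    moreover have "(\<Union>d. {l. D l = d}) = (UNIV :: complex set)" by auto
    ultimately have "countable (range complex_of_real)"
      using countable_subset by (metis top_greatest)
    then have "countable (UNIV :: real set)"
      by (metis countable_image_inj_on inj_of_real)
    then show False using uncountable_UNIV_real by simp
  qed
  then obtain d where d: "infinite {l. D l = d}" by blast
  let ?S = "U ` {l. D l = d}" and ?M = "\<Union>m\<le>d. monomials n m"
  have "infinite ?S" using d inj by (metis finite_imageD inj_on_subset subset_UNIV)
  moreover have "?S \<subseteq> funspace.span ?M" using D graded_in_span by blast
  ultimately have "funspace.dependent ?S"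
    using funspace.independent_span_bound[of ?M ?S] finite_monomials by blast
  then obtain t u w where t: "finite t" "t \<subseteq> ?S" "(\<Sum>w\<in>t. (\<lambda>x. u w * w x)) = 0" "w \<in> t" "u w \<noteq> 0"
    unfolding funspace.dependent_explicit by blast
  obtain T where T: "T \<subseteq> {l. D l = d}" "t = U ` T" using t(2) by (metis subset_imageE)
  have fT: "finite T" using t(1) T inj by (metis finite_imageD inj_on_subset subset_UNIV)
  obtain l0 where l0: "l0 \<in> T" "w = U l0" using t(4) T by blast
  have "(\<Sum>l\<in>T. u (U l) * U l x) = 0" for x
  proof -
    have s: "(\<Sum>w\<in>A. (\<lambda>x. u w * w x)) x = (\<Sum>w\<in>A. u w * w x)" for A
      by (induction A rule: infinite_finite_induct) auto
    have "(\<Sum>l\<in>T. u (U l) * U l x) = (\<Sum>w\<in>t. u w * w x)"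
      unfolding T(2) using inj by (subst sum.reindex) (auto intro: inj_on_subset)
    also have "\<dots> = 0" using t(3) s[of t] by simp
    finally show ?thesis .
  qed
  with fT l0 t(5) show ?thesis by (intro exI[of _ T] exI[of _ "\<lambda>l. u (U l)"] exI[of _ l0]) auto
qed

section \<open>Ideals of polynomial functions and their common zeros\<close>

definition pideal :: "nat \<Rightarrow> (point \<Rightarrow> complex) set \<Rightarrow> bool" where
  "pideal n I \<longleftrightarrow> (\<forall>f\<in>I. polyfun n f) \<and> (\<lambda>_. 0) \<in> I \<and> (\<forall>f\<in>I. \<forall>g\<in>I. (\<lambda>x. f x + g x) \<in> I) \<and>
    (\<forall>f\<in>I. \<forall>h. polyfun n h \<longrightarrow> (\<lambda>x. h x * f x) \<in> I)"

lemma pidealD: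
  assumes "pideal n I"
  shows "f \<in> I \<Longrightarrow> polyfun n f" "(\<lambda>_. 0) \<in> I"
    "f \<in> I \<Longrightarrow> g \<in> I \<Longrightarrow> (\<lambda>x. f x + g x) \<in> I"
    "f \<in> I \<Longrightarrow> polyfun n h \<Longrightarrow> (\<lambda>x. h x * f x) \<in> I"
  using assms unfolding pideal_def by blast+

lemma pideal_sum:
  assumes I: "pideal n I" and "\<And>a. a \<in> A \<Longrightarrow> f a \<in> I"
  shows "(\<lambda>x. \<Sum>a\<in>A. f a x) \<in> I"
  using assms(2) by (induction A rule: infinite_finite_induct) (auto intro: pidealD[OF I])

lemma pideal_adjoin:
  assumes I: "pideal n I" and g: "polyfun n g"
  defines "J \<equiv> {\<lambda>x. f x + u x * g x |f u. f \<in> I \<and> polyfun n u}"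
  shows "pideal n J" "I \<subseteq> J" "g \<in> J"
proof -
  have J: "(\<lambda>x. f x + u x * g x) \<in> J" if "f \<in> I" "polyfun n u" for f u
    using that unfolding J_def by blast
  show "I \<subseteq> J"
  proof
    fix f assume "f \<in> I"
    from J[OF this polyfun.const[of n 0]] show "f \<in> J" by simp
  qed
  show "g \<in> J"
    using J[OF pidealD(2)[OF I] polyfun.const[of n 1]] by simp
  show "pideal n J"
    unfolding pideal_def
  proof (intro conjI ballI allI impI)
    fix f assume "f \<in> J"
    then obtain e u where "e \<in> I" "polyfun n u" "f = (\<lambda>x. e x + u x * g x)"
      unfolding J_def by blast
    then show "polyfun n f"
      using pidealD(1)[OF I] g by auto
  next
    show "(\<lambda>_. 0) \<in> J"
      using \<open>I \<subseteq> J\<close> pidealD(2)[OF I] by blast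
  next
    fix f1 f2 assume "f1 \<in> J" "f2 \<in> J"
    then obtain e1 u1 e2 u2 where e: "e1 \<in> I" "polyfun n u1" "f1 = (\<lambda>x. e1 x + u1 x * g x)"
      "e2 \<in> I" "polyfun n u2" "f2 = (\<lambda>x. e2 x + u2 x * g x)"
      unfolding J_def by blast
    from J[OF pidealD(3)[OF I e(1,4)] polyfun.add[OF e(2,5)]] show "(\<lambda>x. f1 x + f2 x) \<in> J"
      by (simp add: e algebra_simps)
  next
    fix f h assume "f \<in> J" and h: "polyfun n h"
    then obtain e u where e: "e \<in> I" "polyfun n u" "f = (\<lambda>x. e x + u x * g x)"
      unfolding J_def by blast
    from J[OF pidealD(4)[OF I e(1) h] polyfun.mult[OF h e(2)]] show "(\<lambda>x. h x * f x) \<in> J"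
      by (simp add: e algebra_simps)
  qed
qed

lemma polyfun_poly: "polyfun n f \<Longrightarrow> polyfun n (\<lambda>x. poly P (f x))"
  by (induction P) auto

text \<open>Modulo \<open>I\<close> each \<open>x k - l\<close> is invertible with inverse
  \<open>U l\<close>. So the linear factor at a root of \<open>P\<close> can be cancelled, and the
  descent ends with a nonzero constant in \<open>I\<close>.\<close>

lemma pideal_univariate:
  assumes I: "pideal n I" and k: "k < n"
    and U: "\<And>l. polyfun n (U l)" "\<And>l. (\<lambda>x. 1 - U l x * (x k - l)) \<in> I"
  shows "P \<noteq> 0 \<Longrightarrow> (\<lambda>x. poly P (x k)) \<in> I \<Longrightarrow> (\<lambda>_. 1) \<in> I"
proof (induction "degree P" arbitrary: P rule: less_induct)
  case less
  show ?case
  proof (cases "degree P = 0")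
    case True
    then obtain c where c: "P = [:c:]" by (metis degree_eq_zeroE)
    with less.prems have "c \<noteq> 0" by auto
    with pidealD(4)[OF I less.prems(2), of "\<lambda>_. 1 / c"] c show ?thesis by simp
  next
    case False
    then have "\<not> constant (poly P)" by (simp add: constant_degree)
    then obtain r where "poly P r = 0"
      using fundamental_theorem_of_algebra by blast
    then obtain Q where Q: "P = [:-r, 1:] * Q" by (metis dvdE poly_eq_0_iff_dvd)
    have "Q \<noteq> 0" using Q less.prems by auto
    then have deg: "degree Q < degree P"
      unfolding Q by (subst degree_mult_eq) auto
    have "(\<lambda>x. poly Q (x k) * (1 - U r x * (x k - r)) + U r x * poly P (x k)) \<in> I"
      using k by (intro pidealD(3,4)[OF I] U less.prems polyfun_poly polyfun.var)
    moreover have "(\<lambda>x. poly Q (x k) * (1 - U r x * (x k - r)) + U r x * poly P (x k)) = (\<lambda>x. poly Q (x k))"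
      by (rule ext) (simp add: Q algebra_simps)
    ultimately show ?thesis using less.hyps[OF deg \<open>Q \<noteq> 0\<close>] by simp
  qed
qed

text \<open>The argument for uncountable fields: were every \<open>x k - l\<close> invertible modulo
  \<open>I\<close>, the inverses would be linearly dependent, and clearing denominators in a
  dependence would put a nonzero polynomial in \<open>x k\<close> alone into
  \<open>I\<close>.\<close>

lemma pideal_adjoin_point:
  assumes I: "pideal n I" and proper: "(\<lambda>_. 1) \<notin> I" and k: "k < n"
  shows "\<exists>J l. pideal n J \<and> (\<lambda>_. 1) \<notin> J \<and> I \<subseteq> J \<and> (\<lambda>x. x k - l) \<in> J"
proof (rule ccontr)
  assume none: "\<not> ?thesis"
  have "\<exists>u. polyfun n u \<and> (\<lambda>x. 1 - u x * (x k - l)) \<in> I" for l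
  proof -
    have "polyfun n (\<lambda>x. x k - l)" using k by auto
    note J = pideal_adjoin[OF I this]
    from none J have "(\<lambda>_. 1) \<in> {\<lambda>x. f x + u x * (x k - l) |f u. f \<in> I \<and> polyfun n u}"
      by blast
    then obtain f u where fu: "(\<lambda>_. 1) = (\<lambda>x. f x + u x * (x k - l))" "f \<in> I" "polyfun n u"
      by blast
    have "f = (\<lambda>x. 1 - u x * (x k - l))"
      using fun_cong[OF fu(1)] by (intro ext) (metis add_diff_cancel_right')
    with fu show ?thesis by blast
  qed
  then obtain U where U: "\<And>l. polyfun n (U l)" "\<And>l. (\<lambda>x. 1 - U l x * (x k - l)) \<in> I"
    by metis
  have "inj U"
  proof (rule injI, rule ccontr)
    fix l m assume eq: "U l = U m" and "l \<noteq> m"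
    \<comment> \<open>This difference is \<open>U l x * (l - m)\<close>; multiplied by
      \<open>(x k - l) / (l - m)\<close> and added to the member for \<open>l\<close> it gives
      \<open>1\<close>.\<close>
    have a: "(\<lambda>x. (1 - U l x * (x k - l)) + (- 1) * (1 - U m x * (x k - m))) \<in> I"
      by (intro pidealD(3,4)[OF I] U polyfun.const)
    have "(\<lambda>x. (x k - l) / (l - m) * ((1 - U l x * (x k - l)) + (- 1) * (1 - U m x * (x k - m)))
        + (1 - U l x * (x k - l))) \<in> I"
      using k polyfun.mult[OF polyfun_diff[OF polyfun.var[OF k] polyfun.const] polyfun.const[of n "1 / (l - m)"]]
      by (intro pidealD(3)[OF I] pidealD(4)[OF I a] U) simp
    moreover have "(x k - l) / (l - m) * ((1 - U l x * (x k - l)) + (- 1) * (1 - U m x * (x k - m)))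
        + (1 - U l x * (x k - l)) = 1" for x
      using \<open>l \<noteq> m\<close> eq by (simp add: field_simps)
    ultimately show False using proper by simp
  qed
  then obtain T c l0 where T: "finite T" "l0 \<in> T" "c l0 \<noteq> 0" and dep: "\<And>x. (\<Sum>l\<in>T. c l * U l x) = 0"
    using uncountable_family_dependent[of n U, OF U(1)] by blast
  \<comment> \<open>The numerator of the sum of all \<open>c l / (X - l)\<close>; at
    \<open>l0\<close> every term but its own vanishes.\<close>
  define P where "P = (\<Sum>l\<in>T. smult (c l) (\<Prod>m\<in>T - {l}. [:-m, 1:]))"
  have "poly P l0 = c l0 * (\<Prod>m\<in>T - {l0}. l0 - m)"
  proof -
    have "poly P l0 = (\<Sum>l\<in>T. c l * (\<Prod>m\<in>T - {l}. l0 - m))"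
      by (simp add: P_def poly_sum poly_prod)
    also have "\<dots> = (\<Sum>l\<in>T. if l = l0 then c l0 * (\<Prod>m\<in>T - {l0}. l0 - m) else 0)"
      using T by (intro sum.cong) auto
    also have "\<dots> = c l0 * (\<Prod>m\<in>T - {l0}. l0 - m)"
      using T by simp
    finally show ?thesis .
  qed
  then have "P \<noteq> 0" using T by auto
  moreover have "(\<lambda>x. poly P (x k)) \<in> I"
  proof -
    have pp: "polyfun n (\<lambda>x. c l * (\<Prod>m\<in>T - {l}. x k - m))" for l
      by (intro polyfun.mult polyfun.const polyfun_prod polyfun_diff polyfun.var k)
    \<comment> \<open>Weighted like the terms of \<open>P\<close>, these members of \<open>I\<close>
      add up to \<open>P\<close> minus the full product times the dependence, and the latter is
      \<open>0\<close>.\<close>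
    have "(\<lambda>x. \<Sum>l\<in>T. c l * (\<Prod>m\<in>T - {l}. x k - m) * (1 - U l x * (x k - l))) \<in> I"
      by (intro pideal_sum[OF I] pidealD(4)[OF I] U pp)
    moreover have "(\<Sum>l\<in>T. c l * (\<Prod>m\<in>T - {l}. x k - m) * (1 - U l x * (x k - l))) = poly P (x k)" for x
    proof -
      have "(\<Sum>l\<in>T. c l * (\<Prod>m\<in>T - {l}. x k - m) * (1 - U l x * (x k - l))) =
          (\<Sum>l\<in>T. c l * (\<Prod>m\<in>T - {l}. x k - m) - (\<Prod>m\<in>T. x k - m) * (c l * U l x))"
      proof (rule sum.cong[OF refl])
        fix l assume "l \<in> T"
        then have "(\<Prod>m\<in>T. x k - m) = (x k - l) * (\<Prod>m\<in>T - {l}. x k - m)"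
          using T by (simp add: prod.remove)
        then show "c l * (\<Prod>m\<in>T - {l}. x k - m) * (1 - U l x * (x k - l)) =
            c l * (\<Prod>m\<in>T - {l}. x k - m) - (\<Prod>m\<in>T. x k - m) * (c l * U l x)"
          by (simp only:) (simp add: algebra_simps)
      qed
      also have "\<dots> = poly P (x k) - (\<Prod>m\<in>T. x k - m) * (\<Sum>l\<in>T. c l * U l x)"
        by (simp add: sum_subtractf sum_distrib_left P_def poly_sum poly_prod)
      finally show ?thesis using dep by simp
    qed
    ultimately show ?thesis by simp
  qed
  ultimately show False using pideal_univariate[OF I k U] proper by blast
qed

text \<open>The coordinates are fixed one at a time in a growing proper ideal. Once it contains all
  \<open>x i - l i\<close>, every polynomial is congruent to its value at \<open>l\<close>, so a
  member with nonzero value there would make the ideal improper.\<close>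

lemma weak_nullstellensatz:
  assumes I: "pideal n I" and proper: "(\<lambda>_. 1) \<notin> I"
  shows "\<exists>x. \<forall>f\<in>I. f x = 0"
proof -
  have "\<exists>J l. pideal n J \<and> (\<lambda>_. 1) \<notin> J \<and> I \<subseteq> J \<and> (\<forall>i<m. (\<lambda>x. x i - l i) \<in> J)" if "m \<le> n" for m
    using that
  proof (induction m)
    case 0
    then show ?case using I proper by blast
  next
    case (Suc m)
    then obtain J l where J: "pideal n J" "(\<lambda>_. 1) \<notin> J" "I \<subseteq> J" "\<And>i. i < m \<Longrightarrow> (\<lambda>x. x i - l i) \<in> J"
      by auto
    from pideal_adjoin_point[OF J(1,2), of m] Suc.prems
    obtain J' l' where J': "pideal n J'" "(\<lambda>_. 1) \<notin> J'" "J \<subseteq> J'" "(\<lambda>x. x m - l') \<in> J'"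
      by auto
    have "\<forall>i<Suc m. (\<lambda>x. x i - (l(m := l')) i) \<in> J'"
      using J J' by (auto simp: less_Suc_eq)
    with J J' show ?case by blast
  qed
  from this[of n] obtain J l where J: "pideal n J" "(\<lambda>_. 1) \<notin> J" "I \<subseteq> J" "\<And>i. i < n \<Longrightarrow> (\<lambda>x. x i - l i) \<in> J"
    by auto
  have diff: "(\<lambda>x. f x - f l) \<in> J" if "polyfun n f" for f
    using that
  proof (induction rule: polyfun.induct)
    case (const c)
    then show ?case using pidealD(2)[OF J(1)] by simp
  next
    case (var i)
    then show ?case using J by simp
  next
    case (add f g)
    from pidealD(3)[OF J(1) add.IH] show ?case by (simp add: algebra_simps)
  next
    case (mult f g)
    have "(\<lambda>x. g x * (f x - f l) + f l * (g x - g l)) \<in> J"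
      by (intro pidealD(3,4)[OF J(1)] mult polyfun.const)
    then show ?case by (simp add: algebra_simps)
  qed
  have "f l = 0" if f: "f \<in> I" for f
  proof (rule ccontr)
    assume nz: "f l \<noteq> 0"
    have "f \<in> J" "polyfun n f" using f J pidealD(1)[OF I] by auto
    then have "(\<lambda>x. 1 / f l * f x + (- 1 / f l) * (f x - f l)) \<in> J"
      by (intro pidealD(3,4)[OF J(1)] diff polyfun.const)
    then show False using nz J(2) by (simp add: field_simps)
  qed
  then show ?thesis by blast
qed

section \<open>Polynomial maps with nonvanishing Jacobian\<close>

text \<open>The entries of the adjugate are signed minors, hence polynomial; they are set to
  \<open>0\<close> outside the matrix so that \<open>polyfun\<close> holds for all indices.\<close>

lemma polyfun_adjugate:
  assumes A: "\<And>i j. i < m \<Longrightarrow> j < m \<Longrightarrow> polyfun n (\<lambda>x. A x i j)"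
  shows "\<exists>B. (\<forall>i j. polyfun n (B i j)) \<and>
    (\<forall>x. \<forall>i<m. \<forall>k<m. (\<Sum>j<m. A x i j * B j k x) = (if i = k then det (mat m m (\<lambda>(i, j). A x i j)) else 0) \<and>
      (\<Sum>j<m. B i j x * A x j k) = (if i = k then det (mat m m (\<lambda>(i, j). A x i j)) else 0))"
proof -
  define M where "M x = mat m m (\<lambda>(i, j). A x i j)" for x
  define B where "B i j = (\<lambda>x. if i < m \<and> j < m then adj_mat (M x) $$ (i, j) else 0)" for i j
  have M: "M x \<in> carrier_mat m m" for x by (simp add: M_def)
  have "polyfun n (B i j)" for i j
  proof (cases "i < m \<and> j < m")
    case True
    have "polyfun n (\<lambda>x. (-1) ^ (j + i) * det (mat (m - 1) (m - 1) (\<lambda>(i', j'). A x (if i' < j then i' else Suc i') (if j' < i then j' else Suc j'))))"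
      by (intro polyfun.mult polyfun.const polyfun_det A) auto
    moreover have "B i j x = (-1) ^ (j + i) * det (mat (m - 1) (m - 1) (\<lambda>(i', j'). A x (if i' < j then i' else Suc i') (if j' < i then j' else Suc j')))" for x
    proof -
      have "mat_delete (M x) j i = mat (m - 1) (m - 1) (\<lambda>(i', j'). A x (if i' < j then i' else Suc i') (if j' < i then j' else Suc j'))"
        unfolding mat_delete_def M_def by (rule eq_matI) auto
      then show ?thesis using True by (simp add: B_def adj_mat_def cofactor_def M_def)
    qed
    ultimately show ?thesis by presburger
  next
    case False
    then have "B i j = (\<lambda>_. 0)" by (auto simp: B_def)
    then show ?thesis by simp
  qed
  moreover have "(\<Sum>j<m. A x i j * B j k x) = (if i = k then det (M x) else 0) \<and>
      (\<Sum>j<m. B i j x * A x j k) = (if i = k then det (M x) else 0)" if "i < m" "k < m" for x i k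
  proof
    have "(\<Sum>j<m. A x i j * B j k x) = (M x * adj_mat (M x)) $$ (i, k)"
      using that M[of x] adj_mat(1)[OF M[of x]]
      by (simp add: scalar_prod_def B_def lessThan_atLeast0) (simp add: M_def)
    then show "(\<Sum>j<m. A x i j * B j k x) = (if i = k then det (M x) else 0)"
      using that adj_mat(2)[OF M[of x]] by simp
    have "(\<Sum>j<m. B i j x * A x j k) = (adj_mat (M x) * M x) $$ (i, k)"
      using that M[of x] adj_mat(1)[OF M[of x]]
      by (simp add: scalar_prod_def B_def lessThan_atLeast0) (simp add: M_def)
    then show "(\<Sum>j<m. B i j x * A x j k) = (if i = k then det (M x) else 0)"
      using that adj_mat(3)[OF M[of x]] by simp
  qed
  ultimately show ?thesis
    unfolding M_def by (intro exI[of _ B] conjI allI impI) simp_all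
qed

text \<open>A polynomial map of affine space with nonvanishing Jacobian is etale. The components
  from \<open>n\<close> on are arbitrary, which is harmless because polynomial functions of
  \<open>n\<close> variables ignore them.\<close>

locale etale =
  fixes n :: nat and f :: "nat \<Rightarrow> point \<Rightarrow> complex"
  assumes f: "i < n \<Longrightarrow> polyfun n (f i)"
    and det_nz: "det (mat n n (\<lambda>(i, j). pd j (f i) x)) \<noteq> 0"
begin

definition F :: "point \<Rightarrow> point" where
  "F x = (\<lambda>i. f i x)"

lemma polyfun_F [intro]: "polyfun n g \<Longrightarrow> polyfun n (\<lambda>x. g (F x))"
  by (rule polyfun_compose) (auto simp: F_def f)

text \<open>The determinant is a polynomial without zeros, hence a nonzero constant; dividing the
  adjugate by it keeps the entries polynomial.\<close>

lemma inverse_jacobian_ex: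
  "\<exists>C. (\<forall>i j. polyfun n (C i j)) \<and>
    (\<forall>x. \<forall>i<n. \<forall>k<n. (\<Sum>j<n. pd j (f i) x * C j k x) = (if i = k then 1 else 0) \<and>
      (\<Sum>j<n. C i j x * pd k (f j) x) = (if i = k then 1 else 0))"
proof -
  define d where "d = (\<lambda>x. det (mat n n (\<lambda>(i, j). pd j (f i) x)))"
  have pf: "polyfun n (\<lambda>x. pd j (f i) x)" if "i < n" "j < n" for i j
    using that f by auto
  obtain B where B: "\<And>i j. polyfun n (B i j)" and
    *: "\<And>x i k. i < n \<Longrightarrow> k < n \<Longrightarrow> (\<Sum>j<n. pd j (f i) x * B j k x) = (if i = k then d x else 0) \<and>
      (\<Sum>j<n. B i j x * pd k (f j) x) = (if i = k then d x else 0)"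
    using polyfun_adjugate[of n n "\<lambda>x i j. pd j (f i) x", OF pf] unfolding d_def by blast
  have "polyfun n d" unfolding d_def by (rule polyfun_det) (rule pf)
  then have const: "d x = d (\<lambda>_. 0)" for x
    using det_nz unfolding d_def by (rule polyfun_nonvanishing_const)
  have nz: "d (\<lambda>_. 0) \<noteq> 0" using det_nz by (simp add: d_def)
  define C where "C i j = (\<lambda>x. inverse (d (\<lambda>_. 0)) * B i j x)" for i j
  have "(\<Sum>j<n. pd j (f i) x * C j k x) = inverse (d (\<lambda>_. 0)) * (\<Sum>j<n. pd j (f i) x * B j k x)"
    "(\<Sum>j<n. C i j x * pd k (f j) x) = inverse (d (\<lambda>_. 0)) * (\<Sum>j<n. B i j x * pd k (f j) x)" for i k x
    by (simp_all add: C_def sum_distrib_left mult_ac)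
  moreover have "polyfun n (C i j)" for i j
    unfolding C_def by (intro polyfun.mult polyfun.const B)
  moreover have "inverse (d (\<lambda>_. 0)) * d x = 1" for x
    using const[of x] nz by simp
  ultimately show ?thesis using * by (intro exI[of _ C]) simp
qed

definition C :: "nat \<Rightarrow> nat \<Rightarrow> point \<Rightarrow> complex" where
  "C = (SOME C. (\<forall>i j. polyfun n (C i j)) \<and>
    (\<forall>x. \<forall>i<n. \<forall>k<n. (\<Sum>j<n. pd j (f i) x * C j k x) = (if i = k then 1 else 0) \<and>
      (\<Sum>j<n. C i j x * pd k (f j) x) = (if i = k then 1 else 0)))"

lemma
  shows polyfun_C: "polyfun n (C i j)"
    and jacobian_C: "i < n \<Longrightarrow> k < n \<Longrightarrow> (\<Sum>j<n. pd j (f i) x * C j k x) = (if i = k then 1 else 0)"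
    and C_jacobian: "i < n \<Longrightarrow> k < n \<Longrightarrow> (\<Sum>j<n. C i j x * pd k (f j) x) = (if i = k then 1 else 0)"
  using someI_ex[OF inverse_jacobian_ex, folded C_def] by blast+

section \<open>Derivations lifted from the target to the source\<close>

text \<open>\<open>D v\<close> is the derivation of the source that corresponds to \<open>dird n v\<close> on the target.\<close>

definition D :: "point \<Rightarrow> (point \<Rightarrow> complex) \<Rightarrow> point \<Rightarrow> complex" where
  "D v g x = dird n (\<lambda>i. \<Sum>l<n. C i l x * v l) g x"

lemma polyfun_D [intro]:
  assumes "polyfun n g"
  shows "polyfun n (D v g)"
proof -
  have "D v g = (\<lambda>x. \<Sum>j<n. (\<Sum>l<n. C j l x * v l) * pd j g x)"
    by (rule ext) (simp add: D_def dird_def)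
  then show ?thesis
    using assms by (auto intro!: polyfun_sum polyfun.mult polyfun.const polyfun_C polyfun_pd)
qed

lemma dird_F:
  assumes g: "polyfun n g"
  shows "dird n w (\<lambda>x. g (F x)) x = dird n (\<lambda>j. dird n w (f j) x) g (F x)"
proof (rule dird_unique)
  show "polyfun n (\<lambda>x. g (F x))" using g by auto
  have "((\<lambda>s. g (F (shift x s w))) has_field_derivative
      (\<Sum>j<n. dird n w (f j) x * pd j g (F (shift x 0 w)))) (at 0)"
    by (rule polyfun_chain[OF g]) (simp add: F_def DERIV_shift_0[OF f])
  then show "((\<lambda>s. g (F (shift x s w))) has_field_derivative
      dird n (\<lambda>j. dird n w (f j) x) g (F x)) (at 0)"
    by (simp add: dird_def)
qed

text \<open>By the chain rule the Jacobian matrix acts on the direction, and this undoes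
  \<open>C\<close>.\<close>

lemma D_F:
  assumes g: "polyfun n g"
  shows "D v (\<lambda>x. g (F x)) x = dird n v g (F x)"
  unfolding D_def dird_F[OF g]
proof (rule dird_cong)
  fix j assume j: "j < n"
  have "dird n (\<lambda>i. \<Sum>l<n. C i l x * v l) (f j) x = (\<Sum>i<n. \<Sum>l<n. v l * (pd i (f j) x * C i l x))"
    by (simp add: dird_def sum_distrib_left mult_ac)
  also have "\<dots> = (\<Sum>l<n. v l * (\<Sum>i<n. pd i (f j) x * C i l x))"
    by (subst sum.swap) (simp add: sum_distrib_left)
  also have "\<dots> = (\<Sum>l<n. if l = j then v j else 0)"
    by (intro sum.cong refl) (simp add: jacobian_C[OF j])
  also have "\<dots> = v j" using j by simp
  finally show "dird n (\<lambda>i. \<Sum>l<n. C i l x * v l) (f j) x = v j" .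
qed

lemma D_const_0: "D v (\<lambda>_. 0) = (\<lambda>_. 0)"
  by (rule ext) (simp add: D_def)

lemma D_pow_polyfun: "polyfun n g \<Longrightarrow> polyfun n ((D v ^^ a) g)"
  by (induction a) auto

lemma dird_pow_polyfun: "polyfun n g \<Longrightarrow> polyfun n ((dird n v ^^ a) g)"
  by (induction a) auto

lemma D_pow_F:
  assumes g: "polyfun n g"
  shows "(D v ^^ a) (\<lambda>x. g (F x)) = (\<lambda>x. (dird n v ^^ a) g (F x))"
proof (induction a)
  case (Suc a)
  show ?case
    unfolding funpow.simps comp_def Suc by (rule ext) (rule D_F[OF dird_pow_polyfun[OF g]])
qed simp

lemma D_sum:
  assumes "\<And>a. a \<in> A \<Longrightarrow> polyfun n (g a)"
  shows "D v (\<lambda>x. \<Sum>a\<in>A. c a * g a x) = (\<lambda>x. \<Sum>a\<in>A. c a * D v (g a) x)"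
  using assms by (auto simp: D_def fun_eq_iff dird_sum dird_cmult polyfun.mult intro!: sum.cong)

lemma D_pow_sum:
  assumes "\<And>a. a \<in> A \<Longrightarrow> polyfun n (g a)"
  shows "(D v ^^ m) (\<lambda>x. \<Sum>a\<in>A. c a * g a x) = (\<lambda>x. \<Sum>a\<in>A. c a * (D v ^^ m) (g a) x)"
proof (induction m)
  case (Suc m)
  show ?case
    using D_sum[of A "\<lambda>a. (D v ^^ m) (g a)" v c] assms D_pow_polyfun by (simp add: Suc)
qed simp

lemma D_leibniz:
  assumes g: "polyfun n g" and h: "polyfun n h"
  shows "(D v ^^ m) (\<lambda>x. g x * h x) = (\<lambda>x. \<Sum>j\<le>m. of_nat (m choose j) * ((D v ^^ j) g x * (D v ^^ (m - j)) h x))"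
proof (induction m)
  case (Suc m)
  define a where "a j = (D v ^^ j) g" for j
  define b where "b j = (D v ^^ j) h" for j
  have ab: "polyfun n (a j)" "polyfun n (b j)" for j
    using D_pow_polyfun g h by (auto simp: a_def b_def)
  have D_mult: "D v (\<lambda>x. a j x * b i x) x = a (Suc j) x * b i x + a j x * b (Suc i) x" for i j x
    using dird_mult[OF ab(1)[of j] ab(2)[of i]] by (simp add: D_def a_def b_def)
  have "D v (\<lambda>x. \<Sum>j\<le>m. of_nat (m choose j) * (a j x * b (m - j) x)) x =
      (\<Sum>j\<le>Suc m. of_nat (Suc m choose j) * (a j x * b (Suc m - j) x))" for x
  proof -
    have "D v (\<lambda>x. \<Sum>j\<le>m. of_nat (m choose j) * (a j x * b (m - j) x)) x =
        (\<Sum>j\<le>m. of_nat (m choose j) * D v (\<lambda>x. a j x * b (m - j) x) x)"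
      using D_sum[of "{..m}" "\<lambda>j x. a j x * b (m - j) x" v "\<lambda>j. of_nat (m choose j)"] ab polyfun.mult
      by (simp add: fun_eq_iff)
    also have "\<dots> = (\<Sum>j\<le>m. of_nat (m choose j) * (a (Suc j) x * b (m - j) x)) +
        (\<Sum>j\<le>m. of_nat (m choose j) * (a j x * b (Suc (m - j)) x))"
      by (simp add: D_mult sum.distrib distrib_left)
    also have "(\<Sum>j\<le>m. of_nat (m choose j) * (a j x * b (Suc (m - j)) x)) =
        (\<Sum>j\<le>Suc m. of_nat (m choose j) * (a j x * b (Suc m - j) x))"
      by (simp add: Suc_diff_le)
    also have "\<dots> = a 0 x * b (Suc m) x + (\<Sum>j\<le>m. of_nat (m choose Suc j) * (a (Suc j) x * b (m - j) x))"
      by (subst sum.atMost_Suc_shift) simp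
    also have "(\<Sum>j\<le>m. of_nat (m choose j) * (a (Suc j) x * b (m - j) x)) +
        (a 0 x * b (Suc m) x + (\<Sum>j\<le>m. of_nat (m choose Suc j) * (a (Suc j) x * b (m - j) x))) =
        a 0 x * b (Suc m) x + (\<Sum>j\<le>m. of_nat (Suc m choose Suc j) * (a (Suc j) x * b (m - j) x))"
      by (simp add: sum.distrib[symmetric] distrib_right[symmetric] add_ac)
    also have "\<dots> = (\<Sum>j\<le>Suc m. of_nat (Suc m choose j) * (a j x * b (Suc m - j) x))"
      by (simp add: sum.atMost_Suc_shift del: sum.atMost_Suc binomial_Suc_Suc)
    finally show ?thesis .
  qed
  then have "D v (\<lambda>x. \<Sum>j\<le>m. of_nat (m choose j) * (a j x * b (m - j) x)) =
      (\<lambda>x. \<Sum>j\<le>Suc m. of_nat (Suc m choose j) * (a j x * b (Suc m - j) x))"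
    by (rule ext)
  then show ?case
    unfolding funpow.simps comp_def Suc a_def b_def .
qed simp

text \<open>The image is Zariski dense: the iterated derivatives of \<open>g\<close> at an image
  point lift to iterated \<open>D v\<close> of the zero function, so every Taylor expansion of
  \<open>g\<close> there vanishes.\<close>

lemma zero_on_image:
  assumes g: "polyfun n g" and z: "\<And>x. g (F x) = 0"
  shows "g y = 0"
proof (rule ccontr)
  assume nz: "g y \<noteq> 0"
  define y0 where "y0 = F (\<lambda>_. 0)"
  define v where "v = (\<lambda>i. y i - y0 i)"
  have "shift y0 1 v = y" by (simp add: shift_def v_def)
  then obtain a where a: "(dird n v ^^ a) g y0 \<noteq> 0"
    using dird_pow_nonzero[OF g, of y0 1 v] nz by auto
  have "(D v ^^ a) (\<lambda>x. g (F x)) = (\<lambda>_. 0)" for a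
    using z by (induction a) (simp_all add: D_const_0)
  then have "(dird n v ^^ a) g (F x) = 0" for x
    using D_pow_F[OF g, of a v] by (simp add: fun_eq_iff)
  with a show False by (simp add: y0_def)
qed

lemma eq_on_image:
  assumes "polyfun n g" "polyfun n h" "\<And>x. g (F x) = h (F x)"
  shows "g y = h y"
  using zero_on_image[of "\<lambda>y. g y - h y" y] assms by auto

text \<open>
  Compare Taylor coefficients at \<open>x0\<close> in two directions: along \<open>v\<close> the right-hand side is constant,
  while the left-hand side has a term of lowest order in the transversal direction whose order
  along \<open>v\<close> is positive.
\<close>

lemma image_avoids_zeros:
  assumes e: "polyfun n e" and z: "polyfun n z" and r: "polyfun n r"
    and inv: "invariant v r" and rz: "r y1 \<noteq> 0"
    and eq: "\<And>x. e (F x) * z x = r (F x)"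
    and es: "e (shift (F x0) s v) \<noteq> 0"
  shows "e (F x0) \<noteq> 0"
proof
  assume e0: "e (F x0) = 0"
  define y0 where "y0 = F x0"
  define u where "u = (\<lambda>i. y1 i - y0 i)"
  define W where "W = (\<lambda>x. e (F x))"
  have W: "polyfun n W" using e by (auto simp: W_def)
  have "\<exists>k. (dird n v ^^ k) e y0 \<noteq> 0"
    using dird_pow_nonzero[OF e, of y0 s v] es by (simp add: y0_def)
  then obtain k where k: "(dird n v ^^ k) e y0 \<noteq> 0" and k_min: "\<And>j. j < k \<Longrightarrow> (dird n v ^^ j) e y0 = 0"
    using exists_least_iff[of "\<lambda>k. (dird n v ^^ k) e y0 \<noteq> 0"] by blast
  have "k \<noteq> 0" using k e0 by (intro notI) (simp add: y0_def)
  have DW: "(D v ^^ j) W x0 = (dird n v ^^ j) e y0" for j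
    using D_pow_F[OF e, of j v] by (simp add: W_def y0_def)
  have "shift y0 1 u = y1" by (simp add: shift_def u_def)
  then obtain a where a: "(dird n u ^^ a) r y0 \<noteq> 0"
    using dird_pow_nonzero[OF r, of y0 1 u] rz by auto
  \<comment> \<open>Otherwise no derivative of \<open>z\<close> along \<open>u\<close>, hence by
    Leibniz none of the product, would survive at \<open>x0\<close>; but the product is
    \<open>r\<close> after \<open>F\<close>, whose derivative of order \<open>a\<close> is
    nonzero.\<close>
  have "\<exists>m b. (D u ^^ m) ((D v ^^ b) z) x0 \<noteq> 0"
  proof (rule ccontr)
    assume "\<not> ?thesis"
    then have none: "(D u ^^ j) z x0 = 0" for j
      by (metis funpow_0)
    have "(dird n u ^^ a) r y0 = (D u ^^ a) (\<lambda>x. W x * z x) x0"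
      using D_pow_F[OF r, of a u] eq by (simp add: W_def y0_def)
    also have "\<dots> = 0"
      unfolding D_leibniz[OF W z] by (simp add: none)
    finally show False using a by simp
  qed
  \<comment> \<open>\<open>m\<close> is least over all orders \<open>b\<close> at once, so in the
    Leibniz formula for the \<open>m\<close>-fold \<open>D u\<close> every term that spends a
    derivative on the factor from \<open>W\<close> vanishes.\<close>
  then obtain m where m: "\<exists>b. (D u ^^ m) ((D v ^^ b) z) x0 \<noteq> 0"
    and m_min: "\<And>j b. j < m \<Longrightarrow> (D u ^^ j) ((D v ^^ b) z) x0 = 0"
    using exists_least_iff[of "\<lambda>m. \<exists>b. (D u ^^ m) ((D v ^^ b) z) x0 \<noteq> 0"] by blast
  obtain l where l: "(D u ^^ m) ((D v ^^ l) z) x0 \<noteq> 0"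
    and l_min: "\<And>j. j < l \<Longrightarrow> (D u ^^ m) ((D v ^^ j) z) x0 = 0"
    using m exists_least_iff[of "\<lambda>l. (D u ^^ m) ((D v ^^ l) z) x0 \<noteq> 0"] by blast
  have tm: "(D u ^^ m) (\<lambda>x. (D v ^^ j) W x * (D v ^^ b) z x) x0 =
      (D v ^^ j) W x0 * (D u ^^ m) ((D v ^^ b) z) x0" for j b
  proof -
    have "(D u ^^ m) (\<lambda>x. (D v ^^ j) W x * (D v ^^ b) z x) x0 =
        (\<Sum>i\<le>m. of_nat (m choose i) * ((D u ^^ i) ((D v ^^ j) W) x0 * (D u ^^ (m - i)) ((D v ^^ b) z) x0))"
      by (simp add: D_leibniz[OF D_pow_polyfun[OF W] D_pow_polyfun[OF z]])
    also have "\<dots> = (\<Sum>i\<in>{0}. of_nat (m choose i) * ((D u ^^ i) ((D v ^^ j) W) x0 * (D u ^^ (m - i)) ((D v ^^ b) z) x0))"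
      by (rule sum.mono_neutral_right) (auto simp: m_min)
    finally show ?thesis by simp
  qed
  \<comment> \<open>The orders \<open>k\<close> of \<open>W\<close> and \<open>l\<close> of
    \<open>z\<close> along \<open>v\<close> add: among the splittings of \<open>k + l\<close> only
    \<open>j = k\<close> has both factors nonzero. As \<open>k > 0\<close>, this contradicts that
    \<open>D v\<close> annihilates the product.\<close>
  have "(D u ^^ m) ((D v ^^ (k + l)) (\<lambda>x. W x * z x)) x0 =
      (\<Sum>j\<le>k + l. of_nat ((k + l) choose j) * (D u ^^ m) (\<lambda>x. (D v ^^ j) W x * (D v ^^ (k + l - j)) z x) x0)"
    unfolding D_leibniz[OF W z]
    by (subst D_pow_sum) (auto intro: D_pow_polyfun W z)
  also have "\<dots> = (\<Sum>j\<le>k + l. of_nat ((k + l) choose j) * ((dird n v ^^ j) e y0 * (D u ^^ m) ((D v ^^ (k + l - j)) z) x0))"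
    by (simp add: tm DW)
  also have "\<dots> = (\<Sum>j\<in>{k}. of_nat ((k + l) choose j) * ((dird n v ^^ j) e y0 * (D u ^^ m) ((D v ^^ (k + l - j)) z) x0))"
  proof (rule sum.mono_neutral_right)
    show "\<forall>j\<in>{..k + l} - {k}. of_nat ((k + l) choose j) * ((dird n v ^^ j) e y0 * (D u ^^ m) ((D v ^^ (k + l - j)) z) x0) = 0"
    proof
      fix j assume "j \<in> {..k + l} - {k}"
      then have "j < k \<or> k + l - j < l" by auto
      then show "of_nat ((k + l) choose j) * ((dird n v ^^ j) e y0 * (D u ^^ m) ((D v ^^ (k + l - j)) z) x0) = 0"
        using k_min l_min by auto
    qed
  qed auto
  finally have "(D u ^^ m) ((D v ^^ (k + l)) (\<lambda>x. W x * z x)) x0 \<noteq> 0"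
    using k l by simp
  moreover have "(D v ^^ Suc j) (\<lambda>x. W x * z x) = (\<lambda>_. 0)" for j
  proof (induction j)
    case 0
    have "dird n v r y = 0" for y
      by (rule dird_unique[OF r]) (use inv in \<open>simp add: invariant_def\<close>)
    then show ?case
      using D_F[OF r, of v] eq by (simp add: W_def fun_eq_iff)
  next
    case (Suc j)
    then show ?case by (simp add: D_const_0)
  qed
  moreover have "(D u ^^ m) (\<lambda>_. 0) = (\<lambda>_. 0)"
    by (induction m) (simp_all add: D_const_0)
  ultimately show False
    using \<open>k \<noteq> 0\<close> by (cases k) auto
qed

end

section \<open>An injective map with nonvanishing Jacobian has a rational inverse\<close>

text \<open>A pair of points becomes one point of \<open>2 * n\<close> variables, so that
  polynomials in both are again instances of \<open>polyfun\<close>.\<close>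

definition join :: "nat \<Rightarrow> point \<Rightarrow> point \<Rightarrow> point" where
  "join n x z = (\<lambda>i. if i < n then x i else z (i - n))"

lemma polyfun_fst: "polyfun n g \<Longrightarrow> polyfun (2 * n) g"
  by (rule polyfun_mono) auto

lemma polyfun_snd: "polyfun n g \<Longrightarrow> polyfun (2 * n) (\<lambda>w. g (\<lambda>i. w (n + i)))"
  by (rule polyfun_compose) auto

lemma join_fst: "polyfun n g \<Longrightarrow> g (join n x z) = g x"
  by (rule polyfun_cong) (auto simp: join_def)

lemma join_snd [simp]: "(\<lambda>i. join n x z (n + i)) = z"
  by (simp add: join_def)

text \<open>For products the telescoping \<open>g x * (h x - h z) + h z * (g x - g z)\<close> does
  it.\<close>

lemma hadamard_ex:
  "polyfun n g \<Longrightarrow> \<exists>A. (\<forall>k. polyfun (2 * n) (A k)) \<and>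
    (\<forall>x z. g x - g z = (\<Sum>k<n. A k (join n x z) * (x k - z k)))"
proof (induction rule: polyfun.induct)
  case (const c)
  show ?case by (rule exI[of _ "\<lambda>_ _. 0"]) simp
next
  case (var i)
  have "x i - z i = (\<Sum>k<n. (if k = i then 1 else 0) * (x k - z k))" for x z :: point
  proof -
    have "(\<Sum>k<n. (if k = i then 1 else 0) * (x k - z k)) = (\<Sum>k<n. if k = i then x i - z i else 0)"
      by (rule sum.cong) auto
    then show ?thesis using var by simp
  qed
  then show ?case by (intro exI[of _ "\<lambda>k _. if k = i then 1 else 0"]) simp
next
  case (add g h)
  from add.IH(1) obtain A where A: "\<forall>k. polyfun (2 * n) (A k)"
    "\<forall>x z. g x - g z = (\<Sum>k<n. A k (join n x z) * (x k - z k))" by (elim exE conjE)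
  from add.IH(2) obtain B where B: "\<forall>k. polyfun (2 * n) (B k)"
    "\<forall>x z. h x - h z = (\<Sum>k<n. B k (join n x z) * (x k - z k))" by (elim exE conjE)
  have "g x + h x - (g z + h z) = (\<Sum>k<n. (A k (join n x z) + B k (join n x z)) * (x k - z k))" for x z
  proof -
    have "(\<Sum>k<n. (A k (join n x z) + B k (join n x z)) * (x k - z k)) = (g x - g z) + (h x - h z)"
      using spec[OF spec[OF A(2), of x], of z] spec[OF spec[OF B(2), of x], of z]
      by (simp add: distrib_right sum.distrib)
    then show ?thesis by simp
  qed
  then show ?case
    by (intro exI[of _ "\<lambda>k w. A k w + B k w"] conjI allI polyfun.add A(1)[rule_format] B(1)[rule_format])
next
  case (mult g h)
  from mult.IH(1) obtain A where A: "\<forall>k. polyfun (2 * n) (A k)"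
    "\<forall>x z. g x - g z = (\<Sum>k<n. A k (join n x z) * (x k - z k))" by (elim exE conjE)
  from mult.IH(2) obtain B where B: "\<forall>k. polyfun (2 * n) (B k)"
    "\<forall>x z. h x - h z = (\<Sum>k<n. B k (join n x z) * (x k - z k))" by (elim exE conjE)
  define E where "E = (\<lambda>k w. g w * B k w + h (\<lambda>i. w (n + i)) * A k w)"
  have "polyfun (2 * n) (E k)" for k
    unfolding E_def by (intro polyfun.add polyfun.mult polyfun_fst polyfun_snd mult.hyps A(1)[rule_format] B(1)[rule_format])
  moreover have "g x * h x - g z * h z = (\<Sum>k<n. E k (join n x z) * (x k - z k))" for x z
  proof -
    have "(\<Sum>k<n. E k (join n x z) * (x k - z k)) = g x * (h x - h z) + h z * (g x - g z)"
      unfolding A(2)[rule_format] B(2)[rule_format] sum_distrib_left sum.distrib[symmetric]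
      by (rule sum.cong) (simp_all add: E_def join_fst mult.hyps, simp add: algebra_simps)
    then show ?thesis by (simp add: algebra_simps)
  qed
  ultimately show ?case by (intro exI[of _ E] conjI allI)
qed

text \<open>When the first argument leaves the diagonal along the \<open>k\<close>-th axis, the
  difference quotient of \<open>g\<close> is \<open>A k\<close>; its limit is the partial
  derivative.\<close>

lemma hadamard_diagonal:
  assumes g: "polyfun n g" and A: "\<And>k. polyfun (2 * n) (A k)"
    and eq: "\<And>x z. g x - g z = (\<Sum>k<n. A k (join n x z) * (x k - z k))" and k: "k < n"
  shows "A k (join n x x) = pd k g x"
proof -
  define e where "e = (\<lambda>i. if i = k then 1 else 0 :: complex)"
  have "(\<Sum>j<n. e j * pd j g x) = (\<Sum>j<n. if j = k then pd k g x else 0)"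
    by (rule sum.cong) (auto simp: e_def)
  then have dir: "dird n e g x = pd k g x"
    using k by (simp add: dird_def)
  have line: "join n (shift x s e) x = shift (join n x x) s (join n e (\<lambda>_. 0))" for s
    by (auto simp: join_def shift_def)
  have "g (shift x s e) = g x + A k (shift (join n x x) s (join n e (\<lambda>_. 0))) * s" for s
  proof -
    have "g (shift x s e) - g x = (\<Sum>l<n. A l (join n (shift x s e) x) * (shift x s e l - x l))"
      by (rule eq)
    also have "\<dots> = (\<Sum>l<n. if l = k then A k (join n (shift x s e) x) * s else 0)"
      by (intro sum.cong) (auto simp: shift_def e_def)
    finally show ?thesis using k by (simp add: line algebra_simps)
  qed
  moreover have "((\<lambda>s. g x + A k (shift (join n x x) s (join n e (\<lambda>_. 0))) * s) has_field_derivative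
      A k (join n x x)) (at 0)"
    using DERIV_add[OF DERIV_const[of "g x"] DERIV_mult[OF DERIV_shift_0[OF A[of k], of "join n x x" "join n e (\<lambda>_. 0)"] DERIV_ident]]
    by simp
  ultimately have "dird n e g x = A k (join n x x)"
    by (intro dird_unique[OF g]) simp
  with dir show ?thesis by simp
qed

text \<open>Separating the two groups of variables is what lets a functional act on the
  \<open>z\<close>-part alone.\<close>

lemma split_variables:
  "polyfun (2 * n) h \<Longrightarrow> \<exists>ps. (\<forall>(u, v)\<in>set ps. polyfun n u \<and> polyfun n v) \<and>
    (\<forall>x z. h (join n x z) = (\<Sum>(u, v)\<leftarrow>ps. u x * v z))"
proof (induction rule: polyfun.induct)
  case (const c)
  show ?case by (rule exI[of _ "[(\<lambda>_. c, \<lambda>_. 1)]"]) simp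
next
  case (var i)
  show ?case
  proof (cases "i < n")
    case True
    then show ?thesis by (intro exI[of _ "[(\<lambda>x. x i, \<lambda>_. 1)]"]) (auto simp: join_def)
  next
    case False
    then show ?thesis using var by (intro exI[of _ "[(\<lambda>_. 1, \<lambda>x. x (i - n))]"]) (auto simp: join_def)
  qed
next
  case (add g h)
  then obtain ps qs where "\<forall>(u, v)\<in>set ps. polyfun n u \<and> polyfun n v" "\<forall>(u, v)\<in>set qs. polyfun n u \<and> polyfun n v"
    "\<And>x z. g (join n x z) = (\<Sum>(u, v)\<leftarrow>ps. u x * v z)" "\<And>x z. h (join n x z) = (\<Sum>(u, v)\<leftarrow>qs. u x * v z)"
    by metis
  then show ?case by (intro exI[of _ "ps @ qs"]) auto
next
  case (mult g h)
  then obtain ps qs where ps: "\<forall>(u, v)\<in>set ps. polyfun n u \<and> polyfun n v" and qs: "\<forall>(u, v)\<in>set qs. polyfun n u \<and> polyfun n v"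
    and eq: "\<And>x z. g (join n x z) = (\<Sum>(u, v)\<leftarrow>ps. u x * v z)" "\<And>x z. h (join n x z) = (\<Sum>(u, v)\<leftarrow>qs. u x * v z)"
    by metis
  define m where "m = (\<lambda>((u :: point \<Rightarrow> complex, v :: point \<Rightarrow> complex), (u' :: point \<Rightarrow> complex, v' :: point \<Rightarrow> complex)).
    (\<lambda>x. u x * u' x, \<lambda>z. v z * v' z))"
  have prod: "(\<Sum>(u, v)\<leftarrow>map m (List.product as bs). u x * v z) = (\<Sum>(u, v)\<leftarrow>as. u x * v z) * (\<Sum>(u, v)\<leftarrow>bs. u x * v z)" for as bs x z
  proof (induction as)
    case (Cons a as)
    have "(\<Sum>(u, v)\<leftarrow>map m (map (Pair a) bs). u x * v z) = fst a x * snd a z * (\<Sum>(u, v)\<leftarrow>bs. u x * v z)"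
      by (induction bs) (auto simp: m_def algebra_simps split: prod.splits)
    with Cons show ?case by (cases a) (simp add: distrib_right)
  qed simp
  have "\<forall>(u, v)\<in>set (map m (List.product ps qs)). polyfun n u \<and> polyfun n v"
    using ps qs by (auto simp: m_def)
  then show ?case
    using prod eq by (intro exI[of _ "map m (List.product ps qs)"]) simp
qed

lemma pideal_generated:
  assumes g: "\<And>j. j < N \<Longrightarrow> polyfun n (g j)"
  shows "pideal n {\<lambda>x. \<Sum>j<N. b j x * g j x |b. \<forall>j. polyfun n (b j)}" (is "pideal n ?I")
  unfolding pideal_def
proof (intro conjI ballI allI impI)
  fix h assume "h \<in> ?I"
  then obtain b where "\<forall>j. polyfun n (b j)" "h = (\<lambda>x. \<Sum>j<N. b j x * g j x)" by blast
  then show "polyfun n h" using g by (auto intro!: polyfun_sum)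
next
  show "(\<lambda>_. 0) \<in> ?I"
    by (rule CollectI, rule exI[of _ "\<lambda>_ _. 0"]) simp
next
  fix h h' assume "h \<in> ?I" "h' \<in> ?I"
  then obtain b b' where "\<forall>j. polyfun n (b j)" "h = (\<lambda>x. \<Sum>j<N. b j x * g j x)"
    "\<forall>j. polyfun n (b' j)" "h' = (\<lambda>x. \<Sum>j<N. b' j x * g j x)" by blast
  then show "(\<lambda>x. h x + h' x) \<in> ?I"
    by (intro CollectI exI[of _ "\<lambda>j x. b j x + b' j x"]) (auto simp: distrib_right sum.distrib)
next
  fix h c assume "h \<in> ?I" and c: "polyfun n c"
  then obtain b where "\<forall>j. polyfun n (b j)" "h = (\<lambda>x. \<Sum>j<N. b j x * g j x)" by blast
  with c show "(\<lambda>x. c x * h x) \<in> ?I"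
    by (intro CollectI exI[of _ "\<lambda>j x. c x * b j x"]) (auto simp: sum_distrib_left mult_ac)
qed

locale injective_etale = etale +
  assumes inj: "(\<And>i. i < n \<Longrightarrow> f i x = f i z) \<Longrightarrow> i < n \<Longrightarrow> x i = z i"
begin

text \<open>At a common zero of the differences and of the determinant of \<open>A\<close>,
  injectivity puts the point on the diagonal, where \<open>A\<close> is the Jacobian matrix. In the
  resulting expression of \<open>1\<close>, multiplied by \<open>x i - z i\<close>, the determinant
  term is rewritten by Cramer's rule.\<close>

lemma diagonal_ideal:
  "\<exists>b. (\<forall>i j. polyfun (2 * n) (b i j)) \<and>
    (\<forall>x z. \<forall>i<n. x i - z i = (\<Sum>j<n. b i j (join n x z) * (f j x - f j z)))"
proof -
  have "\<exists>A. \<forall>j<n. (\<forall>k. polyfun (2 * n) (A j k)) \<and>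
    (\<forall>x z. f j x - f j z = (\<Sum>k<n. A j k (join n x z) * (x k - z k)))"
    using hadamard_ex[OF f] by metis
  then obtain A where A: "\<And>j k. j < n \<Longrightarrow> polyfun (2 * n) (A j k)"
    and A_eq: "\<And>j x z. j < n \<Longrightarrow> f j x - f j z = (\<Sum>k<n. A j k (join n x z) * (x k - z k))"
    by metis
  define d where "d = (\<lambda>w. det (mat n n (\<lambda>(j, k). A j k w)))"
  have d: "polyfun (2 * n) d" unfolding d_def by (rule polyfun_det) (rule A)
  obtain B where B: "\<And>i j. polyfun (2 * n) (B i j)" and
    BA: "\<And>w i k. i < n \<Longrightarrow> k < n \<Longrightarrow> (\<Sum>j<n. B i j w * A j k w) = (if i = k then d w else 0)"
    using polyfun_adjugate[of n "2 * n" "\<lambda>w j k. A j k w", OF A] unfolding d_def by blast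
  \<comment> \<open>The determinant is listed as generator number \<open>n\<close>, after the
    differences.\<close>
  define g where "g j = (\<lambda>w. if j < n then f j w - f j (\<lambda>i. w (n + i)) else d w)" for j
  have g: "polyfun (2 * n) (g j)" for j
  proof (cases "j < n")
    case True
    then have "polyfun (2 * n) (\<lambda>w. f j w - f j (\<lambda>i. w (n + i)))"
      by (intro polyfun_diff polyfun_fst[OF f] polyfun_snd[OF f])
    with True show ?thesis by (simp add: g_def)
  qed (simp add: g_def d)
  let ?I = "{\<lambda>x. \<Sum>j<Suc n. b j x * g j x |b. \<forall>j. polyfun (2 * n) (b j)}"
  have I: "pideal (2 * n) ?I" by (rule pideal_generated) (rule g)
  have gI: "g j \<in> ?I" if "j < Suc n" for j
  proof -
    have "(\<Sum>l<Suc n. (if l = j then 1 else 0) * g l x) = (\<Sum>l<Suc n. if l = j then g j x else 0)" for x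
      by (rule sum.cong) auto
    then have "g j = (\<lambda>x. \<Sum>l<Suc n. (if l = j then 1 else 0) * g l x)"
      using that by (intro ext) (simp del: sum.lessThan_Suc)
    then show ?thesis
      by (intro CollectI exI[of _ "\<lambda>l _. if l = j then 1 else 0"] conjI allI polyfun.const)
  qed
  have "(\<lambda>_. 1) \<in> ?I"
  proof (rule ccontr)
    assume "(\<lambda>_. 1) \<notin> ?I"
    from weak_nullstellensatz[OF I this] obtain w where w: "\<forall>h\<in>?I. h w = 0" ..
    have gw: "g j w = 0" if "j < Suc n" for j using bspec[OF w gI[OF that]] .
    define z where "z = (\<lambda>i. w (n + i))"
    have "f j w = f j z" if "j < n" for j
      using gw[of j] that by (simp add: g_def z_def)
    then have eq: "w i = z i" if "i < n" for i using inj that by blast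
    have "d w = d (join n z z)"
      by (rule polyfun_cong[OF d]) (auto simp: join_def eq, simp add: z_def)
    also have "mat n n (\<lambda>(j, k). A j k (join n z z)) = mat n n (\<lambda>(j, k). pd k (f j) z)"
      by (rule eq_matI) (auto intro!: hadamard_diagonal f A A_eq)
    then have "d (join n z z) \<noteq> 0" using det_nz[of z] by (simp add: d_def)
    finally show False using gw[of n] by (simp add: g_def)
  qed
  then obtain b where b: "\<And>j. polyfun (2 * n) (b j)" and one: "(\<lambda>_. 1) = (\<lambda>w. \<Sum>j<Suc n. b j w * g j w)"
    by blast
  define b' where "b' i j = (\<lambda>w. b j w * (w i - w (n + i)) + b n w * B i j w)" for i j
  have "polyfun (2 * n) (\<lambda>w. if i < n then b' i j w else 0)" for i j
  proof (cases "i < n")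
    case True
    then have "polyfun (2 * n) (b' i j)"
      unfolding b'_def by (intro polyfun.add polyfun.mult b B polyfun_diff polyfun.var) auto
    with True show ?thesis by simp
  qed simp
  moreover have "x i - z i = (\<Sum>j<n. b' i j (join n x z) * (f j x - f j z))" if i: "i < n" for i x z
  proof -
    let ?w = "join n x z"
    have gj: "g j ?w = f j x - f j z" if "j < n" for j
      using that by (simp add: g_def join_fst[OF f])
    have 1: "(\<Sum>j<n. b j ?w * (f j x - f j z)) + b n ?w * d ?w = 1"
      using fun_cong[OF one, of ?w] by (simp add: gj) (simp add: g_def)
    have "(\<Sum>j<n. B i j ?w * (f j x - f j z)) = (\<Sum>j<n. \<Sum>k<n. B i j ?w * A j k ?w * (x k - z k))"
      by (intro sum.cong) (auto simp: A_eq sum_distrib_left mult.assoc)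
    also have "\<dots> = (\<Sum>k<n. (\<Sum>j<n. B i j ?w * A j k ?w) * (x k - z k))"
      by (subst sum.swap) (simp add: sum_distrib_right)
    also have "\<dots> = (\<Sum>k<n. if k = i then d ?w * (x i - z i) else 0)"
      using i by (intro sum.cong) (auto simp: BA)
    also have "\<dots> = d ?w * (x i - z i)" using i by simp
    finally have 2: "(\<Sum>j<n. B i j ?w * (f j x - f j z)) = d ?w * (x i - z i)" .
    have "(\<Sum>j<n. b' i j ?w * (f j x - f j z)) =
        (\<Sum>j<n. b j ?w * (f j x - f j z)) * (x i - z i) + b n ?w * (\<Sum>j<n. B i j ?w * (f j x - f j z))"
      unfolding sum_distrib_left sum_distrib_right sum.distrib[symmetric] using i
      by (intro sum.cong) (auto simp: b'_def join_def algebra_simps)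
    also have "\<dots> = ((\<Sum>j<n. b j ?w * (f j x - f j z)) + b n ?w * d ?w) * (x i - z i)"
      unfolding 2 by (simp add: algebra_simps)
    finally show ?thesis using 1 by simp
  qed
  ultimately show ?thesis
    by (intro exI[of _ "\<lambda>i j w. if i < n then b' i j w else 0"]) simp
qed

text \<open>
  A functional on the module spanned by \<open>v 0, \<dots>, v N\<close> over the ring of polynomials in \<open>F\<close>,
  given by its values \<open>\<phi> a\<close> on the generators, and not vanishing at \<open>v 0 = 1\<close>.
\<close>

lemma module_functional:
  fixes v :: "nat \<Rightarrow> point \<Rightarrow> complex"
  assumes v0: "v 0 = (\<lambda>_. 1)" and v: "\<And>a. polyfun n (v a)"
  shows "\<exists>\<phi>. (\<forall>a. polyfun n (\<phi> a)) \<and> (\<exists>y. \<phi> 0 y \<noteq> 0) \<and>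
    (\<forall>h. (\<forall>a. polyfun n (h a)) \<longrightarrow> (\<forall>z. (\<Sum>a\<le>N. h a (F z) * v a z) = 0) \<longrightarrow> (\<forall>y. (\<Sum>a\<le>N. h a y * \<phi> a y) = 0))"
proof (induction N)
  case 0
  have "h 0 y = 0" if "\<forall>a. polyfun n (h a)" "\<forall>z. (\<Sum>a\<le>0. h a (F z) * v a z) = 0" for h :: "nat \<Rightarrow> point \<Rightarrow> complex" and y
    using that zero_on_image[of "h 0"] by (simp add: v0)
  then show ?case by (intro exI[of _ "\<lambda>_ _. 1"]) simp
next
  case (Suc N)
  then obtain \<phi> where \<phi>: "\<And>a. polyfun n (\<phi> a)" "\<exists>y. \<phi> 0 y \<noteq> 0" and
    rel: "\<And>h y. (\<And>a. polyfun n (h a)) \<Longrightarrow> (\<And>z. (\<Sum>a\<le>N. h a (F z) * v a z) = 0) \<Longrightarrow> (\<Sum>a\<le>N. h a y * \<phi> a y) = 0"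
    by metis
  show ?case
  proof (cases "\<exists>r y. (\<forall>a. polyfun n (r a)) \<and> (\<forall>z. (\<Sum>a\<le>Suc N. r a (F z) * v a z) = 0) \<and> r (Suc N) y \<noteq> 0")
    case False
    \<comment> \<open>No relation involves the new generator, so its value may be chosen as
      \<open>0\<close>.\<close>
    define \<psi> where "\<psi> a = (if a = Suc N then (\<lambda>_. 0) else \<phi> a)" for a
    have "(\<Sum>a\<le>Suc N. h a y * \<psi> a y) = 0"
      if h: "\<forall>a. polyfun n (h a)" "\<forall>z. (\<Sum>a\<le>Suc N. h a (F z) * v a z) = 0" for h y
    proof -
      have "h (Suc N) y = 0" for y using False h by blast
      then have "(\<Sum>a\<le>N. h a (F z) * v a z) = 0" for z using h(2) by simp
      then have "(\<Sum>a\<le>N. h a y * \<phi> a y) = 0" using rel h(1) by blast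
      then show ?thesis by (simp add: \<psi>_def)
    qed
    moreover have "polyfun n (\<psi> a)" for a using \<phi> by (simp add: \<psi>_def)
    moreover have "\<exists>y. \<psi> 0 y \<noteq> 0" using \<phi> by (simp add: \<psi>_def)
    ultimately show ?thesis by (intro exI[of _ \<psi>]) simp
  next
    case True
    then obtain r y1 where r: "\<And>a. polyfun n (r a)" "\<And>z. (\<Sum>a\<le>Suc N. r a (F z) * v a z) = 0" "r (Suc N) y1 \<noteq> 0"
      by blast
    \<comment> \<open>The relation \<open>r\<close> forces the value at the new generator up to the
      factor \<open>r (Suc N)\<close>, by which the old values are therefore multiplied; as a
      nonzero polynomial it keeps the value at \<open>v 0\<close> nonzero.\<close>
    define \<psi> where "\<psi> a = (if a = Suc N then (\<lambda>y. - (\<Sum>b\<le>N. r b y * \<phi> b y)) else (\<lambda>y. r (Suc N) y * \<phi> a y))" for a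
    have "polyfun n (\<psi> a)" for a
      unfolding \<psi>_def using r(1) \<phi>(1)
      by (cases "a = Suc N") (auto intro!: polyfun_uminus polyfun_sum polyfun.mult)
    moreover have "\<exists>y. \<psi> 0 y \<noteq> 0"
    proof (rule ccontr)
      assume "\<not> ?thesis"
      then have "r (Suc N) x * \<phi> 0 x = 0" for x by (simp add: \<psi>_def)
      then have "\<phi> 0 y = 0" for y
        using polyfun_mult_eq_0[OF r(1) \<phi>(1) _ r(3)] by blast
      with \<phi>(2) show False by blast
    qed
    moreover have "(\<Sum>a\<le>Suc N. h a y * \<psi> a y) = 0"
      if h: "\<forall>a. polyfun n (h a)" "\<forall>z. (\<Sum>a\<le>Suc N. h a (F z) * v a z) = 0" for h y
    proof -
      \<comment> \<open>Eliminates the generator \<open>v (Suc N)\<close> from the relation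
        \<open>h\<close> by means of \<open>r\<close>.\<close>
      define k where "k a = (\<lambda>y. r (Suc N) y * h a y - h (Suc N) y * r a y)" for a
      have sum_k: "(\<Sum>a\<le>N. k a y * w a) =
          r (Suc N) y * (\<Sum>a\<le>N. h a y * w a) - h (Suc N) y * (\<Sum>a\<le>N. r a y * w a)" for y w
        unfolding sum_distrib_left sum_subtractf[symmetric]
        by (rule sum.cong) (simp_all add: k_def algebra_simps)
      have "polyfun n (k a)" for a
        unfolding k_def using r(1) h(1) by (intro polyfun_diff polyfun.mult) auto
      moreover have "(\<Sum>a\<le>N. k a (F z) * v a z) = 0" for z
      proof -
        have "(\<Sum>a\<le>N. h a (F z) * v a z) = - (h (Suc N) (F z) * v (Suc N) z)"
          "(\<Sum>a\<le>N. r a (F z) * v a z) = - (r (Suc N) (F z) * v (Suc N) z)"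
          using h(2) r(2)[of z] by (simp_all add: eq_neg_iff_add_eq_0)
        then show ?thesis unfolding sum_k by simp
      qed
      ultimately have "(\<Sum>a\<le>N. k a y * \<phi> a y) = 0" using rel by blast
      then have "r (Suc N) y * (\<Sum>a\<le>N. h a y * \<phi> a y) = h (Suc N) y * (\<Sum>a\<le>N. r a y * \<phi> a y)"
        unfolding sum_k by simp
      moreover have "(\<Sum>a\<le>N. h a y * \<psi> a y) = r (Suc N) y * (\<Sum>a\<le>N. h a y * \<phi> a y)"
        unfolding sum_distrib_left by (rule sum.cong) (auto simp: \<psi>_def)
      ultimately show ?thesis by (simp add: \<psi>_def)
    qed
    ultimately show ?thesis by (intro exI[of _ \<psi>]) simp
  qed
qed

text \<open>For fixed \<open>x\<close>, the expression of \<open>x i - z i\<close> in the ideal,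
  split into products, is a relation with coefficients polynomial in \<open>F z\<close> between
  \<open>1\<close>, \<open>z i\<close> and the \<open>z\<close>-factors. The functional turns it
  into an identity in a free \<open>y\<close>; putting \<open>y = F x\<close> kills all terms with a
  factor \<open>f j x - y j\<close>.\<close>

lemma coordinate_rational:
  assumes i: "i < n"
  shows "\<exists>q p. polyfun n q \<and> polyfun n p \<and> (\<exists>y. q y \<noteq> 0) \<and> (\<forall>x. q (F x) * x i = p (F x))"
proof -
  obtain b where b: "\<And>i j. polyfun (2 * n) (b i j)" and
    b_eq: "\<And>x z i. i < n \<Longrightarrow> x i - z i = (\<Sum>j<n. b i j (join n x z) * (f j x - f j z))"
    using diagonal_ideal by blast
  have "\<forall>j. \<exists>ps. (\<forall>(u, v)\<in>set ps. polyfun n u \<and> polyfun n v) \<and>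
      (\<forall>x z. b i j (join n x z) = (\<Sum>(u, v)\<leftarrow>ps. u x * v z))"
    by (intro allI split_variables b)
  from choice[OF this] obtain ps where ps': "\<forall>j. (\<forall>(u, v)\<in>set (ps j). polyfun n u \<and> polyfun n v) \<and>
      (\<forall>x z. b i j (join n x z) = (\<Sum>(u, v)\<leftarrow>ps j. u x * v z))"
    by (elim exE)
  have ps: "polyfun n u \<and> polyfun n v" if "(u, v) \<in> set (ps j)" for u v j
    using bspec[OF conjunct1[OF spec[OF ps', of j]] that] by simp
  have ps_eq: "b i j (join n x z) = (\<Sum>(u, v)\<leftarrow>ps j. u x * v z)" for j x z
    using conjunct2[OF spec[OF ps', of j]] by (elim allE)
  define ts where "ts = concat (map (\<lambda>j. map (Pair j) (ps j)) [0..<n])"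
  define N where "N = length ts"
  \<comment> \<open>Generators: \<open>1\<close>, then \<open>z i\<close>, then the
    \<open>z\<close>-factors from the list \<open>ts\<close>; hence the offset \<open>2\<close> and
    the top index \<open>Suc N\<close>.\<close>
  define v where "v a = (if a = 0 then (\<lambda>_. 1) else if a = 1 then (\<lambda>z. z i)
      else if a - 2 < N then snd (snd (ts ! (a - 2))) else (\<lambda>_. 0))" for a
  define h where "h x a = (if a = 0 then (\<lambda>_. x i) else if a = 1 then (\<lambda>_. - 1)
      else if a - 2 < N then (\<lambda>y. - fst (snd (ts ! (a - 2))) x * (f (fst (ts ! (a - 2))) x - y (fst (ts ! (a - 2))))) else (\<lambda>_. 0))"
    for x :: point and a
  have ts: "fst t < n \<and> polyfun n (fst (snd t)) \<and> polyfun n (snd (snd t))" if "t \<in> set ts" for t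
    using that ps by (auto simp: ts_def)
  have v: "polyfun n (v a)" for a
    using ts[OF nth_mem[of "a - 2" ts]] i by (auto simp: v_def N_def)
  have h: "polyfun n (h x a)" for x a
  proof (cases "2 \<le> a \<and> a - 2 < N")
    case True
    then have "fst (ts ! (a - 2)) < n" using ts[OF nth_mem[of "a - 2" ts]] by (simp add: N_def)
    then have "polyfun n (\<lambda>y. - fst (snd (ts ! (a - 2))) x * (f (fst (ts ! (a - 2))) x - y (fst (ts ! (a - 2)))))"
      by (intro polyfun.mult polyfun.const polyfun_diff polyfun.var)
    moreover have "a \<noteq> 0" "a \<noteq> 1" using True by auto
    ultimately show ?thesis using True by (simp add: h_def)
  next
    case False
    then have "a = 0 \<or> a = 1 \<or> \<not> a - 2 < N" by linarith
    then show ?thesis by (elim disjE) (simp_all add: h_def)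
  qed
  have sum_eq: "(\<Sum>a\<le>Suc N. g a) = g 0 + g 1 + (\<Sum>a<N. g (a + 2))" for g :: "nat \<Rightarrow> complex"
  proof -
    have "(\<Sum>a\<le>Suc N. g a) = (\<Sum>a<Suc (Suc N). g a)" by (simp only: lessThan_Suc_atMost)
    then show ?thesis by (simp add: sum.lessThan_Suc_shift del: sum.lessThan_Suc)
  qed
  have rel: "(\<Sum>a\<le>Suc N. h x a (F z) * v a z) = 0" for x z
  proof -
    have "(\<Sum>a<N. h x (a + 2) (F z) * v (a + 2) z) =
        (\<Sum>a<N. (\<lambda>(j, u, v). - (u x * v z * (f j x - f j z))) (ts ! a))"
      by (intro sum.cong) (auto simp: h_def v_def F_def split: prod.splits)
    also have "\<dots> = (\<Sum>(j, u, v)\<leftarrow>ts. - (u x * v z * (f j x - f j z)))"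
      by (simp add: N_def sum_list_sum_nth lessThan_atLeast0)
    also have "\<dots> = (\<Sum>j\<leftarrow>[0..<n]. \<Sum>(u, v)\<leftarrow>ps j. - (u x * v z * (f j x - f j z)))"
    proof -
      have "(\<Sum>(j, u, v)\<leftarrow>concat (map (\<lambda>j. map (Pair j) (ps j)) js). - (u x * v z * (f j x - f j z))) =
          (\<Sum>j\<leftarrow>js. \<Sum>(u, v)\<leftarrow>ps j. - (u x * v z * (f j x - f j z)))" for js
        by (induction js) (simp_all add: comp_def)
      then show ?thesis by (simp add: ts_def)
    qed
    also have "\<dots> = (\<Sum>j\<leftarrow>[0..<n]. - (b i j (join n x z) * (f j x - f j z)))"
    proof -
      have "(\<Sum>(u, v)\<leftarrow>l. - (u x * v z * c)) = - ((\<Sum>(u, v)\<leftarrow>l. u x * v z) * c)" for l :: "((point \<Rightarrow> complex) \<times> (point \<Rightarrow> complex)) list" and c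
        by (induction l) (auto simp: algebra_simps)
      then show ?thesis by (simp add: ps_eq)
    qed
    also have "\<dots> = - (\<Sum>j<n. b i j (join n x z) * (f j x - f j z))"
      by (simp add: interv_sum_list_conv_sum_set_nat lessThan_atLeast0 sum_negf)
    also have "\<dots> = - (x i - z i)" using b_eq[OF i] by simp
    finally show ?thesis unfolding sum_eq by (simp add: h_def v_def)
  qed
  have v0: "v 0 = (\<lambda>_. 1)" by (simp add: v_def)
  from module_functional[of v "Suc N", OF v0 v]
  obtain \<phi> where \<phi>: "\<forall>a. polyfun n (\<phi> a)" "\<exists>y. \<phi> 0 y \<noteq> 0" and
    \<phi>_rel: "\<forall>h. (\<forall>a. polyfun n (h a)) \<longrightarrow> (\<forall>z. (\<Sum>a\<le>Suc N. h a (F z) * v a z) = 0) \<longrightarrow> (\<forall>y. (\<Sum>a\<le>Suc N. h a y * \<phi> a y) = 0)"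
    by - (erule exE, (erule conjE)+, rule that)
  have "\<phi> 0 (F x) * x i = \<phi> 1 (F x)" for x
  proof -
    have "(\<Sum>a\<le>Suc N. h x a (F x) * \<phi> a (F x)) = 0"
      using \<phi>_rel[rule_format, of "h x" "F x", OF h rel] .
    moreover have "(\<Sum>a<N. h x (a + 2) (F x) * \<phi> (a + 2) (F x)) = 0"
      by (intro sum.neutral) (simp add: h_def F_def)
    ultimately show ?thesis unfolding sum_eq by (simp add: h_def algebra_simps)
  qed
  with \<phi> show ?thesis by blast
qed

end

section \<open>Division along a direction\<close>

text \<open>The restriction to the line through \<open>y\<close> along \<open>v\<close>, with the
  \<open>k\<close>-th coordinate as parameter.\<close>

definition epoly :: "(nat \<Rightarrow> point \<Rightarrow> complex) \<Rightarrow> nat \<Rightarrow> point \<Rightarrow> complex poly" where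
  "epoly c d y = (\<Sum>j<d. monom (c j y) j)"

lemma coeff_epoly [simp]: "coeff (epoly c d y) j = (if j < d then c j y else 0)"
  by (simp add: epoly_def coeff_sum)

lemma poly_epoly:
  assumes "expansion n k v d c f" "v k = 1"
  shows "poly (epoly c d y) t = f (shift y (t - y k) v)"
proof -
  have "f (shift y (t - y k) v) = (\<Sum>j<d. c j (shift y (t - y k) v) * (shift y (t - y k) v) k ^ j)"
    using assms(1) unfolding expansion_def by blast
  also have "\<dots> = (\<Sum>j<d. c j y * t ^ j)"
  proof (rule sum.cong[OF refl])
    fix j
    have "c j (shift y (t - y k) v) = c j y"
      using assms(1) unfolding expansion_def invariant_def by blast
    then show "c j (shift y (t - y k) v) * (shift y (t - y k) v) k ^ j = c j y * t ^ j"
      by (simp add: shift_apply assms(2))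
  qed
  finally show ?thesis by (simp add: epoly_def poly_sum poly_monom)
qed

lemma expansion_nonzero_on_line:
  assumes "expansion n k v d c f" "v k = 1" "j < d" "c j y \<noteq> 0"
  shows "\<exists>s. f (shift y s v) \<noteq> 0"
proof -
  have "epoly c d y \<noteq> 0" using assms by (auto simp: poly_eq_iff)
  then obtain t where "poly (epoly c d y) t \<noteq> 0"
    using poly_all_0_iff_0 by blast
  then show ?thesis unfolding poly_epoly[OF assms(1,2)] by blast
qed

lemma expansion_drop:
  assumes "expansion n k v (Suc d) c f" "\<And>y. c d y = 0"
  shows "expansion n k v d c f"
  using assms by (simp add: expansion_def)

lemma expansion_zero: "expansion n k v 0 c f \<Longrightarrow> f y = 0"
  by (simp add: expansion_def)

lemma expansion_coeff: "expansion n k v d c f \<Longrightarrow> polyfun n (c j)" "expansion n k v d c f \<Longrightarrow> invariant v (c j)"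
  unfolding expansion_def by blast+

text \<open>\<open>Pr\<close> will be membership in an ideal. Least length makes the leading
  coefficient nonzero, and remainders of division by \<open>e\<close>, being shorter, must
  vanish.\<close>

lemma minimal_expansion:
  assumes "Pr e" "expansion n k v N c e" "e y \<noteq> 0"
  shows "\<exists>d c e. Pr e \<and> expansion n k v (Suc d) c e \<and> (\<exists>y. c d y \<noteq> 0) \<and> (\<exists>y. e y \<noteq> 0) \<and>
    (\<forall>d' c' e'. Pr e' \<longrightarrow> expansion n k v d' c' e' \<longrightarrow> d' \<le> d \<longrightarrow> (\<forall>y. e' y = 0))"
proof -
  let ?S = "\<lambda>N. \<exists>c e y. Pr e \<and> expansion n k v N c e \<and> e y \<noteq> 0"
  obtain M where M: "?S M" and least: "\<And>j. j < M \<Longrightarrow> \<not> ?S j"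
    using exists_least_iff[of ?S] assms by blast
  then obtain c e y where e: "Pr e" "expansion n k v M c e" "e y \<noteq> 0" by blast
  have "M \<noteq> 0" using e(2,3) expansion_zero by (metis)
  then obtain d where d: "M = Suc d" by (cases M) auto
  have "\<exists>y. c d y \<noteq> 0"
    using least[of d] e expansion_drop[of n k v d c e] d by blast
  moreover have "\<forall>y. e' y = 0" if "Pr e'" "expansion n k v d' c' e'" "d' \<le> d" for d' c' e'
    using least[of d'] that d by auto
  ultimately show ?thesis using e d by blast
qed

text \<open>Long division in which the leading coefficient of \<open>g\<close> is multiplied in at
  each step instead of inverted. The truncated \<open>d - m\<close> covers dividends shorter than
  \<open>g\<close>, which get the quotient \<open>0\<close>.\<close>

lemma pseudo_division:
  assumes k: "k < n" and g: "expansion n k v (Suc m) cg g"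
  shows "expansion n k v d cf h \<Longrightarrow> \<exists>s a ca b cb. expansion n k v (d - m) ca a \<and> expansion n k v m cb b \<and>
    (\<forall>y. cg m y ^ s * h y = a y * g y + b y)"
proof (induction d arbitrary: cf h)
  case 0
  have "expansion n k v (0 - m) (\<lambda>_ _. 0) (\<lambda>_. 0)" by (simp add: expansion_def invariant_def)
  moreover have "expansion n k v m (\<lambda>_ _. 0) (\<lambda>_. 0)" by (simp add: expansion_def invariant_def)
  moreover have "\<forall>y. cg m y ^ 0 * h y = (\<lambda>_. 0) y * g y + (\<lambda>_. 0) y"
    using expansion_zero[OF 0] by simp
  ultimately show ?case by blast
next
  case (Suc d)
  show ?case
  proof (cases "Suc d \<le> m")
    case True
    then have "expansion n k v (Suc d - m) (\<lambda>_ _. 0) (\<lambda>_. 0)" by (simp add: expansion_def invariant_def)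
    moreover note expansion_mono[OF Suc.prems True]
    moreover have "\<forall>y. cg m y ^ 0 * h y = (\<lambda>_. 0) y * g y + h y" by simp
    ultimately show ?thesis by blast
  next
    case False
    then have m: "m \<le> d" by simp
    define w where "w = (\<lambda>y :: point. y k ^ (d - m) * cf d y)"
    note cf = expansion_coeff[OF Suc.prems, of d] and cg = expansion_coeff[OF g, of m]
    define h' where "h' = (\<lambda>y. cg m y * h y - cf d y * (y k ^ (d - m) * g y))"
    have sh: "expansion n k v (Suc d) (\<lambda>j x. if j < d - m then 0 else cg (j - (d - m)) x) (\<lambda>x. x k ^ (d - m) * g x)"
      using expansion_shift[OF g, of "d - m"] m by simp
    have "expansion n k v (Suc d) (\<lambda>j x. cg m x * cf j x - cf d x * (if j < d - m then 0 else cg (j - (d - m)) x)) h'"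
      unfolding h'_def
      by (intro expansion_diff expansion_cmult[OF Suc.prems cg] expansion_cmult[OF sh cf])
    then have "expansion n k v d (\<lambda>j x. cg m x * cf j x - cf d x * (if j < d - m then 0 else cg (j - (d - m)) x)) h'"
      by (rule expansion_drop) (use m in simp)
    from Suc.IH[OF this] obtain s a ca b cb where a: "expansion n k v (d - m) ca a" and b: "expansion n k v m cb b"
      and eq: "\<forall>y. cg m y ^ s * h' y = a y * g y + b y"
      by (elim exE conjE)
    have "expansion n k v 1 (\<lambda>_. cf d) (cf d)"
      using cf by (simp add: expansion_def)
    from expansion_shift[OF this, of "d - m"]
    have "expansion n k v (Suc d - m) (\<lambda>j x. if j < d - m then 0 else cf d x) w"
      using m by (simp add: w_def Suc_diff_le)
    then have "expansion n k v (Suc d - m) (\<lambda>j x. cg m x ^ s * (if j < d - m then 0 else cf d x)) (\<lambda>x. cg m x ^ s * w x)"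
      by (rule expansion_cmult) (use cg in auto)
    from expansion_add[OF expansion_mono[OF a] this]
    have a': "expansion n k v (Suc d - m)
        (\<lambda>j x. (if j < d - m then ca j x else 0) + cg m x ^ s * (if j < d - m then 0 else cf d x)) (\<lambda>x. a x + cg m x ^ s * w x)"
      by simp
    have "cg m y ^ Suc s * h y = (a y + cg m y ^ s * w y) * g y + b y" for y
    proof -
      have "cg m y ^ Suc s * h y = cg m y ^ s * h' y + cg m y ^ s * w y * g y"
        by (simp add: h'_def w_def algebra_simps)
      then show ?thesis using eq by (simp add: distrib_right)
    qed
    with a' b show ?thesis by (intro exI conjI allI)
  qed
qed

lemma poly_poly_ext:
  fixes P Q :: "complex poly poly"
  assumes "\<And>t T. poly (poly P [:T:]) t = poly (poly Q [:T:]) t"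
  shows "P = Q"
proof -
  have "coeff P j = coeff Q j" for j
  proof (rule poly_ext)
    fix t :: complex
    have ev: "poly (map_poly (\<lambda>c. poly c t) R) T = poly (poly R [:T:]) t" for R :: "complex poly poly" and T
      by (induction R) (simp_all add: map_poly_pCons)
    have "map_poly (\<lambda>c. poly c t) P = map_poly (\<lambda>c. poly c t) Q"
      by (rule poly_ext) (simp add: ev assms)
    then have "coeff (map_poly (\<lambda>c. poly c t) P) j = coeff (map_poly (\<lambda>c. poly c t) Q) j" by simp
    then show "poly (coeff P j) t = poly (coeff Q j) t" by (simp add: coeff_map_poly)
  qed
  then show ?thesis by (simp add: poly_eq_iff)
qed

text \<open>\<open>Q\<close> is primitive, so by Gauss's lemma the contents of \<open>A\<close> and
  \<open>E\<close> multiply to \<open>R ^ s\<close> up to a unit. Comparing leading coefficients,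
  the cofactors of the two contents in the leading coefficients are units; so \<open>R\<close> is
  the content of \<open>E\<close> up to a unit.\<close>

lemma monic_multiple_content:
  fixes A E Q :: "complex poly poly"
  assumes eq: "smult (R ^ s) Q = A * E" and Q: "lead_coeff Q = 1" and E: "lead_coeff E = R" and R: "R \<noteq> 0"
  shows "R dvd coeff E j"
proof -
  have "is_unit (content Q)" using Q content_dvd_coeff[of Q "degree Q"] by simp
  then have "content Q = 1" by (metis is_unit_content_iff)
  then have cont: "normalize (R ^ s) = content A * content E"
    using arg_cong[OF eq, of content] by (simp add: content_mult content_smult)
  obtain r1 where r1: "R = content E * r1"
    using content_dvd_coeff[of E "degree E"] E by (metis dvdE)
  obtain a1 where a1: "lead_coeff A = content A * a1"
    using content_dvd_coeff[of A "degree A"] by (metis dvdE)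
  have "R ^ s = lead_coeff A * R"
    using arg_cong[OF eq, of lead_coeff] by (simp only: lead_coeff_smult lead_coeff_mult Q E mult_1_right)
  also have "\<dots> = (content A * content E) * (a1 * r1)"
    using r1 a1 by (simp add: mult_ac)
  finally have 1: "R ^ s = (content A * content E) * (a1 * r1)" .
  have "R ^ s dvd content A * content E"
    unfolding cont[symmetric] by simp
  then obtain u where "content A * content E = R ^ s * u" by (rule dvdE)
  with 1 have "R ^ s * 1 = R ^ s * (u * (a1 * r1))" by (metis mult.assoc mult_1_right)
  then have "u * (a1 * r1) = 1" using R by (metis mult_left_cancel power_not_zero)
  then have "1 = r1 * (u * a1)" by (simp only: mult_ac)
  then have "is_unit r1" by (rule dvdI)
  then have "R dvd content E" using r1 by (simp add: mult_unit_dvd_iff)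
  then show ?thesis using content_dvd_coeff dvd_trans by blast
qed

text \<open>Divisibility in many variables is tested on the lines through \<open>y0\<close>. There
  the coefficients become polynomials in one parameter, and Gauss's lemma applies to the polynomials
  over these.\<close>

lemma leading_coeff_divides:
  assumes k: "v k = 1"
    and q: "expansion n k v (Suc m) cq q" and q1: "\<And>y. cq m y = 1"
    and a: "expansion n k v da ca a"
    and e: "expansion n k v (Suc d) ce e" and nz: "ce d y0 \<noteq> 0"
    and eq: "\<And>y. ce d y ^ s * q y = a y * e y" and j: "j \<le> d"
  shows "\<exists>g. polyfun n g \<and> (\<forall>y. ce j y = ce d y * g y)"
  proof (rule line_divides[OF expansion_coeff(1)[OF e] expansion_coeff(1)[OF e]])
    show "ce d y0 \<noteq> 0" by (fact nz)
    fix u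
    have line: "\<exists>P. \<forall>j t. c j (shift y0 t u) = poly (P j) t" if "expansion n k v N c h" for N c h
    proof (rule choice, rule allI)
      fix j
      show "\<exists>P. \<forall>t. c j (shift y0 t u) = poly P t"
        by (rule polyfun_line[OF expansion_coeff(1)[OF that]])
    qed
    obtain Cq where Cq: "\<And>j t. cq j (shift y0 t u) = poly (Cq j) t" using line[OF q] by auto
    obtain Ca where Ca: "\<And>j t. ca j (shift y0 t u) = poly (Ca j) t" using line[OF a] by auto
    obtain Ce where Ce: "\<And>j t. ce j (shift y0 t u) = poly (Ce j) t" using line[OF e] by auto
    define P where "P C N = (\<Sum>j<N. monom (C j) j)" for C :: "nat \<Rightarrow> complex poly" and N
    have cP: "coeff (P C N) j = (if j < N then C j else 0)" for C N j
      by (simp add: P_def coeff_sum)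
    \<comment> \<open>Two parameters: \<open>t\<close> moves the base point along \<open>u\<close>,
      and \<open>T\<close> is the \<open>k\<close>-th coordinate reached by moving from there along
      \<open>v\<close>.\<close>
    have ev: "poly (poly (P C N) [:T:]) t = h (shift (shift y0 t u) (T - shift y0 t u k) v)"
      if "expansion n k v N c h" "\<And>j t. c j (shift y0 t u) = poly (C j) t" for C N c h T t
      unfolding poly_epoly[OF that(1) k, symmetric]
      by (simp add: P_def epoly_def poly_sum poly_monom that(2) poly_power)
    have inv: "ce d (shift y s v) = ce d y" for y s
      using expansion_coeff(2)[OF e, of d] unfolding invariant_def by blast
    have deg: "degree (P C (Suc N)) = N" if "C N \<noteq> 0" for C N
      by (rule order_antisym[OF degree_le le_degree]) (use that in \<open>auto simp: cP\<close>)
    have "smult (Ce d ^ s) (P Cq (Suc m)) = P Ca da * P Ce (Suc d)"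
      by (rule poly_poly_ext)
         (simp add: ev[OF q Cq] ev[OF a Ca] ev[OF e Ce] eq[symmetric] inv Ce poly_power)
    moreover have "Cq m = 1"
      using Cq[of m] q1 by (intro poly_ext) simp
    then have "lead_coeff (P Cq (Suc m)) = 1"
      using deg[of Cq m] by (simp add: cP)
    moreover have "Ce d \<noteq> 0"
      using Ce[of d 0] nz by auto
    moreover from this have "lead_coeff (P Ce (Suc d)) = Ce d"
      using deg[of Ce d] by (simp add: cP)
    ultimately have "Ce d dvd coeff (P Ce (Suc d)) j"
      using monic_multiple_content by blast
    then obtain g where "Ce j = Ce d * g" using j by (auto simp: cP elim: dvdE)
    then show "\<exists>g. \<forall>t. ce j (shift y0 t u) = ce d (shift y0 t u) * poly g t"
      by (intro exI[of _ g]) (simp add: Ce)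
  qed

text \<open>Along \<open>v\<close> the left side has degree at least \<open>m\<close> unless
  \<open>h\<close> vanishes on the line, whereas the right side has degree below
  \<open>m\<close>.\<close>

lemma monic_multiple_zero:
  assumes k: "v k = 1"
    and q: "expansion n k v (Suc m) cq q" and q1: "\<And>y. cq m y = 1"
    and b: "expansion n k v m cb b" and h: "expansion n k v d ch h"
    and eq: "\<And>y. q y * h y = b y"
  shows "h y = 0"
proof -
  have "epoly cq (Suc m) y * epoly ch d y = epoly cb m y"
    by (rule poly_ext) (simp add: poly_epoly[OF q k] poly_epoly[OF b k] poly_epoly[OF h k] eq)
  moreover have cm: "coeff (epoly cq (Suc m) y) m = 1" by (simp add: q1)
  then have "degree (epoly cq (Suc m) y) \<ge> m" "epoly cq (Suc m) y \<noteq> 0"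
    by (metis le_degree zero_neq_one, metis coeff_0 zero_neq_one)
  moreover have "epoly cb m y = 0 \<or> degree (epoly cb m y) < m"
    by (metis coeff_epoly leading_coeff_0_iff)
  ultimately have "epoly ch d y = 0"
    using degree_mult_eq[of "epoly cq (Suc m) y" "epoly ch d y"] by (cases "epoly ch d y = 0") auto
  then show ?thesis
    using poly_epoly[OF h k, of y "y k"] by simp
qed

section \<open>Rational functions of the map that are polynomial\<close>

context etale
begin

text \<open>The denominators of \<open>s\<close>, as a fraction in polynomials of \<open>F\<close>,
  form an ideal that contains zero.\<close>

definition denominator :: "(point \<Rightarrow> complex) \<Rightarrow> (point \<Rightarrow> complex) \<Rightarrow> bool" where
  "denominator s e \<longleftrightarrow> polyfun n e \<and> (\<exists>p. polyfun n p \<and> (\<forall>x. e (F x) * s x = p (F x)))"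

text \<open>The shape is that of a pseudo-remainder, which is how the ideal property enters.\<close>

lemma denominator_combination:
  assumes "denominator s e" "denominator s e'" "polyfun n a" "polyfun n b"
  shows "denominator s (\<lambda>y. a y * e y - b y * e' y)"
proof -
  obtain p where p: "polyfun n p" "\<And>x. e (F x) * s x = p (F x)"
    using assms(1) unfolding denominator_def by blast
  obtain p' where p': "polyfun n p'" "\<And>x. e' (F x) * s x = p' (F x)"
    using assms(2) unfolding denominator_def by blast
  have "polyfun n (\<lambda>y. a y * e y - b y * e' y)" "polyfun n (\<lambda>y. a y * p y - b y * p' y)"
    using assms p p' by (auto simp: denominator_def)
  moreover have "(a (F x) * e (F x) - b (F x) * e' (F x)) * s x = a (F x) * p (F x) - b (F x) * p' (F x)" for x
    by (simp add: p(2)[symmetric] p'(2)[symmetric] algebra_simps)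
  ultimately show ?thesis unfolding denominator_def by blast
qed

lemma monic_denominator:
  assumes q: "denominator s q0" "q0 y0 \<noteq> 0" and n: "n \<ge> 1"
  shows "\<exists>k<n. \<exists>v m c q. v k = 1 \<and> expansion n k v (Suc m) c q \<and> (\<forall>y. c m y = 1) \<and> denominator s q"
proof -
  have "polyfun n q0" using q by (simp add: denominator_def)
  from polyfun_monic_direction[OF this q(2) n] obtain k v m \<gamma> c where k: "k < n" "v k = 1"
    and \<gamma>: "\<gamma> \<noteq> 0" and c: "expansion n k v m c (\<lambda>y. q0 y - \<gamma> * y k ^ m)"
    by (elim exE conjE)
  \<comment> \<open>The term with coefficient \<open>0\<close> fits the scaling into the shape of
    \<open>denominator_combination\<close>.\<close>
  define q where "q = (\<lambda>y. inverse \<gamma> * q0 y - 0 * q0 y)"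
  have "denominator s q"
    unfolding q_def by (rule denominator_combination[OF q(1) q(1)]) auto
  have "expansion n k v 1 (\<lambda>_ _. 1) (\<lambda>_. 1)"
    by (simp add: expansion_def invariant_def)
  from expansion_shift[OF this, of m]
  have s: "expansion n k v (Suc m) (\<lambda>j x. if j < m then 0 else 1) (\<lambda>y. y k ^ m)"
    by simp
  have "expansion n k v m (\<lambda>j x. inverse \<gamma> * c j x) (\<lambda>y. inverse \<gamma> * (q0 y - \<gamma> * y k ^ m))"
    by (rule expansion_cmult[OF c]) (auto simp: invariant_def)
  from expansion_add[OF expansion_mono[OF this, of "Suc m"] s]
  have "expansion n k v (Suc m) (\<lambda>j x. (if j < m then inverse \<gamma> * c j x else 0) + (if j < m then 0 else 1))
      (\<lambda>y. inverse \<gamma> * (q0 y - \<gamma> * y k ^ m) + y k ^ m)"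
    by simp
  moreover have "(\<lambda>y. inverse \<gamma> * (q0 y - \<gamma> * y k ^ m) + y k ^ m) = q"
    using \<gamma> by (simp add: q_def fun_eq_iff field_simps)
  ultimately have "expansion n k v (Suc m) (\<lambda>j x. (if j < m then inverse \<gamma> * c j x else 0) + (if j < m then 0 else 1)) q"
    by simp
  then show ?thesis
    using k \<open>denominator s q\<close>
    by (intro exI[of _ k] conjI exI[of _ v] exI[of _ m]
        exI[of _ "\<lambda>j x. (if j < m then inverse \<gamma> * c j x else 0) + (if j < m then 0 else 1)"] exI[of _ q]) auto
qed

text \<open>
  A denominator \<open>e\<close> of least degree along \<open>v\<close> is, up to a factor \<open>r\<close> constant along \<open>v\<close>, monic; it is
  coprime to its numerator over the field of rational functions constant along \<open>v\<close>, so that the monic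
  factor has no zero on the image of \<open>F\<close>. Then its composite with \<open>F\<close> is a unit, hence constant.
\<close>

lemma denominator_without_direction:
  assumes k: "k < n" "v k = 1"
    and q: "expansion n k v (Suc m) cq q" and q1: "\<And>y. cq m y = 1" and dq: "denominator s q"
    and s: "polyfun n s"
  shows "\<exists>r y. denominator s r \<and> invariant v r \<and> r y \<noteq> 0"
proof -
  have "\<exists>t. q (shift y t v) \<noteq> 0" for y
    by (rule expansion_nonzero_on_line[OF q k(2), of m]) (simp_all add: q1)
  then obtain y0 where "q y0 \<noteq> 0" by blast
  from minimal_expansion[of "denominator s", OF dq q this]
  obtain d ce e y1 where e: "denominator s e" "expansion n k v (Suc d) ce e" "ce d y1 \<noteq> 0"
    and e_min: "\<And>d' c' e' y. denominator s e' \<Longrightarrow> expansion n k v d' c' e' \<Longrightarrow> d' \<le> d \<Longrightarrow> e' y = 0"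
    by (elim exE conjE) (rule that, assumption+, blast)
  define r where "r = ce d"
  have r: "polyfun n r" "invariant v r" using expansion_coeff[OF e(2)] by (simp_all add: r_def)
  have pe: "polyfun n e" using e(1) by (simp add: denominator_def)
  have pq: "polyfun n q" using dq by (simp add: denominator_def)

  \<comment> \<open>The pseudo-remainder of the monic \<open>q\<close> by \<open>e\<close> is a
    denominator of smaller degree, hence \<open>0\<close>: \<open>e\<close> divides \<open>q\<close>
    times a power of \<open>r\<close>. Gauss's lemma then makes \<open>r\<close> divide every
    coefficient of \<open>e\<close>.\<close>
  from pseudo_division[OF k(1) e(2) q] obtain N a ca b cb where a: "expansion n k v (Suc m - d) ca a"
    and b: "expansion n k v d cb b" and ab: "\<forall>y. r y ^ N * q y = a y * e y + b y"
    unfolding r_def by (elim exE conjE)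
  have pa: "polyfun n a" by (rule expansion_polyfun[OF a k(1)])
  have "denominator s (\<lambda>y. r y ^ N * q y - a y * e y)"
    by (rule denominator_combination[OF dq e(1) polyfun_power[OF r(1)] pa])
  moreover have "(\<lambda>y. r y ^ N * q y - a y * e y) = b" using ab by (simp add: fun_eq_iff)
  ultimately have "b y = 0" for y using e_min[OF _ b order_refl] by simp
  with ab have ae: "ce d y ^ N * q y = a y * e y" for y by (simp add: r_def)
  have "\<exists>g. polyfun n g \<and> (\<forall>y. ce j y = ce d y * g y)" if "j \<le> d" for j
    by (rule leading_coeff_divides[of v k n m cq q _ ca a d ce e y1 N j, OF k(2) q q1 a e(2,3) ae that])
  then have "\<exists>g. \<forall>j\<le>d. polyfun n (g j) \<and> (\<forall>y. ce j y = r y * g j y)"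
    unfolding r_def by metis
  then obtain g where g: "\<And>j. j \<le> d \<Longrightarrow> polyfun n (g j)" "\<And>j y. j \<le> d \<Longrightarrow> ce j y = r y * g j y"
    by blast
  define cm where "cm j = (if j \<le> d then g j else (\<lambda>_. 0))" for j
  \<comment> \<open>\<open>e\<close> with the factor \<open>r\<close> removed; it is monic along
    \<open>v\<close>.\<close>
  define w where "w = (\<lambda>y. \<Sum>j<Suc d. cm j y * y k ^ j)"
  have rnz: "r y1 \<noteq> 0" using e(3) by (simp add: r_def)
  have w: "expansion n k v (Suc d) cm w"
    unfolding expansion_def
  proof (intro conjI allI)
    fix j
    show "polyfun n (cm j)" using g(1) by (simp add: cm_def)
    show "invariant v (cm j)"
    proof (cases "j \<le> d")
      case True
      have "g j (shift y t v) = g j y" for y t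
      proof (rule polyfun_cancel[OF r(1) _ _ rnz, of "\<lambda>y. g j (shift y t v)" "g j"])
        show "polyfun n (\<lambda>y. g j (shift y t v))" "polyfun n (g j)" using g(1)[OF True] by auto
        fix y
        have "r y * g j (shift y t v) = r (shift y t v) * g j (shift y t v)"
          using r(2) by (simp add: invariant_def)
        also have "\<dots> = ce j (shift y t v)" by (simp add: g(2)[OF True])
        also have "\<dots> = ce j y" using expansion_coeff(2)[OF e(2), of j] by (simp add: invariant_def)
        finally show "r y * g j (shift y t v) = r y * g j y" by (simp add: g(2)[OF True])
      qed
      then show ?thesis using True by (simp add: cm_def invariant_def)
    qed (simp add: cm_def invariant_def)
  qed (simp add: w_def)
  have pw: "polyfun n w" by (rule expansion_polyfun[OF w k(1)])
  have ew: "e y = r y * w y" for y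
  proof -
    have "e y = (\<Sum>j<Suc d. ce j y * y k ^ j)" using e(2) unfolding expansion_def by blast
    also have "\<dots> = (\<Sum>j<Suc d. r y * (cm j y * y k ^ j))"
      by (intro sum.cong refl) (simp add: cm_def g(2))
    finally show ?thesis by (simp only: w_def sum_distrib_left)
  qed
  have w1: "cm d y = 1" for y
  proof -
    have "g d y = 1"
      by (rule polyfun_cancel[OF r(1) g(1) _ rnz, of d "\<lambda>_. 1"]) (use g(2)[of d] in \<open>auto simp: r_def\<close>)
    then show ?thesis by (simp add: cm_def)
  qed

  obtain p where p: "polyfun n p" "\<And>x. e (F x) * s x = p (F x)"
    using e(1) unfolding denominator_def by blast
  \<comment> \<open>The ideal generated by numerator and denominator. Its element \<open>h\<close>
    of least degree along \<open>v\<close> acts as their greatest common divisor over the fractions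
    constant along \<open>v\<close>.\<close>
  define J where "J h \<longleftrightarrow> (\<exists>u u'. polyfun n u \<and> polyfun n u' \<and> h = (\<lambda>y. u y * p y + u' y * e y))" for h
  have J_comb: "J (\<lambda>y. a y * h y - b y * h' y)" if "J h" "J h'" "polyfun n a" "polyfun n b" for a b h h'
  proof -
    from that(1) obtain u u' where u: "polyfun n u" "polyfun n u'" "h = (\<lambda>y. u y * p y + u' y * e y)"
      unfolding J_def by blast
    from that(2) obtain z z' where z: "polyfun n z" "polyfun n z'" "h' = (\<lambda>y. z y * p y + z' y * e y)"
      unfolding J_def by blast
    show ?thesis
      unfolding J_def
    proof (intro exI conjI)
      show "polyfun n (\<lambda>y. a y * u y - b y * z y)" "polyfun n (\<lambda>y. a y * u' y - b y * z' y)"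
        using u z that by auto
      show "(\<lambda>y. a y * h y - b y * h' y) =
          (\<lambda>y. (a y * u y - b y * z y) * p y + (a y * u' y - b y * z' y) * e y)"
        by (simp add: u z algebra_simps)
    qed
  qed
  have Je: "J e" unfolding J_def by (intro exI[of _ "\<lambda>_. 0"] exI[of _ "\<lambda>_. 1"]) auto
  have Jp: "J p" unfolding J_def by (intro exI[of _ "\<lambda>_. 1"] exI[of _ "\<lambda>_. 0"]) auto
  have "\<exists>y. e y \<noteq> 0" using expansion_nonzero_on_line[OF e(2) k(2) lessI e(3)] by blast
  then obtain y2 where y2: "e y2 \<noteq> 0" by blast
  from minimal_expansion[of J, OF Je e(2) y2]
  obtain d' ch h y3 y4 where h: "J h" "expansion n k v (Suc d') ch h" "ch d' y3 \<noteq> 0" "h y4 \<noteq> 0"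
    and h_min: "\<And>d'' c' h' y. J h' \<Longrightarrow> expansion n k v d'' c' h' \<Longrightarrow> d'' \<le> d' \<Longrightarrow> h' y = 0"
    by (elim exE conjE) (rule that, assumption+, blast)
  define l where "l = ch d'"
  have l: "polyfun n l" "invariant v l" using expansion_coeff[OF h(2)] by (simp_all add: l_def)
  have div: "\<exists>N a ca. expansion n k v (D - d') ca a \<and> (\<forall>y. l y ^ N * z y = a y * h y)"
    if z: "J z" "expansion n k v D cz z" for z D cz
  proof -
    from pseudo_division[OF k(1) h(2) z(2)] obtain N a ca b cb where a: "expansion n k v (D - d') ca a"
      and b: "expansion n k v d' cb b" and ab: "\<forall>y. l y ^ N * z y = a y * h y + b y"
      unfolding l_def by (elim exE conjE)
    have "J (\<lambda>y. l y ^ N * z y - a y * h y)"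
      by (rule J_comb[OF z(1) h(1) polyfun_power[OF l(1)] expansion_polyfun[OF a k(1)]])
    moreover have "(\<lambda>y. l y ^ N * z y - a y * h y) = b" using ab by (simp add: fun_eq_iff)
    ultimately have "b y = 0" for y using h_min[OF _ b order_refl] by simp
    with a ab show ?thesis by (intro exI conjI allI) auto
  qed
  from div[OF Je e(2)] obtain N1 a1 ca1 where a1: "expansion n k v (Suc d - d') ca1 a1"
    and eq1: "\<And>y. l y ^ N1 * e y = a1 y * h y" by blast
  \<comment> \<open>If \<open>h\<close> had positive degree, cancelling it from numerator and
    denominator would leave the denominator \<open>l ^ N2 * a1\<close>, shorter than
    \<open>e\<close>; so it would be \<open>0\<close>, and then \<open>e\<close> as well.\<close>
  have "d' = 0"
  proof (rule ccontr)
    assume "d' \<noteq> 0"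
    obtain dp cp where cp: "expansion n k v dp cp p" using polyfun_expansion[of k n v p, OF k p(1)] by blast
    from div[OF Jp cp] obtain N2 a2 ca2 where a2: "expansion n k v (dp - d') ca2 a2"
      and eq2: "\<And>y. l y ^ N2 * p y = a2 y * h y" by blast
    have pa12: "polyfun n a1" "polyfun n a2"
      using expansion_polyfun[OF a1 k(1)] expansion_polyfun[OF a2 k(1)] .
    have "denominator s (\<lambda>y. l y ^ N2 * a1 y)"
      unfolding denominator_def
    proof (intro conjI exI allI)
      show "polyfun n (\<lambda>y. l y ^ N2 * a1 y)" "polyfun n (\<lambda>y. a2 y * l y ^ N1)"
        using pa12 l by auto
      fix x
      show "l (F x) ^ N2 * a1 (F x) * s x = a2 (F x) * l (F x) ^ N1"
      proof (rule polyfun_cancel[of n "\<lambda>x. e (F x)" "\<lambda>x. l (F x) ^ N2 * a1 (F x) * s x" "\<lambda>x. a2 (F x) * l (F x) ^ N1"])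
        have "\<exists>x. e (F x) \<noteq> 0" using zero_on_image[OF pe, of y2] y2 by blast
        then show "e (F (SOME x. e (F x) \<noteq> 0)) \<noteq> 0" by (rule someI_ex)
        show "polyfun n (\<lambda>x. e (F x))" "polyfun n (\<lambda>x. l (F x) ^ N2 * a1 (F x) * s x)"
          "polyfun n (\<lambda>x. a2 (F x) * l (F x) ^ N1)"
          by (intro polyfun.mult polyfun_power polyfun_F pe l(1) pa12 s)+
        fix x
        have "e (F x) * (l (F x) ^ N2 * a1 (F x) * s x) = (l (F x) ^ N2 * p (F x)) * a1 (F x)"
          unfolding p(2)[symmetric] by (simp only: mult_ac)
        also have "\<dots> = a2 (F x) * (a1 (F x) * h (F x))" unfolding eq2 by (simp only: mult_ac)
        also have "\<dots> = e (F x) * (a2 (F x) * l (F x) ^ N1)" unfolding eq1[symmetric] by (simp only: mult_ac)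
        finally show "e (F x) * (l (F x) ^ N2 * a1 (F x) * s x) = e (F x) * (a2 (F x) * l (F x) ^ N1)" .
      qed
    qed
    moreover have "expansion n k v (Suc d - d') (\<lambda>j x. l x ^ N2 * ca1 j x) (\<lambda>y. l y ^ N2 * a1 y)"
      by (rule expansion_cmult[OF a1]) (use l in auto)
    moreover have "Suc d - d' \<le> d" using \<open>d' \<noteq> 0\<close> by simp
    ultimately have zero: "l y ^ N2 * a1 y = 0" for y by (rule e_min)
    have "l y ^ Suc (N2 + N1) * e y = 0" for y
    proof -
      have "l y ^ Suc (N2 + N1) * e y = l y * l y ^ N2 * (l y ^ N1 * e y)"
        by (simp add: power_add mult_ac)
      also have "\<dots> = l y * h y * (l y ^ N2 * a1 y)" unfolding eq1 by (simp only: mult_ac)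
      finally show ?thesis using zero by simp
    qed
    then have "e y = 0" for y
    proof (rule polyfun_mult_eq_0[OF polyfun_power[OF l(1)] pe])
      show "l y3 ^ Suc (N2 + N1) \<noteq> 0" using h(3) by (simp add: l_def)
    qed
    with y2 show False by blast
  qed
  then have h_inv: "invariant v h"
    using h(2) expansion_coeff(2)[OF h(2), of 0] by (simp add: expansion_def invariant_def)
  obtain u u' where u: "polyfun n u" "polyfun n u'" "h = (\<lambda>y. u y * p y + u' y * e y)"
    using h(1) unfolding J_def by blast
  \<comment> \<open>The relation \<open>h = u * p + u' * e\<close> read at \<open>F x\<close>: there
    \<open>p\<close> is \<open>e\<close> times \<open>s x\<close>, and \<open>e = r * w\<close>. So
    \<open>w\<close> times this polynomial in \<open>x\<close> is \<open>h\<close>, which is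
    constant along \<open>v\<close>.\<close>
  define z where "z = (\<lambda>x. r (F x) * (u (F x) * s x + u' (F x)))"
  have wz: "w (F x) * z x = h (F x)" for x
    using p(2)[of x] ew[of "F x"] by (simp add: u(3) z_def algebra_simps flip: p(2))
  have ph: "polyfun n h" by (rule expansion_polyfun[OF h(2) k(1)])
  have "w (F x) \<noteq> 0" for x
  proof -
    have "\<exists>t. w (shift (F x) t v) \<noteq> 0"
      by (rule expansion_nonzero_on_line[OF w k(2) lessI]) (simp add: w1)
    then obtain t where t: "w (shift (F x) t v) \<noteq> 0" by blast
    have "polyfun n z" unfolding z_def by (intro polyfun.mult polyfun.add polyfun_F r(1) u(1,2) s)
    from image_avoids_zeros[OF pw this ph h_inv h(4) wz t] show ?thesis .
  qed
  then have "w (F x) = w (F (\<lambda>_. 0))" for x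
    using polyfun_nonvanishing_const[OF polyfun_F[OF pw]] by blast
  then have w_const: "w y = w (F (\<lambda>_. 0))" for y
    using eq_on_image[OF pw polyfun.const] by blast
  \<comment> \<open>A constant \<open>w\<close> has no room for a leading term of positive degree in
    its expansion.\<close>
  have "d = 0"
  proof (rule ccontr)
    assume "d \<noteq> 0"
    have "expansion n k v 1 (\<lambda>_ _. w (F (\<lambda>_. 0))) (\<lambda>_. w (F (\<lambda>_. 0)))"
      by (simp add: expansion_def invariant_def)
    from expansion_diff[OF w expansion_mono[OF this, of "Suc d"]]
    have "expansion n k v (Suc d) (\<lambda>j x. cm j x - (if j < 1 then w (F (\<lambda>_. 0)) else 0)) (\<lambda>y. w y - w (F (\<lambda>_. 0)))"
      by simp
    from expansion_nonzero_on_line[OF this k(2) lessI] w1 \<open>d \<noteq> 0\<close> w_const show False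
      by simp
  qed
  then have "e = r"
    using e(2) by (simp add: expansion_def r_def fun_eq_iff)
  with e(1) r rnz show ?thesis by blast
qed

text \<open>Two denominators are played against each other: \<open>q\<close> monic along
  \<open>v\<close> and \<open>r\<close> constant along \<open>v\<close>. Dividing the numerator of
  \<open>q\<close> by \<open>q\<close> with quotient \<open>a\<close>, one finds that
  \<open>q * (p - r * a)\<close> is \<open>r\<close> times the remainder. Its degree is too small
  for a nonzero multiple of \<open>q\<close>, so \<open>p = r * a\<close>, and the fraction is
  \<open>a\<close>.\<close>

lemma rational_imp_polynomial:
  assumes s: "polyfun n s" and q0: "denominator s q0" "q0 y0 \<noteq> 0" and n: "n \<ge> 1"
  shows "\<exists>c. polyfun n c \<and> (\<forall>x. s x = c (F x))"
proof -
  from monic_denominator[OF q0 n] obtain k v m cq q where k: "k < n" "v k = 1"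
    and q: "expansion n k v (Suc m) cq q" and q1: "\<And>y. cq m y = 1" and dq: "denominator s q"
    by (elim exE conjE) (rule that, assumption+, blast, assumption)
  have "\<exists>r y. denominator s r \<and> invariant v r \<and> r y \<noteq> 0"
    by (rule denominator_without_direction[of k v m cq q s, OF k q q1 dq s])
  then obtain r y1 where r: "denominator s r" "invariant v r" "r y1 \<noteq> 0" by blast
  obtain p where p: "polyfun n p" "\<And>x. r (F x) * s x = p (F x)"
    using r(1) unfolding denominator_def by blast
  obtain p0 where p0: "polyfun n p0" "\<And>x. q (F x) * s x = p0 (F x)"
    using dq unfolding denominator_def by blast
  have pr: "polyfun n r" "polyfun n q" using r dq by (auto simp: denominator_def)
  \<comment> \<open>At points of the image both sides are \<open>r * q\<close> times
    \<open>s\<close>, and the image is dense.\<close>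
  have rp: "r y * p0 y = q y * p y" for y
    by (rule eq_on_image) (use pr p p0 in \<open>auto simp flip: p(2) p0(2)\<close>)
  obtain d0 c0 where c0: "expansion n k v d0 c0 p0" using polyfun_expansion[of k n v p0, OF k p0(1)] by blast
  from pseudo_division[OF k(1) q c0] obtain N a ca b cb where a: "expansion n k v (d0 - m) ca a"
    and b: "expansion n k v m cb b" and "\<forall>y. cq m y ^ N * p0 y = a y * q y + b y"
    by (elim exE conjE)
  then have ab: "p0 y = a y * q y + b y" for y by (simp add: q1)
  have pa: "polyfun n a" "polyfun n b" using expansion_polyfun[OF a k(1)] expansion_polyfun[OF b k(1)] .
  have "polyfun n (\<lambda>y. p y - r y * a y)" using p pr pa by auto
  from polyfun_expansion[of k n v, OF k this] obtain d1 c1 where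
    c1: "expansion n k v d1 c1 (\<lambda>y. p y - r y * a y)" by blast
  have rb: "expansion n k v m (\<lambda>j y. r y * cb j y) (\<lambda>y. r y * b y)"
    by (rule expansion_cmult[OF b pr(1) r(2)])
  have "q y * (p y - r y * a y) = r y * b y" for y
    using rp[of y] ab[of y] by (simp add: algebra_simps)
  from monic_multiple_zero[of v k n m cq q _ _ d1 c1, OF k(2) q q1 rb c1 this]
  have "p y - r y * a y = 0" for y .
  have "s x = a (F x)" for x
  proof (rule polyfun_cancel[of n "\<lambda>x. r (F x)" s "\<lambda>x. a (F x)"])
    have "\<exists>x. r (F x) \<noteq> 0" using zero_on_image[OF pr(1), of y1] r(3) by blast
    then show "r (F (SOME x. r (F x) \<noteq> 0)) \<noteq> 0" by (rule someI_ex)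
    show "polyfun n (\<lambda>x. r (F x))" "polyfun n s" "polyfun n (\<lambda>x. a (F x))" using pr s pa by auto
    show "r (F x) * s x = r (F x) * a (F x)" for x
      using \<open>p (F x) - r (F x) * a (F x) = 0\<close> p(2)[of x] by simp
  qed
  with pa show ?thesis by blast
qed

end

context injective_etale
begin

text \<open>That \<open>g\<close> is a left inverse comes from its construction; that it is a right
  inverse holds on the image of \<open>F\<close> and extends by density, so surjectivity results as
  well.\<close>

lemma polynomial_inverse:
  assumes "n \<ge> 1"
  shows "\<exists>g. (\<forall>i<n. polyfun n (g i)) \<and> (\<forall>x. \<forall>i<n. g i (F x) = x i) \<and> (\<forall>y. \<forall>j<n. f j (\<lambda>i. g i y) = y j)"
proof -
  have "\<exists>c. polyfun n c \<and> (\<forall>x. x i = c (F x))" if i: "i < n" for i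
  proof -
    from coordinate_rational[OF i] obtain q p y where "polyfun n q" "polyfun n p" "q y \<noteq> 0"
      "\<forall>x. q (F x) * x i = p (F x)" by blast
    then have "denominator (\<lambda>x. x i) q" unfolding denominator_def by blast
    from rational_imp_polynomial[OF polyfun.var[OF i] this \<open>q y \<noteq> 0\<close> assms] show ?thesis .
  qed
  then have "\<exists>g. \<forall>i<n. polyfun n (g i) \<and> (\<forall>x. x i = g i (F x))" by metis
  then obtain g where g: "\<And>i. i < n \<Longrightarrow> polyfun n (g i)" "\<And>i x. i < n \<Longrightarrow> g i (F x) = x i"
    by metis
  have "f j (\<lambda>i. g i y) = y j" if j: "j < n" for j y
  proof (rule eq_on_image[where g = "\<lambda>y. f j (\<lambda>i. g i y)" and h = "\<lambda>y. y j"])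
    show "polyfun n (\<lambda>y. f j (\<lambda>i. g i y))" by (rule polyfun_compose[OF f[OF j]]) (rule g)
    show "polyfun n (\<lambda>y. y j)" using j by auto
    fix x
    have "f j (\<lambda>i. g i (F x)) = f j x" by (rule polyfun_cong[OF f[OF j]]) (rule g)
    then show "f j (\<lambda>i. g i (F x)) = F x j" by (simp add: F_def)
  qed
  with g show ?thesis by blast
qed

end

section \<open>Nilpotent matrices\<close>

lemma strictly_upper_pow:
  fixes B :: "complex mat"
  assumes B: "B \<in> carrier_mat m m" and low: "\<And>i j. i < m \<Longrightarrow> j < m \<Longrightarrow> j \<le> i \<Longrightarrow> B $$ (i, j) = 0"
  shows "i < m \<Longrightarrow> j < m \<Longrightarrow> j < i + k \<Longrightarrow> (B ^\<^sub>m k) $$ (i, j) = 0"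
proof (induction k arbitrary: j)
  case 0
  then show ?case using B by simp
next
  case (Suc k)
  have Bk: "B ^\<^sub>m k \<in> carrier_mat m m" using B by simp
  have "(B ^\<^sub>m Suc k) $$ (i, j) = (\<Sum>l<m. (B ^\<^sub>m k) $$ (i, l) * B $$ (l, j))"
    using B Bk Suc.prems by (simp add: scalar_prod_def lessThan_atLeast0)
  also have "\<dots> = 0"
  proof (rule sum.neutral, rule ballI)
    fix l assume "l \<in> {..<m}"
    then have "(B ^\<^sub>m k) $$ (i, l) = 0 \<or> B $$ (l, j) = 0"
      using Suc.IH[of l] low[of l j] Suc.prems by (cases "l < i + k") auto
    then show "(B ^\<^sub>m k) $$ (i, l) * B $$ (l, j) = 0" by auto
  qed
  finally show ?case .
qed

text \<open>The Schur form has the eigenvalues on its diagonal; all being \<open>0\<close>, it is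
  strictly triangular. Eigenvectors suit the elimination below better than powers of a Jacobian
  matrix.\<close>

lemma nilpotent_if_no_eigenvalue:
  fixes A :: "complex mat"
  assumes A: "A \<in> carrier_mat m m"
    and ev: "\<And>v \<mu>. v \<in> carrier_vec m \<Longrightarrow> \<mu> \<noteq> 0 \<Longrightarrow> A *\<^sub>v v = \<mu> \<cdot>\<^sub>v v \<Longrightarrow> v = 0\<^sub>v m"
  shows "A ^\<^sub>m m = 0\<^sub>m m m"
proof -
  obtain as where "char_poly A = (\<Prod>a\<leftarrow>as. [:- a, 1:])" using char_poly_factorized[OF A] by blast
  from schur_decomposition_exists[OF A this] obtain B
    where B: "B \<in> carrier_mat m m" "upper_triangular B" "similar_mat A B" by blast
  have diag: "B $$ (i, i) = 0" if "i < m" for i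
  proof (rule ccontr)
    assume nz: "B $$ (i, i) \<noteq> 0"
    have "B $$ (i, i) \<in> set (diag_mat B)" using that B(1) by (auto simp: diag_mat_def)
    then have "poly (char_poly B) (B $$ (i, i)) = 0"
      unfolding char_poly_upper_triangular[OF B(1,2)] by (force simp: poly_prod_list prod_list_zero_iff)
    then have "eigenvalue A (B $$ (i, i))"
      using eigenvalue_root_char_poly[OF A] char_poly_similar[OF B(3)] by simp
    then obtain v where "v \<in> carrier_vec m" "v \<noteq> 0\<^sub>v m" "A *\<^sub>v v = B $$ (i, i) \<cdot>\<^sub>v v"
      using A unfolding eigenvalue_def eigenvector_def by auto
    with ev nz show False by blast
  qed
  have low: "B $$ (i, j) = 0" if "i < m" "j < m" "j \<le> i" for i j
    using that diag[of i] B(1,2) unfolding upper_triangular_def by (cases "i = j") auto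
  have Bm: "B ^\<^sub>m m = 0\<^sub>m m m"
    using B(1) strictly_upper_pow[OF B(1) low, of _ _ m] by (intro eq_matI) auto
  obtain P Q where PQ: "similar_mat_wit A B P Q" using B(3) unfolding similar_mat_def by blast
  have "P \<in> carrier_mat m m" "Q \<in> carrier_mat m m" "A ^\<^sub>m m = P * (B ^\<^sub>m m) * Q"
    using similar_mat_witD2[OF pow_carrier_mat[OF A] similar_mat_wit_pow[OF PQ, of m]] by blast+
  then show ?thesis by (simp add: Bm)
qed

section \<open>From fixed points of nilpotent maps to injectivity\<close>

text \<open>The condition \<open>JN m\<close> for polynomial functions: nilpotency is asked
  pointwise, and equality only in the coordinates below \<open>m\<close>.\<close>

definition unique_fixed_points :: "nat \<Rightarrow> bool" where
  "unique_fixed_points m \<longleftrightarrow> (\<forall>N. (\<forall>i<m. polyfun m (N i)) \<longrightarrow>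
    (\<forall>z. mat m m (\<lambda>(i, j). pd j (N i) z) ^\<^sub>m m = 0\<^sub>m m m) \<longrightarrow>
    (\<forall>x y. (\<forall>i<m. N i x = x i) \<longrightarrow> (\<forall>i<m. N i y = y i) \<longrightarrow> (\<forall>i<m. x i = y i)))"

text \<open>Homogeneity of degree \<open>m - 1\<close>; the quotient \<open>t ^ m / t\<close> avoids
  truncated subtraction at \<open>m = 0\<close>.\<close>

lemma dird_form_scale:
  assumes g: "form n m g" and t: "t \<noteq> 0"
  shows "dird n w g (\<lambda>i. t * z i) = t ^ m / t * dird n w g z"
proof (rule dird_unique[OF form_polyfun[OF g]])
  have eq: "g (shift (\<lambda>i. t * z i) s w) = t ^ m * g (shift z (s / t) w)" for s
  proof -
    have "shift (\<lambda>i. t * z i) s w = (\<lambda>i. t * shift z (s / t) w i)"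
      using t by (simp add: shift_def fun_eq_iff algebra_simps)
    then show ?thesis by (simp add: form_scale[OF g])
  qed
  have "((\<lambda>s. g (shift z (s / t) w)) has_field_derivative dird n w g (shift z (0 / t) w) * (1 / t)) (at 0)"
    by (rule DERIV_chain2[OF DERIV_shift[OF form_polyfun[OF g]]]) (use t in \<open>auto intro!: derivative_eq_intros\<close>)
  from DERIV_cmult[OF this, of "t ^ m"]
  show "((\<lambda>s. g (shift (\<lambda>i. t * z i) s w)) has_field_derivative t ^ m / t * dird n w g z) (at 0)"
    unfolding eq by (simp add: mult_ac)
qed

context etale
begin

lemma jacobian_kernel_trivial:
  assumes "\<And>j. j < n \<Longrightarrow> dird n w (f j) x = 0" "i < n"
  shows "w i = 0"
proof -
  have "(\<Sum>j<n. C i j x * dird n w (f j) x) = (\<Sum>j<n. \<Sum>l<n. w l * (C i j x * pd l (f j) x))"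
    by (simp add: dird_def sum_distrib_left mult_ac)
  also have "\<dots> = (\<Sum>l<n. w l * (\<Sum>j<n. C i j x * pd l (f j) x))"
    by (subst sum.swap) (simp add: sum_distrib_left)
  also have "\<dots> = (\<Sum>l<n. if l = i then w i else 0)"
    by (intro sum.cong refl) (auto simp: C_jacobian[OF assms(2)])
  finally show ?thesis using assms by simp
qed

text \<open>
  With \<open>H m\<close> the homogeneous components of \<open>f\<close>, normalised so that \<open>H 1\<close> is the identity, the map
  \<open>(H 2 (x) - y\<^sub>1, H 3 (x) - y\<^sub>2, \<dots>, H d (x))\<close> of \<open>(x, y\<^sub>1, \<dots>)\<close> is nilpotent: eliminating the \<open>y\<close>-part of an
  eigenvector for \<open>- \<mu>\<close> leaves a kernel vector of the Jacobian matrix of \<open>f\<close> at \<open>x / \<mu>\<close>. A translate of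
  its negative has as fixed points the points of a fibre of \<open>f\<close>.
\<close>

lemma unique_fixed_points_imp_injective:
  assumes JN: "\<And>m. m \<ge> 1 \<Longrightarrow> unique_fixed_points m" and n: "n \<ge> 1"
    and fib: "\<And>i. i < n \<Longrightarrow> f i p = f i q" and i: "i < n"
  shows "p i = q i"
proof -
  have "\<forall>j. \<exists>dh. j < n \<longrightarrow> graded n (fst dh) (snd dh) (f j)"
    using polyfun_graded[OF f] by (metis fst_conv snd_conv)
  then obtain dh where dh: "\<And>j. j < n \<Longrightarrow> graded n (fst (dh j)) (snd (dh j)) (f j)" by metis
  \<comment> \<open>The extra \<open>Suc\<close> ensures \<open>K \<ge> 1\<close>; the degrees from
    \<open>2\<close> to \<open>K + 1\<close> will fill \<open>K\<close> blocks.\<close>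
  define K where "K = Suc (\<Sum>j<n. fst (dh j))"
  define h where "h j = snd (dh j)" for j
  have h: "graded n (Suc K) (h j) (f j)" if "j < n" for j
    unfolding h_def
  proof (rule graded_mono[OF dh[OF that]])
    have "fst (dh j) \<le> (\<Sum>j<n. fst (dh j))"
      using that by (intro member_le_sum) auto
    then show "fst (dh j) \<le> Suc K" by (simp add: K_def)
  qed
  have K: "K \<ge> 1" by (simp add: K_def)
  define C0 where "C0 i j = C i j (\<lambda>_. 0)" for i j
  \<comment> \<open>Components of \<open>f\<close> after multiplication by the inverse Jacobian
    matrix at the origin, which makes the linear part the identity.\<close>
  define H where "H m i = (\<lambda>x. \<Sum>j<n. C0 i j * h j m x)" for m i
  have formH: "form n m (H m i)" for m i
    unfolding H_def by (intro form_sum form_cmult) (use gradedD(1)[OF h] in auto)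
  have polyH: "polyfun n (H m i)" for m i by (rule form_polyfun[OF formH])
  have sum_split: "(\<Sum>m\<le>Suc K. g m) = g 0 + g 1 + (\<Sum>l<K. g (l + 2))" for g :: "nat \<Rightarrow> complex"
  proof -
    have "(\<Sum>m\<le>Suc K. g m) = (\<Sum>m<Suc (Suc K). g m)" by (simp only: lessThan_Suc_atMost)
    then show ?thesis by (simp add: sum.lessThan_Suc_shift del: sum.lessThan_Suc)
  qed
  have f_H: "(\<Sum>j<n. C0 i j * f j x) = (\<Sum>m\<le>Suc K. H m i x)" for i x
  proof -
    have "(\<Sum>j<n. C0 i j * f j x) = (\<Sum>j<n. \<Sum>m\<le>Suc K. C0 i j * h j m x)"
      by (intro sum.cong refl) (simp only: gradedD(3)[OF h] sum_distrib_left lessThan_iff)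
    also have "\<dots> = (\<Sum>m\<le>Suc K. H m i x)"
      unfolding H_def by (rule sum.swap)
    finally show ?thesis .
  qed
  have H0: "H 0 i x = H 0 i y" for i x y
    using form_scale[OF formH[of 0 i], of 0 x] form_scale[OF formH[of 0 i], of 0 y] by simp
  have h1: "h j 1 x = dird n x (f j) (\<lambda>_. 0)" if "j < n" for j x
  proof (rule dird_unique[OF f[OF that], symmetric])
    define R where "R = (\<Sum>m\<le>Suc K. monom (h j m x) m)"
    have "f j (shift (\<lambda>_. 0) s x) = poly R s" for s
      using graded_scale[OF h[OF that], of s x] by (simp add: shift_def R_def poly_sum poly_monom)
    moreover have "poly (pderiv R) 0 = h j 1 x"
    proof -
      have "coeff (pderiv R) 0 = h j 1 x"
        using K by (simp add: coeff_pderiv R_def coeff_sum)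
      then show ?thesis by (simp add: poly_0_coeff_0)
    qed
    ultimately show "((\<lambda>s. f j (shift (\<lambda>_. 0) s x)) has_field_derivative h j 1 x) (at 0)"
      using poly_DERIV[of R 0] by simp
  qed
  have H1: "H 1 i x = x i" if "i < n" for i x
  proof -
    have "H 1 i x = (\<Sum>j<n. \<Sum>l<n. x l * (C i j (\<lambda>_. 0) * pd l (f j) (\<lambda>_. 0)))"
      unfolding H_def by (intro sum.cong refl) (simp add: h1[unfolded One_nat_def] dird_def C0_def sum_distrib_left mult_ac)
    also have "\<dots> = (\<Sum>l<n. x l * (\<Sum>j<n. C i j (\<lambda>_. 0) * pd l (f j) (\<lambda>_. 0)))"
      by (subst sum.swap) (simp add: sum_distrib_left)
    also have "\<dots> = (\<Sum>l<n. if l = i then x i else 0)"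
      by (intro sum.cong refl) (auto simp: C_jacobian[OF that])
    finally show ?thesis using that by simp
  qed
  \<comment> \<open>The value of the normalised map on the fibre of \<open>p\<close>, less its
    constant term.\<close>
  define c where "c i = (\<Sum>j<n. C0 i j * f j p) - H 0 i p" for i
  \<comment> \<open>\<open>K\<close> blocks of \<open>n\<close> coordinates: \<open>a div n\<close>
    is the block, \<open>a mod n\<close> the position in it, \<open>a + n\<close> the same position
    in the next block. Block \<open>0\<close> holds \<open>x\<close>.\<close>
  define M where "M = n * K"
  have M: "M \<ge> 1" "n \<le> M" using n K by (auto simp: M_def)
  define N where "N a = (\<lambda>z :: point. (if a < n then c a else 0) - H (a div n + 2) (a mod n) z
      + (if a + n < M then z (a + n) else 0))" for a
  have polyN: "polyfun M (N a)" for a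
    unfolding N_def by (cases "a + n < M") (auto intro!: polyfun.add polyfun_diff polyfun_mono[OF polyH M(2)])

  \<comment> \<open>Read from the last block backwards, the fixed point equations determine the
    blocks after \<open>x\<close> as negative tails of the sum of components.\<close>
  define Z where "Z x = (\<lambda>a. if a < n then x a else - (\<Sum>l\<in>{a div n..<K}. H (l + 2) (a mod n) x))" for x :: point
  have fixed: "N a (Z x) = Z x a" if x: "\<And>j. j < n \<Longrightarrow> f j x = f j p" and a: "a < M" for x a
  proof -
    have HZ: "H m i (Z x) = H m i x" for m i
      by (rule polyfun_cong[OF polyH]) (simp add: Z_def)
    have div: "a div n < K" using a n by (simp add: M_def less_mult_imp_div_less mult.commute)
    have next_eq: "(if a + n < M then Z x (a + n) else 0) = - (\<Sum>l\<in>{Suc (a div n)..<K}. H (l + 2) (a mod n) x)"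
    proof (cases "a + n < M")
      case True
      then show ?thesis using n by (simp add: Z_def)
    next
      case False
      have "K \<le> (a + n) div n"
        using False n by (metis M_def div_le_mono nonzero_mult_div_cancel_left not_less not_one_le_zero)
      then have "K \<le> Suc (a div n)" using n by simp
      then show ?thesis using False by simp
    qed
    have tail: "(\<Sum>l\<in>{a div n..<K}. H (l + 2) (a mod n) x) =
        H (a div n + 2) (a mod n) x + (\<Sum>l\<in>{Suc (a div n)..<K}. H (l + 2) (a mod n) x)"
      using div by (simp add: sum.atLeast_Suc_lessThan)
    show ?thesis
    proof (cases "a < n")
      case True
      have "(\<Sum>j<n. C0 a j * f j p) = (\<Sum>j<n. C0 a j * f j x)"
        by (intro sum.cong refl) (simp add: x)
      then have "c a = x a + (\<Sum>l<K. H (l + 2) a x)"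
        using H0[of a p x] H1[OF True, of x] f_H[of a x] by (simp add: c_def sum_split del: sum.atMost_Suc)
      then show ?thesis
        using True tail unfolding N_def HZ next_eq by (simp add: Z_def lessThan_atLeast0)
    next
      case False
      then show ?thesis
        using tail unfolding N_def HZ next_eq by (simp add: Z_def)
    qed
  qed

  have nil: "mat M M (\<lambda>(a, b). pd b (N a) z) ^\<^sub>m M = 0\<^sub>m M M" for z
  proof (rule nilpotent_if_no_eigenvalue)
    fix v \<mu> assume v: "v \<in> carrier_vec M" and \<mu>: "\<mu> \<noteq> 0"
      and eigen: "mat M M (\<lambda>(a, b). pd b (N a) z) *\<^sub>v v = \<mu> \<cdot>\<^sub>v v"
    define w where "w a = (if a < M then v $ a else 0)" for a
    define E where "E m i = dird n w (H m i) z" for m i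
    \<comment> \<open>Row \<open>a\<close> of the eigenvector equation; past the last block the next
      entry counts as \<open>0\<close>.\<close>
    have step: "(if a + n < M then w (a + n) else 0) = \<mu> * w a + E (a div n + 2) (a mod n)" if a: "a < M" for a
    proof -
      have "(mat M M (\<lambda>(a, b). pd b (N a) z) *\<^sub>v v) $ a = (\<Sum>b<M. w b * pd b (N a) z)"
        using a v by (simp add: scalar_prod_def w_def lessThan_atLeast0 mult.commute)
      then have "dird M w (N a) z = \<mu> * w a"
        using a v by (simp add: eigen dird_def w_def)
      moreover have "dird M w (N a) z = (if a + n < M then w (a + n) else 0) - E (a div n + 2) (a mod n)"
      proof (rule dird_unique[OF polyN])
        have "((\<lambda>s. H (a div n + 2) (a mod n) (shift z s w)) has_field_derivative E (a div n + 2) (a mod n)) (at 0)"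
          unfolding E_def by (rule DERIV_shift_0[OF polyH])
        moreover have "((\<lambda>s. if a + n < M then shift z s w (a + n) else 0) has_field_derivative
            (if a + n < M then w (a + n) else 0)) (at 0)"
          by (auto simp: shift_def intro!: derivative_eq_intros)
        ultimately show "((\<lambda>s. N a (shift z s w)) has_field_derivative
            (if a + n < M then w (a + n) else 0) - E (a div n + 2) (a mod n)) (at 0)"
          unfolding N_def by (auto intro!: derivative_eq_intros)
      qed
      ultimately show ?thesis by (simp add: diff_eq_eq)
    qed
    \<comment> \<open>Block \<open>k\<close> of the eigenvector; \<open>W K = 0\<close> closes the
      recursion.\<close>
    define W where "W k i = (if k < K then w (k * n + i) else 0)" for k i
    have W_Suc: "W (Suc k) i = \<mu> * W k i + E (k + 2) i" if "k < K" "i < n" for k i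
    proof -
      have lt: "k * n + i < M"
      proof -
        have "k * n + i < Suc k * n" using that by simp
        also have "\<dots> \<le> K * n" using that by (intro mult_le_mono1) simp
        finally show ?thesis by (simp add: M_def mult.commute)
      qed
      have iff: "k * n + i + n < M \<longleftrightarrow> Suc k < K"
      proof
        assume "k * n + i + n < M"
        then have "Suc k * n < K * n" by (simp add: M_def mult.commute)
        then show "Suc k < K" by (simp only: mult_less_cancel2)
      next
        assume "Suc k < K"
        then have "Suc (Suc k) * n \<le> K * n" by (intro mult_le_mono1) simp
        then show "k * n + i + n < M" using that by (simp add: M_def mult.commute)
      qed
      have dm: "(k * n + i) div n = k" "(k * n + i) mod n = i" using that by auto
      have eq: "k * n + i + n = Suc k * n + i" by simp
      have "(if Suc k < K then w (Suc k * n + i) else 0) = \<mu> * w (k * n + i) + E (k + 2) i"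
        using step[OF lt, unfolded iff dm] by (simp only: eq)
      then show ?thesis
        using that by (simp only: W_def if_True)
    qed
    \<comment> \<open>The recursion unrolled. At \<open>k = K\<close> the left side is
      \<open>0\<close>, and division by \<open>\<mu> ^ K\<close> leaves the weights
      \<open>t ^ (l + 1)\<close> with \<open>t = 1 / \<mu>\<close>, exactly those by which the
      derivative of \<open>H (l + 2)\<close> scales from \<open>z\<close> to
      \<open>t * z\<close>.\<close>
    have W_eq: "W k i = \<mu> ^ k * w i + (\<Sum>l<k. \<mu> ^ (k - 1 - l) * E (l + 2) i)" if "k \<le> K" "i < n" for k i
      using that(1)
    proof (induction k)
      case 0
      then show ?case using K by (simp add: W_def)
    next
      case (Suc k)
      have "(\<Sum>l<k. \<mu> * (\<mu> ^ (k - 1 - l) * E (l + 2) i)) = (\<Sum>l<k. \<mu> ^ (k - l) * E (l + 2) i)"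
      proof (rule sum.cong[OF refl])
        fix l assume "l \<in> {..<k}"
        then have "k - l = Suc (k - 1 - l)" by auto
        then show "\<mu> * (\<mu> ^ (k - 1 - l) * E (l + 2) i) = \<mu> ^ (k - l) * E (l + 2) i" by simp
      qed
      then show ?case
        using W_Suc[of k i] Suc that(2) by (simp add: distrib_left sum_distrib_left mult.assoc)
    qed
    define t where "t = 1 / \<mu>"
    have t: "t \<noteq> 0" "\<mu> * t = 1" using \<mu> by (simp_all add: t_def)
    have kernel: "(\<Sum>j<n. C0 i j * dird n w (f j) (\<lambda>k. t * z k)) = 0" if i: "i < n" for i
    proof -
      have "(\<Sum>j<n. C0 i j * dird n w (f j) (\<lambda>k. t * z k)) = dird n w (\<lambda>x. \<Sum>j<n. C0 i j * f j x) (\<lambda>k. t * z k)"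
        by (subst dird_sum) (auto simp: dird_cmult f intro!: polyfun.mult)
      also have "\<dots> = dird n w (\<lambda>x. \<Sum>m\<le>Suc K. H m i x) (\<lambda>k. t * z k)"
        by (simp only: f_H)
      also have "\<dots> = (\<Sum>m\<le>Suc K. dird n w (H m i) (\<lambda>k. t * z k))"
        by (rule dird_sum) (rule polyH)
      also have "\<dots> = w i + (\<Sum>l<K. t ^ (l + 2) / t * E (l + 2) i)"
      proof -
        have "dird n w (H 0 i) y = 0" for y
        proof -
          have "H 0 i = (\<lambda>_. H 0 i z)" by (rule ext) (rule H0)
          then show ?thesis by (metis dird_const)
        qed
        moreover have "H 1 i = (\<lambda>x. x i)" using H1[OF i] by (simp add: fun_eq_iff)
        then have "dird n w (H 1 i) y = w i" for y using dird_var[OF i] by simp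
        moreover have "dird n w (H (l + 2) i) (\<lambda>k. t * z k) = t ^ (l + 2) / t * E (l + 2) i" for l
          unfolding E_def by (rule dird_form_scale[OF formH t(1)])
        ultimately show ?thesis by (simp only: sum_split) simp
      qed
      finally have eq: "(\<Sum>j<n. C0 i j * dird n w (f j) (\<lambda>k. t * z k)) = w i + (\<Sum>l<K. t ^ (l + 2) / t * E (l + 2) i)" .
      have "\<mu> ^ K * (w i + (\<Sum>l<K. t ^ (l + 2) / t * E (l + 2) i)) = W K i"
      proof -
        have pw: "\<mu> ^ K * (t ^ (l + 2) / t * E (l + 2) i) = \<mu> ^ (K - 1 - l) * E (l + 2) i" if "l < K" for l
        proof -
          have "K = (K - 1 - l) + Suc l" using that by simp
          then have "\<mu> ^ K = \<mu> ^ (K - 1 - l) * \<mu> ^ Suc l" by (metis power_add)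
          moreover have "t ^ (l + 2) / t = t ^ Suc l" using t by simp
          ultimately have "\<mu> ^ K * (t ^ (l + 2) / t) = \<mu> ^ (K - 1 - l) * (\<mu> * t) ^ Suc l"
            by (simp only: power_mult_distrib mult.assoc)
          then show ?thesis using t by (simp add: mult.assoc[symmetric])
        qed
        have "\<mu> ^ K * (w i + (\<Sum>l<K. t ^ (l + 2) / t * E (l + 2) i)) =
            \<mu> ^ K * w i + (\<Sum>l<K. \<mu> ^ K * (t ^ (l + 2) / t * E (l + 2) i))"
          by (simp only: distrib_left sum_distrib_left)
        also have "(\<Sum>l<K. \<mu> ^ K * (t ^ (l + 2) / t * E (l + 2) i)) = (\<Sum>l<K. \<mu> ^ (K - 1 - l) * E (l + 2) i)"
          by (rule sum.cong[OF refl], rule pw) simp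
        finally show ?thesis by (simp only: W_eq[OF order_refl i])
      qed
      also have "W K i = 0" by (simp add: W_def)
      finally show ?thesis using eq \<mu> by simp
    qed
    \<comment> \<open>Multiplying by the Jacobian matrix at the origin removes the
      normalisation.\<close>
    have "dird n w (f j) (\<lambda>k. t * z k) = 0" if j: "j < n" for j
    proof -
      let ?g = "\<lambda>j. dird n w (f j) (\<lambda>k. t * z k)"
      have "(\<Sum>i<n. pd i (f j) (\<lambda>_. 0) * (\<Sum>l<n. C0 i l * ?g l)) = (\<Sum>l<n. (\<Sum>i<n. pd i (f j) (\<lambda>_. 0) * C0 i l) * ?g l)"
        unfolding sum_distrib_left sum_distrib_right by (subst sum.swap) (simp add: mult.assoc)
      also have "\<dots> = (\<Sum>l<n. if l = j then ?g j else 0)"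
        by (intro sum.cong refl) (auto simp: C0_def jacobian_C[OF j])
      finally show ?thesis using kernel j by simp
    qed
    \<comment> \<open>Once the first block is zero, every \<open>E\<close> vanishes, since it
      involves that block only, and with it the remaining blocks.\<close>
    then have w0: "w i = 0" if "i < n" for i
      using jacobian_kernel_trivial[of w "\<lambda>k. t * z k" i] that by blast
    then have E0: "E m i = 0" for m i
      by (simp add: E_def dird_def)
    show "v = 0\<^sub>v M"
    proof (rule eq_vecI)
      fix a assume a: "a < dim_vec (0\<^sub>v M :: complex vec)"
      have k: "a div n < K" using a n by (simp add: M_def less_mult_imp_div_less mult.commute)
      have "w a = W (a div n) (a mod n)" using k by (simp add: W_def)
      also have "\<dots> = 0" using W_eq[of "a div n" "a mod n"] k n w0 E0 by simp
      finally show "v $ a = 0\<^sub>v M $ a" using a by (simp add: w_def)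
    qed (use v in auto)
  qed (simp add: M_def)

  have "\<forall>x y. (\<forall>i<M. N i x = x i) \<longrightarrow> (\<forall>i<M. N i y = y i) \<longrightarrow> (\<forall>i<M. x i = y i)"
    using JN[OF M(1)] polyN nil unfolding unique_fixed_points_def by blast
  moreover have "\<forall>a<M. N a (Z p) = Z p a" by (intro allI impI fixed) auto
  moreover have "\<forall>a<M. N a (Z q) = Z q a" by (intro allI impI fixed) (auto simp: fib)
  ultimately have "Z p a = Z q a" if "a < M" for a using that by blast
  from this[of i] show ?thesis using i M(2) by (simp add: Z_def)
qed

end

section \<open>Formal polynomials and polynomial functions\<close>

definition eval_monom :: "complex vec \<Rightarrow> (nat \<Rightarrow>\<^sub>0 nat) \<Rightarrow> complex" where
  "eval_monom x m = (\<Prod>i\<in>Poly_Mapping.keys m. (x $ i) ^ Poly_Mapping.lookup m i)"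

lemma eval_monom_superset:
  assumes "finite A" "Poly_Mapping.keys m \<subseteq> A"
  shows "eval_monom x m = (\<Prod>i\<in>A. (x $ i) ^ Poly_Mapping.lookup m i)"
  unfolding eval_monom_def using assms
  by (intro prod.mono_neutral_left) (auto simp: in_keys_iff)

lemma eval_monom_add: "eval_monom x (m + m') = eval_monom x m * eval_monom x m'"
proof -
  let ?A = "Poly_Mapping.keys m \<union> Poly_Mapping.keys m'"
  have "eval_monom x (m + m') = (\<Prod>i\<in>?A. (x $ i) ^ Poly_Mapping.lookup (m + m') i)"
    by (rule eval_monom_superset) (auto simp: keys_add)
  also have "\<dots> = eval_monom x m * eval_monom x m'"
    by (simp add: eval_monom_superset[of ?A m] eval_monom_superset[of ?A m'] lookup_add power_add prod.distrib)
  finally show ?thesis .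
qed

lemma eval_poly_superset:
  assumes "finite A" "Poly_Mapping.keys p \<subseteq> A"
  shows "eval_poly x p = (\<Sum>m\<in>A. Poly_Mapping.lookup p m * eval_monom x m)"
  unfolding eval_poly_def eval_monom_def[symmetric] using assms
  by (intro sum.mono_neutral_left) (auto simp: in_keys_iff)

lemma eval_poly_add: "eval_poly x (p + q) = eval_poly x p + eval_poly x q"
proof -
  let ?A = "Poly_Mapping.keys p \<union> Poly_Mapping.keys q"
  have "eval_poly x (p + q) = (\<Sum>m\<in>?A. Poly_Mapping.lookup (p + q) m * eval_monom x m)"
    by (rule eval_poly_superset) (auto simp: keys_add)
  also have "\<dots> = eval_poly x p + eval_poly x q"
    by (simp add: eval_poly_superset[of ?A p] eval_poly_superset[of ?A q] lookup_add distrib_right sum.distrib)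
  finally show ?thesis .
qed

lemma eval_poly_zero: "eval_poly x 0 = 0"
  by (simp add: eval_poly_def)

lemma eval_poly_sum: "eval_poly x (\<Sum>a\<in>A. p a) = (\<Sum>a\<in>A. eval_poly x (p a))"
  by (induction A rule: infinite_finite_induct) (auto simp: eval_poly_add eval_poly_zero)

lemma eval_poly_single: "eval_poly x (Poly_Mapping.single m c) = c * eval_monom x m"
  by (subst eval_poly_superset[of "{m}"]) auto

lemma sum_single_keys: "(\<Sum>m\<in>Poly_Mapping.keys p. Poly_Mapping.single m (Poly_Mapping.lookup p m)) = p"
proof (rule poly_mapping_eqI)
  fix k
  show "Poly_Mapping.lookup (\<Sum>m\<in>Poly_Mapping.keys p. Poly_Mapping.single m (Poly_Mapping.lookup p m)) k =
      Poly_Mapping.lookup p k"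
    by (simp add: lookup_sum lookup_single when_def in_keys_iff)
qed

lemma eval_poly_mult: "eval_poly x (p * q) = eval_poly x p * eval_poly x q"
proof -
  let ?s = "\<lambda>p m. Poly_Mapping.single m (Poly_Mapping.lookup p m)"
  have "eval_poly x (p * q) =
      eval_poly x ((\<Sum>m\<in>Poly_Mapping.keys p. ?s p m) * (\<Sum>m\<in>Poly_Mapping.keys q. ?s q m))"
    by (simp only: sum_single_keys)
  also have "\<dots> = (\<Sum>m\<in>Poly_Mapping.keys p. \<Sum>m'\<in>Poly_Mapping.keys q. eval_poly x (?s p m * ?s q m'))"
    by (simp only: sum_product eval_poly_sum)
  also have "\<dots> = (\<Sum>m\<in>Poly_Mapping.keys p. \<Sum>m'\<in>Poly_Mapping.keys q. eval_poly x (?s p m) * eval_poly x (?s q m'))"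
    by (simp add: mult_single eval_poly_single eval_monom_add mult_ac)
  also have "\<dots> = eval_poly x p * eval_poly x q"
    by (simp only: sum_product[symmetric] eval_poly_sum[symmetric] sum_single_keys)
  finally show ?thesis .
qed

lemma eval_poly_one: "eval_poly x 1 = 1"
  unfolding single_one[symmetric] eval_poly_single by (simp add: eval_monom_def)

text \<open>As a ring homomorphism, evaluation passes through determinants and matrix
  powers.\<close>

interpretation eval_hom: comm_ring_hom "eval_poly x"
  by unfold_locales (simp_all add: eval_poly_add eval_poly_mult eval_poly_zero eval_poly_one)

lemma polys_single: "Poly_Mapping.keys m \<subseteq> {..<n} \<Longrightarrow> Poly_Mapping.single m c \<in> polys n"
  by (simp add: polys_def)

lemma polys_add:
  assumes "p \<in> polys n" "q \<in> polys n"
  shows "p + q \<in> polys n"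
  using assms subsetD[OF keys_add[of p q]] unfolding polys_def by blast

lemma polys_mult: "p \<in> polys n \<Longrightarrow> q \<in> polys n \<Longrightarrow> p * q \<in> polys n"
proof -
  assume p: "p \<in> polys n" and q: "q \<in> polys n"
  have "Poly_Mapping.keys m \<subseteq> {..<n}" if m: "m \<in> Poly_Mapping.keys (p * q)" for m
  proof -
    obtain a b where "m = a + b" "a \<in> Poly_Mapping.keys p" "b \<in> Poly_Mapping.keys q"
      using subsetD[OF keys_mult m] by blast
    then show ?thesis using p q keys_add[of a b] unfolding polys_def by blast
  qed
  then show "p * q \<in> polys n" by (simp add: polys_def)
qed

lemma polys_zero: "0 \<in> polys n"
  by (simp add: polys_def)

lemma polys_one: "1 \<in> polys n"
  by (simp add: polys_def)

lemma polys_sum: "(\<And>a. a \<in> A \<Longrightarrow> p a \<in> polys n) \<Longrightarrow> (\<Sum>a\<in>A. p a) \<in> polys n"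
  by (induction A rule: infinite_finite_induct) (auto simp: polys_zero polys_add)

text \<open>\<open>vec n x\<close> cuts a point down to its first \<open>n\<close> coordinates;
  \<open>polys n\<close> guarantees that no other entry is ever accessed.\<close>

lemma polys_polyfun:
  assumes "p \<in> polys n"
  shows "polyfun n (\<lambda>x. eval_poly (vec n x) p)"
  unfolding eval_poly_def
proof (intro polyfun_sum polyfun.mult polyfun.const polyfun_prod polyfun_power)
  fix m i assume "m \<in> Poly_Mapping.keys p" "i \<in> Poly_Mapping.keys m"
  then have "i < n" using assms by (auto simp: polys_def)
  then show "polyfun n (\<lambda>x. vec n x $ i)" by auto
qed

lemma polyfun_polys: "polyfun n g \<Longrightarrow> \<exists>p\<in>polys n. \<forall>x. eval_poly (vec n x) p = g x"
proof (induction rule: polyfun.induct)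
  case (const c)
  show ?case
    by (rule bexI[of _ "Poly_Mapping.single 0 c"]) (auto simp: eval_poly_single eval_monom_def polys_single)
next
  case (var i)
  show ?case
    by (rule bexI[of _ "Poly_Mapping.single (Poly_Mapping.single i 1) 1"])
       (use var in \<open>auto simp: eval_poly_single eval_monom_def intro!: polys_single\<close>)
next
  case (add g h)
  then show ?case by (metis eval_poly_add polys_add)
next
  case (mult g h)
  then show ?case by (metis eval_poly_mult polys_mult)
qed

section \<open>Formal partial derivatives\<close>

lemma polys_partial_deriv:
  assumes "p \<in> polys n"
  shows "partial_deriv j p \<in> polys n"
  unfolding partial_deriv_def
proof (intro polys_sum polys_single)
  fix m assume "m \<in> Poly_Mapping.keys p"
  then have "Poly_Mapping.keys m \<subseteq> {..<n}" using assms by (auto simp: polys_def)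
  moreover have "Poly_Mapping.keys (m - Poly_Mapping.single j 1) \<subseteq> Poly_Mapping.keys m"
    by (auto simp: in_keys_iff lookup_minus)
  ultimately show "Poly_Mapping.keys (m - Poly_Mapping.single j 1) \<subseteq> {..<n}" by blast
qed

lemma pd_eqI:
  assumes "((\<lambda>s. g (x(j := s))) has_field_derivative d) (at (x j))"
  shows "pd j g x = d"
  unfolding pd_def using assms DERIV_unique by blast

lemma DERIV_pd:
  assumes "polyfun n g" "j < n"
  shows "((\<lambda>s. g (x(j := s))) has_field_derivative pd j g x) (at (x j))"
proof -
  have "((\<lambda>s. g (x(j := s))) has_field_derivative
      (\<Sum>i<n. (if i = j then 1 else 0) * pd i g (x(j := x j)))) (at (x j))"
    by (rule polyfun_chain[OF assms(1)]) auto
  also have "(\<Sum>i<n. (if i = j then 1 else 0) * pd i g (x(j := x j))) = (\<Sum>i<n. if i = j then pd j g x else 0)"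
    by (rule sum.cong) auto
  also have "\<dots> = pd j g x" using assms(2) by simp
  finally show ?thesis .
qed

lemma eval_partial_deriv:
  assumes p: "p \<in> polys n" and j: "j < n"
  shows "eval_poly (vec n x) (partial_deriv j p) = pd j (\<lambda>x. eval_poly (vec n x) p) x"
proof (rule pd_eqI[symmetric])
  have "((\<lambda>s. Poly_Mapping.lookup p m * eval_monom (vec n (x(j := s))) m) has_field_derivative
      of_nat (Poly_Mapping.lookup m j) * Poly_Mapping.lookup p m * eval_monom (vec n x) (m - Poly_Mapping.single j 1)) (at (x j))"
    if m: "m \<in> Poly_Mapping.keys p" for m
  proof -
    have km: "Poly_Mapping.keys m \<subseteq> {..<n}" using m p by (auto simp: polys_def)
    moreover have "Poly_Mapping.keys (m - Poly_Mapping.single j 1) \<subseteq> Poly_Mapping.keys m"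
      by (auto simp: in_keys_iff lookup_minus)
    ultimately have km': "Poly_Mapping.keys (m - Poly_Mapping.single j 1) \<subseteq> {..<n}" by blast
    \<comment> \<open>The part of the monomial free of the variable \<open>j\<close>. If that
      variable has exponent \<open>0\<close>, the truncated exponent below is harmless, since its
      coefficient is \<open>0\<close>.\<close>
    define c where "c = (\<Prod>i\<in>{..<n} - {j}. x i ^ Poly_Mapping.lookup m i)"
    have 1: "eval_monom (vec n (x(j := s))) m = s ^ Poly_Mapping.lookup m j * c" for s
      unfolding eval_monom_superset[OF finite_lessThan km] c_def using j
      by (subst prod.remove[of _ j]) auto
    have 2: "eval_monom (vec n x) (m - Poly_Mapping.single j 1) = x j ^ (Poly_Mapping.lookup m j - 1) * c"
      unfolding eval_monom_superset[OF finite_lessThan km'] c_def using j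
      by (subst prod.remove[of _ j]) (auto simp: lookup_minus lookup_single)
    show ?thesis
      unfolding 1 2 by (auto intro!: derivative_eq_intros)
  qed
  then have "((\<lambda>s. \<Sum>m\<in>Poly_Mapping.keys p. Poly_Mapping.lookup p m * eval_monom (vec n (x(j := s))) m) has_field_derivative
      (\<Sum>m\<in>Poly_Mapping.keys p. of_nat (Poly_Mapping.lookup m j) * Poly_Mapping.lookup p m *
        eval_monom (vec n x) (m - Poly_Mapping.single j 1))) (at (x j))"
    by (rule DERIV_sum)
  moreover have "eval_poly (vec n (x(j := s))) p =
      (\<Sum>m\<in>Poly_Mapping.keys p. Poly_Mapping.lookup p m * eval_monom (vec n (x(j := s))) m)" for s
    by (rule eval_poly_superset) auto
  moreover have "eval_poly (vec n x) (partial_deriv j p) =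
      (\<Sum>m\<in>Poly_Mapping.keys p. of_nat (Poly_Mapping.lookup m j) * Poly_Mapping.lookup p m *
        eval_monom (vec n x) (m - Poly_Mapping.single j 1))"
    by (simp only: partial_deriv_def eval_poly_sum eval_poly_single)
  ultimately show "((\<lambda>s. eval_poly (vec n (x(j := s))) p) has_field_derivative
      eval_poly (vec n x) (partial_deriv j p)) (at (x j))"
    by (simp only:)
qed

lemma lookup_partial_deriv:
  "Poly_Mapping.lookup (partial_deriv j p) k =
    of_nat (Suc (Poly_Mapping.lookup k j)) * Poly_Mapping.lookup p (k + Poly_Mapping.single j 1)"
proof -
  let ?e = "Poly_Mapping.single j (1 :: nat)"
  have "Poly_Mapping.lookup (partial_deriv j p) k =
      (\<Sum>m\<in>Poly_Mapping.keys p. if m = k + ?e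
        then of_nat (Suc (Poly_Mapping.lookup k j)) * Poly_Mapping.lookup p (k + ?e) else 0)"
    unfolding partial_deriv_def lookup_sum
  proof (rule sum.cong[OF refl])
    fix m
    show "Poly_Mapping.lookup (Poly_Mapping.single (m - ?e) (of_nat (Poly_Mapping.lookup m j) * Poly_Mapping.lookup p m)) k =
      (if m = k + ?e then of_nat (Suc (Poly_Mapping.lookup k j)) * Poly_Mapping.lookup p (k + ?e) else 0)"
    proof (cases "m = k + ?e")
      case True
      then show ?thesis by (simp add: lookup_single lookup_add)
    next
      case False
      \<comment> \<open>Truncation may send other monomials to \<open>k\<close>, but only ones
        without the variable \<open>j\<close>, and these carry the coefficient
        \<open>0\<close>.\<close>
      have "Poly_Mapping.lookup m j = 0" if "m - ?e = k"
      proof (rule ccontr)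
        assume "Poly_Mapping.lookup m j \<noteq> 0"
        then have "m = (m - ?e) + ?e"
          by (intro poly_mapping_eqI) (auto simp: lookup_add lookup_minus lookup_single when_def)
        with that False show False by simp
      qed
      then show ?thesis using False by (auto simp: lookup_single when_def)
    qed
  qed
  also have "\<dots> = of_nat (Suc (Poly_Mapping.lookup k j)) * Poly_Mapping.lookup p (k + ?e)"
    by (auto simp: in_keys_iff)
  finally show ?thesis .
qed

text \<open>Induction over the total degree of the monomial: the constant coefficient is the value
  at the origin; any other is, up to a nonzero integer, a coefficient of lower degree in a partial
  derivative, which again vanishes everywhere.\<close>

lemma polys_eq_zero:
  assumes "p \<in> polys n" "\<And>x. eval_poly (vec n x) p = 0"
  shows "p = 0"
proof -
  have "Poly_Mapping.lookup p m = 0"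
    if "p \<in> polys n" "\<forall>x. eval_poly (vec n x) p = 0" "(\<Sum>i\<in>Poly_Mapping.keys m. Poly_Mapping.lookup m i) = N" for p m N
    using that
  proof (induction N arbitrary: p m)
    case 0
    have "m = 0"
    proof (rule poly_mapping_eqI)
      fix i
      show "Poly_Mapping.lookup m i = Poly_Mapping.lookup 0 i"
        using 0(3) by (cases "i \<in> Poly_Mapping.keys m") (auto simp: in_keys_iff)
    qed
    have "eval_monom (vec n (\<lambda>_. 0)) k = 0" if k: "k \<in> Poly_Mapping.keys p" "k \<noteq> 0" for k
    proof -
      obtain i where "i \<in> Poly_Mapping.keys k" using k(2) by (metis all_not_in_conv keys_eq_empty)
      moreover from this have "i < n" using k 0(1) by (auto simp: polys_def)
      ultimately show ?thesis
        unfolding eval_monom_def by (intro prod_zero) (auto simp: in_keys_iff intro!: bexI[of _ i])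
    qed
    then have "eval_poly (vec n (\<lambda>_. 0)) p = (\<Sum>k\<in>Poly_Mapping.keys p. if k = 0 then Poly_Mapping.lookup p 0 else 0)"
      unfolding eval_poly_superset[OF finite_keys order_refl]
      by (intro sum.cong refl) (auto simp: eval_monom_def)
    then show ?case
      using 0(2) \<open>m = 0\<close> by (auto simp: in_keys_iff split: if_splits)
  next
    case (Suc N)
    let ?e = "\<lambda>j. Poly_Mapping.single j (1 :: nat)"
    obtain j where j: "j \<in> Poly_Mapping.keys m"
      using Suc.prems(3) by (metis empty_iff all_not_in_conv sum.empty nat.distinct(1))
    show ?case
    proof (cases "j < n")
      case False
      then have "m \<notin> Poly_Mapping.keys p" using Suc.prems(1) j by (auto simp: polys_def)
      then show ?thesis by (simp add: in_keys_iff)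
    next
      case True
      have m: "m = (m - ?e j) + ?e j"
        using j by (intro poly_mapping_eqI) (auto simp: lookup_add lookup_minus lookup_single when_def in_keys_iff)
      have "(\<Sum>i\<in>Poly_Mapping.keys m. Poly_Mapping.lookup m i) =
          (\<Sum>i\<in>Poly_Mapping.keys m. Poly_Mapping.lookup (m - ?e j) i + (if i = j then 1 else 0))"
        using j by (intro sum.cong refl) (auto simp: lookup_minus lookup_single when_def in_keys_iff)
      also have "\<dots> = (\<Sum>i\<in>Poly_Mapping.keys m. Poly_Mapping.lookup (m - ?e j) i) + 1"
        using j by (simp add: sum.distrib)
      also have "(\<Sum>i\<in>Poly_Mapping.keys m. Poly_Mapping.lookup (m - ?e j) i) =
          (\<Sum>i\<in>Poly_Mapping.keys (m - ?e j). Poly_Mapping.lookup (m - ?e j) i)"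
        by (rule sum.mono_neutral_right) (auto simp: in_keys_iff lookup_minus)
      finally have "(\<Sum>i\<in>Poly_Mapping.keys (m - ?e j). Poly_Mapping.lookup (m - ?e j) i) = N"
        using Suc.prems(3) by simp
      moreover have "eval_poly (vec n x) (partial_deriv j p) = 0" for x
        unfolding eval_partial_deriv[OF Suc.prems(1) True] using Suc.prems(2)
        by (intro pd_eqI) simp
      ultimately have "Poly_Mapping.lookup (partial_deriv j p) (m - ?e j) = 0"
        using Suc.IH polys_partial_deriv[OF Suc.prems(1)] by blast
      then have "Poly_Mapping.lookup p ((m - ?e j) + ?e j) = 0"
        unfolding lookup_partial_deriv by (simp del: of_nat_Suc)
      then show ?thesis using m by simp
    qed
  qed
  with assms show ?thesis by (intro poly_mapping_eqI) simp
qed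

section \<open>The equivalence\<close>

lemma vec_surj: "X \<in> carrier_vec n \<Longrightarrow> X = vec n (\<lambda>i. X $ i)"
  by (intro eq_vecI) auto

lemma morphismD: "morphism n G \<Longrightarrow> i < n \<Longrightarrow> polyfun n (\<lambda>x. eval_poly (vec n x) (G $ i))"
  by (rule polys_polyfun) (simp add: morphism_def)

lemma eval_morphism_vec:
  "morphism n G \<Longrightarrow> eval_morphism G (vec n x) = vec n (\<lambda>i. eval_poly (vec n x) (G $ i))"
  by (intro eq_vecI) (auto simp: eval_morphism_def morphism_def)

lemma morphism_ex:
  assumes "\<And>i. i < n \<Longrightarrow> polyfun n (g i)"
  shows "\<exists>G. morphism n G \<and> (\<forall>i<n. \<forall>x. eval_poly (vec n x) (G $ i) = g i x)"
proof -
  have "\<forall>i. \<exists>p. i < n \<longrightarrow> p \<in> polys n \<and> (\<forall>x. eval_poly (vec n x) p = g i x)"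
    using polyfun_polys[OF assms] by blast
  from choice[OF this] obtain p where "\<forall>i<n. p i \<in> polys n \<and> (\<forall>x. eval_poly (vec n x) (p i) = g i x)" by blast
  then show ?thesis by (intro exI[of _ "vec n p"]) (simp add: morphism_def)
qed

lemma eval_jacobi_mat:
  assumes "morphism n G"
  shows "map_mat (eval_poly (vec n x)) (jacobi_mat G) = mat n n (\<lambda>(i, j). pd j (\<lambda>x. eval_poly (vec n x) (G $ i)) x)"
  using assms by (intro eq_matI) (auto simp: jacobi_mat_def morphism_def eval_partial_deriv)

lemma jacobi_mat_carrier: "morphism n G \<Longrightarrow> jacobi_mat G \<in> carrier_mat n n"
  by (auto simp: jacobi_mat_def morphism_def)

lemma eval_jacobian:
  assumes "morphism n G"
  shows "eval_poly (vec n x) (jacobian G) = det (mat n n (\<lambda>(i, j). pd j (\<lambda>x. eval_poly (vec n x) (G $ i)) x))"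
  unfolding jacobian_def eval_hom.hom_det[symmetric] eval_jacobi_mat[OF assms] ..

lemma polys_pow_mat:
  assumes A: "A \<in> carrier_mat n n" and p: "\<And>i j. i < n \<Longrightarrow> j < n \<Longrightarrow> A $$ (i, j) \<in> polys m"
  shows "i < n \<Longrightarrow> j < n \<Longrightarrow> (A ^\<^sub>m k) $$ (i, j) \<in> polys m"
proof (induction k arbitrary: j)
  case 0
  then show ?case using A by (simp add: polys_zero polys_one)
next
  case (Suc k)
  have "A ^\<^sub>m k \<in> carrier_mat n n" using A by simp
  then have "(A ^\<^sub>m Suc k) $$ (i, j) = (\<Sum>l<n. (A ^\<^sub>m k) $$ (i, l) * A $$ (l, j))"
    using A Suc.prems by (simp add: scalar_prod_def lessThan_atLeast0)
  also have "\<dots> \<in> polys m"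
    using Suc p by (intro polys_sum polys_mult) auto
  finally show ?case .
qed

text \<open>Evaluation commutes with matrix powers, and by \<open>polys_eq_zero\<close> a polynomial
  entry is zero once it is zero at every point.\<close>

lemma nilpotent_morphism_iff:
  assumes G: "morphism n G"
  shows "nilpotent_morphism n G \<longleftrightarrow>
    (\<forall>x. mat n n (\<lambda>(i, j). pd j (\<lambda>x. eval_poly (vec n x) (G $ i)) x) ^\<^sub>m n = 0\<^sub>m n n)"
proof -
  let ?J = "jacobi_mat G"
  have J: "?J \<in> carrier_mat n n" using jacobi_mat_carrier[OF G] .
  have pow: "mat n n (\<lambda>(i, j). pd j (\<lambda>x. eval_poly (vec n x) (G $ i)) x) ^\<^sub>m n =
      map_mat (eval_poly (vec n x)) (?J ^\<^sub>m n)" for x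
    unfolding eval_jacobi_mat[OF G, symmetric] by (rule eval_hom.mat_hom_pow[OF J, symmetric])
  have "?J ^\<^sub>m n = 0\<^sub>m n n" if zero: "\<forall>x. map_mat (eval_poly (vec n x)) (?J ^\<^sub>m n) = 0\<^sub>m n n"
  proof (rule eq_matI)
    fix i j assume "i < dim_row (0\<^sub>m n n :: cpoly mat)" "j < dim_col (0\<^sub>m n n :: cpoly mat)"
    then have ij: "i < n" "j < n" by auto
    have "(?J ^\<^sub>m n) $$ (i, j) = 0"
    proof (rule polys_eq_zero)
      show "(?J ^\<^sub>m n) $$ (i, j) \<in> polys n"
        using G by (intro polys_pow_mat[OF J] ij) (auto simp: jacobi_mat_def morphism_def intro!: polys_partial_deriv)
      fix x
      have "eval_poly (vec n x) ((?J ^\<^sub>m n) $$ (i, j)) = map_mat (eval_poly (vec n x)) (?J ^\<^sub>m n) $$ (i, j)"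
        using ij J by simp
      then show "eval_poly (vec n x) ((?J ^\<^sub>m n) $$ (i, j)) = 0" using zero ij by simp
    qed
    then show "(?J ^\<^sub>m n) $$ (i, j) = 0\<^sub>m n n $$ (i, j)" using ij by simp
  qed (use J in auto)
  moreover have "map_mat (eval_poly (vec n x)) (0\<^sub>m n n) = 0\<^sub>m n n" for x
    by (intro eq_matI) (auto simp: eval_poly_zero)
  ultimately show ?thesis
    using G unfolding nilpotent_morphism_def pow by auto
qed

lemma fixed_point_vec:
  "morphism n G \<Longrightarrow> fixed_point n G (vec n x) \<longleftrightarrow> (\<forall>i<n. eval_poly (vec n x) (G $ i) = x i)"
  by (auto simp: fixed_point_def eval_morphism_vec vec_eq_iff)

lemma JN_imp_unique_fixed_points:
  assumes "JN n"
  shows "unique_fixed_points n"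
  unfolding unique_fixed_points_def
proof (intro allI impI)
  fix N x y i
  assume N: "\<forall>i<n. polyfun n (N i)" and nil: "\<forall>z. mat n n (\<lambda>(i, j). pd j (N i) z) ^\<^sub>m n = 0\<^sub>m n n"
    and fx: "\<forall>i<n. N i x = x i" "\<forall>i<n. N i y = y i" and i: "i < n"
  obtain G where G: "morphism n G" "\<forall>i<n. \<forall>x. eval_poly (vec n x) (G $ i) = N i x"
    using morphism_ex[of n N] N by blast
  have "mat n n (\<lambda>(i, j). pd j (\<lambda>x. eval_poly (vec n x) (G $ i)) z) = mat n n (\<lambda>(i, j). pd j (N i) z)" for z
    using G(2) by (intro eq_matI) auto
  then have "nilpotent_morphism n G"
    using nil by (simp add: nilpotent_morphism_iff[OF G(1)])
  moreover have "fixed_point n G (vec n x)" "fixed_point n G (vec n y)"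
    using fx G by (auto simp: fixed_point_vec)
  ultimately have "vec n x = vec n y"
    using assms unfolding JN_def by blast
  then show "x i = y i" using i by (metis index_vec)
qed

text \<open>The nilpotent map lives in \<open>n * K\<close> variables with \<open>K\<close>
  depending on the degrees, so a single \<open>n\<close> calls on (2) in dimensions without
  bound.\<close>

lemma JC_if_JN:
  assumes JN: "\<And>m. m \<ge> 1 \<Longrightarrow> JN m" and n: "n \<ge> 1"
  shows "JC n"
  unfolding JC_def
proof (intro allI impI, elim conjE)
  fix G assume G: "morphism n G" and nz: "\<forall>x\<in>carrier_vec n. eval_poly x (jacobian G) \<noteq> 0"
  define f where "f i = (\<lambda>x. eval_poly (vec n x) (G $ i))" for i
  interpret etale n f
  proof
    show "polyfun n (f i)" if "i < n" for i using morphismD[OF G that] by (simp add: f_def)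
    show "det (mat n n (\<lambda>(i, j). pd j (f i) x)) \<noteq> 0" for x
      using nz unfolding f_def eval_jacobian[OF G, symmetric] by simp
  qed
  interpret injective_etale n f
  proof
    fix x z i assume "\<And>i. i < n \<Longrightarrow> f i x = f i z" "i < n"
    then show "x i = z i"
      using unique_fixed_points_imp_injective[OF JN_imp_unique_fixed_points[OF JN] n] by blast
  qed
  from polynomial_inverse[OF n] obtain g where g: "\<forall>i<n. polyfun n (g i)"
    and gF: "\<forall>x. \<forall>i<n. g i (F x) = x i" and fg: "\<forall>y. \<forall>j<n. f j (\<lambda>i. g i y) = y j"
    by (elim exE conjE)
  obtain I where I: "morphism n I" and I_eq: "\<forall>i<n. \<forall>x. eval_poly (vec n x) (I $ i) = g i x"
    using morphism_ex[of n g] g by blast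
  have GF: "eval_morphism G (vec n x) = vec n (F x)" for x
    by (simp add: eval_morphism_vec[OF G] F_def f_def)
  have Ig: "eval_morphism I (vec n y) = vec n (\<lambda>i. g i y)" for y
    unfolding eval_morphism_vec[OF I] using I_eq by (intro eq_vecI) auto
  have "eval_morphism I (eval_morphism G X) = X \<and> eval_morphism G (eval_morphism I X) = X"
    if X: "X \<in> carrier_vec n" for X
  proof -
    have "eval_morphism I (eval_morphism G (vec n x)) = vec n x" for x
      unfolding GF Ig using gF by (intro eq_vecI) auto
    moreover have "eval_morphism G (eval_morphism I (vec n x)) = vec n x" for x
      unfolding Ig GF using fg by (intro eq_vecI) (auto simp: F_def)
    ultimately show ?thesis using vec_surj[OF X] by metis
  qed
  with G I show "isomorphism n G" unfolding isomorphism_def by blast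
qed

text \<open>With \<open>A\<close> the Jacobian matrix of \<open>N\<close> at a point, a kernel
  vector of \<open>1 - A\<close> is fixed by \<open>A\<close>, hence by its \<open>n\<close>-th
  power, which is \<open>0\<close>. So the Jacobian of \<open>X - N\<close> has no zero; this
  direction stays in one dimension.\<close>

lemma JN_if_JC:
  assumes JC: "JC n"
  shows "JN n"
  unfolding JN_def
proof (intro allI impI, elim conjE)
  fix N X Y assume N: "nilpotent_morphism n N" and fX: "fixed_point n N X" and fY: "fixed_point n N Y"
  have mN: "morphism n N" using N by (simp add: nilpotent_morphism_def)
  define h where "h i = (\<lambda>x. eval_poly (vec n x) (N $ i))" for i
  have h: "polyfun n (h i)" if "i < n" for i using morphismD[OF mN that] by (simp add: h_def)
  obtain G where G: "morphism n G" and G_eq: "\<forall>i<n. \<forall>x. eval_poly (vec n x) (G $ i) = x i - h i x"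
    using morphism_ex[of n "\<lambda>i x. x i - h i x", OF polyfun_diff[OF polyfun.var h]] by blast
  have "eval_poly (vec n x) (jacobian G) \<noteq> 0" for x
  proof
    assume zero: "eval_poly (vec n x) (jacobian G) = 0"
    define A where "A = mat n n (\<lambda>(i, j). pd j (h i) x)"
    define B where "B = mat n n (\<lambda>(i, j). (if i = j then 1 else 0) - pd j (h i) x)"
    have A: "A \<in> carrier_mat n n" and B: "B \<in> carrier_mat n n" by (simp_all add: A_def B_def)
    have An: "A ^\<^sub>m n = 0\<^sub>m n n"
      using N unfolding nilpotent_morphism_iff[OF mN] A_def h_def by blast
    have "mat n n (\<lambda>(i, j). pd j (\<lambda>x. eval_poly (vec n x) (G $ i)) x) = B"
    proof (rule eq_matI)
      fix i j assume "i < dim_row B" "j < dim_col B"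
      then have ij: "i < n" "j < n" by (auto simp: B_def)
      have "pd j (\<lambda>x. eval_poly (vec n x) (G $ i)) x = (if i = j then 1 else 0) - pd j (h i) x"
      proof (rule pd_eqI)
        have "((\<lambda>s. (x(j := s)) i) has_field_derivative (if i = j then 1 else 0)) (at (x j))" by auto
        from DERIV_diff[OF this DERIV_pd[OF h[OF ij(1)] ij(2), of x]]
        show "((\<lambda>s. eval_poly (vec n (x(j := s))) (G $ i)) has_field_derivative
            (if i = j then 1 else 0) - pd j (h i) x) (at (x j))"
          by (simp only: G_eq[rule_format, OF ij(1)])
      qed
      then show "mat n n (\<lambda>(i, j). pd j (\<lambda>x. eval_poly (vec n x) (G $ i)) x) $$ (i, j) = B $$ (i, j)"
        using ij by (simp add: B_def)
    qed (auto simp: B_def)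
    then have "det B = 0" using zero unfolding eval_jacobian[OF G] by simp
    then obtain v where v: "v \<in> carrier_vec n" "v \<noteq> 0\<^sub>v n" "B *\<^sub>v v = 0\<^sub>v n"
      using det_0_iff_vec_prod_zero_field[OF B] by blast
    have Av: "A *\<^sub>v v = v"
    proof (rule eq_vecI)
      fix i assume "i < dim_vec v"
      then have i: "i < n" using v by simp
      have "0 = (\<Sum>j<n. ((if i = j then 1 else 0) - pd j (h i) x) * v $ j)"
        using arg_cong[OF v(3), of "\<lambda>w. w $ i"] i v(1) by (simp add: B_def scalar_prod_def lessThan_atLeast0)
      also have "\<dots> = (\<Sum>j<n. (if i = j then v $ i else 0)) - (\<Sum>j<n. pd j (h i) x * v $ j)"
        unfolding sum_subtractf[symmetric] by (rule sum.cong) (auto simp: algebra_simps)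
      also have "(\<Sum>j<n. pd j (h i) x * v $ j) = (A *\<^sub>v v) $ i"
        using i v(1) by (simp add: A_def scalar_prod_def lessThan_atLeast0)
      finally show "(A *\<^sub>v v) $ i = v $ i" using i by simp
    qed (use v A in auto)
    have "A ^\<^sub>m k *\<^sub>v v = v" for k
    proof (induction k)
      case 0
      then show ?case using A v by simp
    next
      case (Suc k)
      have "A ^\<^sub>m Suc k *\<^sub>v v = A ^\<^sub>m k *\<^sub>v (A *\<^sub>v v)"
        using A v by (simp add: assoc_mult_mat_vec[of _ n n _ n])
      then show ?case using Suc by (simp add: Av)
    qed
    from this[of n] have "v = 0\<^sub>m n n *\<^sub>v v" by (simp add: An)
    also have "\<dots> = 0\<^sub>v n" using v(1) by (intro eq_vecI) (auto simp: scalar_prod_def)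
    finally show False using v(2) by simp
  qed
  then have "\<forall>X\<in>carrier_vec n. eval_poly X (jacobian G) \<noteq> 0"
    using vec_surj by metis
  with JC G have "isomorphism n G" unfolding JC_def by blast
  then obtain I where I: "\<And>X. X \<in> carrier_vec n \<Longrightarrow> eval_morphism I (eval_morphism G X) = X"
    unfolding isomorphism_def by blast
  have zero: "X' \<in> carrier_vec n \<and> eval_morphism G X' = 0\<^sub>v n" if "fixed_point n N X'" for X'
  proof -
    have X': "X' \<in> carrier_vec n" using that by (simp add: fixed_point_def)
    define x where "x i = X' $ i" for i
    have Xx: "X' = vec n x" using vec_surj[OF X'] by (simp add: x_def[abs_def])
    have "\<forall>i<n. h i x = x i"
      using that unfolding Xx fixed_point_vec[OF mN] by (simp add: h_def)
    then have "eval_morphism G (vec n x) = 0\<^sub>v n"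
      unfolding eval_morphism_vec[OF G] using G_eq by (intro eq_vecI) auto
    with X' Xx show ?thesis by simp
  qed
  show "X = Y"
    using I[of X] I[of Y] zero[OF fX] zero[OF fY] by metis
qed

theorem theorem2:
  shows "(\<forall>n\<ge>1. JC n) \<longleftrightarrow> (\<forall>n\<ge>1. JN n)"
  using JC_if_JN JN_if_JC by blast

end
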